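(* Let $h>0$, let $g:\mathbb{R}_+\to\mathbb{R}_+$ be Lipschitz continuous with constant $L_g>1$, having exactly two fixed points $0$ and $\kappa>0$, and let $c\ge c(L_g)$, $\lambda_c\in[\lambda_1(c),\lambda_2(c)]$ and $\xi_c(z)=e^{-\lambda_c z}$ (see context). Let $v_0(s,z)$ and $\psi_0(s,z)$, $(s,z)\in[-h,0]\times\mathbb{R}$, be two initial data for $$v_t(t,z)=v_{zz}(t,z)-c v_z(t,z)-v(t,z)+g(v(t-h,z-ch)),\qquad t>0,\ z\in\mathbb{R},$$ with corresponding solutions $v(t,z)$ and $\psi(t,z)$, such that $$u_0(s,z):=\xi_c(z)|v_0(s,z)-\psi_0(s,z)|\in C([-h,0],L^1(\mathbb{R})).$$ Put $m=2\lambda_c-c$, $p=\lambda_c^2-c\lambda_c-1$, $q=L_g e^{-\lambda_c ch}$, and let $u(t,z)$ be the solution of $$u_t(t,z)=u_{zz}(t,z)+m u_z(t,z)+p u(t,z)+q u(t-h,z-ch),\qquad t>0,\ z\in\mathbb{R},$$ with initial datum $u_0$ on $[-h,0]$. Then $$\xi_c(z)|v(t,z)-\psi(t,z)|\le u(t,z)\qquad\text{for all } t\ge -h,\ z\in\mathbb{R}.$$ In particular, $$|v(t,z)-\psi(t,z)|\le A_0\,\xi_c(-z)\,\frac{e^{\gamma t}}{\sqrt t}\qquad\text{for all } t>\frac h2,\ z\in\mathbb{R},$$ where $\gamma$ is the only real (non-positive) solution of $\gamma-p=q e^{-h\gamma}$, $A_0=\tfrac12 C_{u_0}\sqrt{1+h(\gamma-p)}$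 and $C_{u_0}=\sup_{s\in[-h,0]}\|u_0(s,\cdot)\|_{L^1(\mathbb{R})}$.
   Context: $\mathbb{R}_+=[0,\infty)$. For fixed $L>1$ and $c>0$ let $E_c(\lambda)=-\lambda^2+c\lambda+1-Le^{-\lambda ch}$ and $c(L)=\inf\{c>0: E_c(\lambda_0)\ge 0 \text{ for some }\lambda_0\in\mathbb{R}\}$. For $c\ge c(L)$, $\lambda_1(c)\le\lambda_2(c)$ denote the two real solutions (coinciding in the case of a double root) of $E_c(\lambda)=0$; here $L=L_g$. Solutions of the nonlinear equation are nonnegative (the domain of $g$ is $\mathbb{R}_+$) solutions of the Cauchy problem with the given initial data on $[-h,0]\times\mathbb{R}$. The solution of the linear delayed equation with datum in $C([-h,0],L^1(\mathbb{R}))$ is the usual mild solution in $C([-h,\infty),L^1(\mathbb{R}))$. *)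

theory Defs
  imports "HOL-Analysis.Analysis"
begin

definition char_E :: "real \<Rightarrow> real \<Rightarrow> real \<Rightarrow> real \<Rightarrow> real" where
  "char_E h L c l = - l\<^sup>2 + c * l + 1 - L * exp (- l * c * h)"

definition c_min :: "real \<Rightarrow> real \<Rightarrow> real" where
  "c_min h L = Inf {c. c > 0 \<and> (\<exists>l0. char_E h L c l0 \<ge> 0)}"

text \<open>For \<open>L > 1\<close> and \<open>c \<ge> c_min h L\<close> the function \<open>char_E h L c\<close> has two real zeros, or one
  double zero; \<open>lambda1\<close> and \<open>lambda2\<close> are the smaller and the larger one.\<close>

definition lambda1 :: "real \<Rightarrow> real \<Rightarrow> real \<Rightarrow> real" where
  "lambda1 h L c = Min {l. char_E h L c l = 0}"

definition lambda2 :: "real \<Rightarrow> real \<Rightarrow> real \<Rightarrow> real" where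
  "lambda2 h L c = Max {l. char_E h L c l = 0}"

definition xi :: "real \<Rightarrow> real \<Rightarrow> real" where
  "xi l z = exp (- l * z)"

text \<open>Nonnegative classical solutions \<open>v t z\<close> of
  \<open>v_t(t,z) = v_zz(t,z) - c v_z(t,z) - v(t,z) + g(v(t-h,z-ch))\<close> for \<open>t > 0\<close>, with datum \<open>v0\<close> on
  \<open>[-h,0]\<close>: of class \<open>C^1\<close> in \<open>t\<close> and \<open>C^2\<close> in \<open>z\<close> for \<open>t > 0\<close>, and continuous up to \<open>t = 0\<close>.
  No regularity of the datum before time \<open>0\<close> and no growth bound in \<open>z\<close> is imposed. Values of \<open>v\<close>
  at times before \<open>-h\<close> are irrelevant.\<close>

definition delayed_rd_solution ::
  "real \<Rightarrow> real \<Rightarrow> (real \<Rightarrow> real) \<Rightarrow> (real \<Rightarrow> real \<Rightarrow> real) \<Rightarrow> (real \<Rightarrow> real \<Rightarrow> real) \<Rightarrow> bool" where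
  "delayed_rd_solution h c g v0 v \<longleftrightarrow>
     (\<forall>t\<ge>-h. \<forall>z. 0 \<le> v t z) \<and>
     (\<forall>s\<in>{-h..0}. \<forall>z. v s z = v0 s z) \<and>
     continuous_on ({0..} \<times> UNIV) (\<lambda>(t, z). v t z) \<and>
     (\<exists>vt vz vzz.
        continuous_on ({0<..} \<times> UNIV) (\<lambda>(t, z). vt t z) \<and>
        continuous_on ({0<..} \<times> UNIV) (\<lambda>(t, z). vz t z) \<and>
        continuous_on ({0<..} \<times> UNIV) (\<lambda>(t, z). vzz t z) \<and>
        (\<forall>t>0. \<forall>z.
           ((\<lambda>s. v s z) has_real_derivative vt t z) (at t) \<and>
           ((\<lambda>y. v t y) has_real_derivative vz t z) (at z) \<and>
           ((\<lambda>y. vz t y) has_real_derivative vzz t z) (at z) \<and>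
           vt t z = vzz t z - c * vz t z - v t z + g (v (t - h) (z - c * h))))"

definition L1_norm :: "(real \<Rightarrow> real) \<Rightarrow> real" where
  "L1_norm f = (LINT z|lebesgue. \<bar>f z\<bar>)"

text \<open>\<open>u \<in> C(I, L^1(R))\<close>, for a curve given by pointwise defined functions \<open>u t\<close>.\<close>

definition continuous_L1_on :: "real set \<Rightarrow> (real \<Rightarrow> real \<Rightarrow> real) \<Rightarrow> bool" where
  "continuous_L1_on I u \<longleftrightarrow>
     (\<forall>t\<in>I. integrable lebesgue (u t)) \<and>
     (\<forall>t\<in>I. ((\<lambda>s. L1_norm (\<lambda>z. u s z - u t z)) \<longlongrightarrow> 0) (at t within I))"

text \<open>Convolution kernel of the semigroup generated by \<open>w \<mapsto> w'' + m w' + p w\<close>, for \<open>t > 0\<close>.\<close>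

definition semigroup_kernel :: "real \<Rightarrow> real \<Rightarrow> real \<Rightarrow> real \<Rightarrow> real" where
  "semigroup_kernel m p t z = exp (p * t) * exp (- (z + m * t)\<^sup>2 / (4 * t)) / sqrt (4 * pi * t)"

text \<open>Mild solutions in \<open>C([-h,\<infinity>), L^1(R))\<close> of
  \<open>u_t(t,z) = u_zz(t,z) + m u_z(t,z) + p u(t,z) + q u(t-h,z-d)\<close>, \<open>t > 0\<close>, with datum \<open>u0\<close> on
  \<open>[-h,0]\<close>. The variation of constants formula is required at every \<open>z\<close>: for \<open>t > 0\<close> its right
  hand side is defined at every \<open>z\<close> and depends only on the classes of \<open>u0 0\<close> and \<open>u (s - h)\<close> in
  \<open>L^1(R)\<close>, so this selects the canonical representative of the class of \<open>u t\<close>.\<close>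

definition delayed_mild_solution ::
  "real \<Rightarrow> real \<Rightarrow> real \<Rightarrow> real \<Rightarrow> real \<Rightarrow> (real \<Rightarrow> real \<Rightarrow> real) \<Rightarrow> (real \<Rightarrow> real \<Rightarrow> real) \<Rightarrow> bool" where
  "delayed_mild_solution h m p q d u0 u \<longleftrightarrow>
     continuous_L1_on {-h..} u \<and>
     (\<forall>s\<in>{-h..0}. \<forall>z. u s z = u0 s z) \<and>
     (\<forall>t>0. \<forall>z. u t z =
        (LINT y|lebesgue. semigroup_kernel m p t (z - y) * u0 0 y) +
        (LINT s:{0..t}|lebesgue.
           (LINT y|lebesgue. semigroup_kernel m p (t - s) (z - y) * (q * u (s - h) (y - d)))))"

end

theory Submission
  imports Defs "HOL-Probability.Probability"
begin

text \<open>The functions \<open>w = xi lam * (v - \<psi>)\<close> and \<open>S = xi lam * (v + \<psi>)\<close> solve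
  \<open>w_t = w_zz + m w_z + p w + F\<close> with \<open>\<bar>F t z\<bar> \<le> q \<bar>w (t - h) (z - c h)\<bar>\<close>, respectively with a
  nonnegative source, and \<open>\<bar>w\<bar> \<le> S\<close>. Nothing is known about their growth in \<open>z\<close>, so the comparison
  is an argument in the spirit of Widder's uniqueness theorem: pairing \<open>S\<close> with a truncated heat
  kernel, a compactly supported subsolution of the backward equation, bounds all Gaussian means of
  \<open>S\<close> by its values on a compact set. These means control the error made by a cutoff in Green's
  identity for \<open>w\<close>, whence \<open>\<bar>w\<bar>\<close> is bounded by the variation of constants formula with data
  \<open>\<bar>w(0)\<bar>\<close> and \<open>\<bar>F\<bar>\<close>. Induction over time intervals of length \<open>h\<close> gives \<open>\<bar>w\<bar> \<le> u\<close>.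

  For the decay put \<open>a = \<gamma> - p = q e^(- h \<gamma>)\<close>. The Fourier bound of \<open>e^(- \<gamma> t) u\<close> diverges as
  \<open>t \<rightarrow> h/2\<close>; instead \<open>e^(- \<gamma> t) u(t)\<close> is a mixture of Gaussians: a backward clock diffuses, and at
  rate \<open>a\<close> it jumps back by \<open>h\<close>, until it reaches the initial interval. If \<open>\<tau>\<close> is the time spent
  diffusing, the bound is \<open>C / sqrt (4 pi)\<close> times the mean of \<open>1 / sqrt \<tau>\<close>, and the function
  \<open>1 / sqrt (r + t / (pi (1 + a h)))\<close>, where \<open>r\<close> is an additional time of diffusion, is a
  supersolution of the equation for the mean of \<open>1 / sqrt (r + \<tau>)\<close> shortly after \<open>t = h\<close>; up to then
  the first jump alone gives the estimate. The mean of \<open>\<tau>\<close> is about \<open>t / (1 + a h)\<close>; the factor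
  \<open>1 / pi\<close> is the loss which the constant \<open>1/2\<close> of the theorem allows.\<close>

subsection \<open>The kernel\<close>

text \<open>Without a growth condition the heat equation has nonzero solutions with zero data, so
  \<open>\<bar>w\<bar> \<le> u\<close> can only come from a sign: \<open>v\<close> and
  \<open>\<psi>\<close> are nonnegative, hence so is \<open>S\<close>, and this excludes growth of
  Tychonoff's kind. The condition \<open>p \<le> 0\<close>, on which the truncation of the kernel
  and the bounds of its mass rely, comes from \<open>char_E h Lg c lam = - (p + q)\<close>, which is
  nonnegative between the two roots. In the decay each jump also translates \<open>z\<close> by
  \<open>c * h\<close>; since the initial estimate is uniform in \<open>z\<close>, only the two
  times \<open>t\<close> and \<open>r\<close> have to be followed. The threshold
  \<open>h + 1 / (3 * a)\<close> between the two regimes is a balance: the estimate by the first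
  jump deteriorates as \<open>t\<close> grows and there leaves the room \<open>2 * pi / 3\<close>
  for the number \<open>209/100\<close>, while the supersolution argument wants
  \<open>1/3 \<le> a * (s - h)\<close>, because just after time \<open>h\<close> the delayed value
  \<open>diffusion_bound a h (s - h)\<close> is still close to 0.\<close>

lemma semigroup_kernel_nonneg [simp]: "0 \<le> t \<Longrightarrow> 0 \<le> semigroup_kernel m p t z"
  by (simp add: semigroup_kernel_def)

lemma semigroup_kernel_pos: "0 < t \<Longrightarrow> 0 < semigroup_kernel m p t z"
  by (simp add: semigroup_kernel_def)

lemma semigroup_kernel_eq_normal:
  assumes "0 < t"
  shows "semigroup_kernel m p t z = exp (p * t) * normal_density 0 (sqrt (2 * t)) (z + m * t)"
  using assms by (simp add: semigroup_kernel_def normal_density_def field_simps)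

lemma semigroup_kernel_measurable [measurable]: "semigroup_kernel m p t \<in> borel_measurable borel"
  unfolding semigroup_kernel_def by measurable

lemma semigroup_kernel_le:
  assumes "0 < t"
  shows "semigroup_kernel m p t z \<le> exp (p * t) / sqrt (4 * pi * t)"
proof -
  have "exp (- (z + m * t)\<^sup>2 / (4 * t)) \<le> 1" using assms by simp
  then show ?thesis
    unfolding semigroup_kernel_def using assms
    by (intro divide_right_mono) auto
qed

text \<open>Half of the Gaussian exponent is given up to remove the drift:
  \<open>(z + m * t)\<^sup>2\<close> is at least
  \<open>z\<^sup>2 / 2 - m\<^sup>2 * t\<^sup>2\<close>. Together with the matching lower bound this
  reduces all tail comparisons to centred Gaussians.\<close>

lemma semigroup_kernel_le_gauss:
  assumes "0 < t" "p \<le> 0"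
  shows "semigroup_kernel m p t z \<le> exp (m\<^sup>2 * t / 4) * exp (- z\<^sup>2 / (8 * t)) / sqrt (4 * pi * t)"
proof -
  have "0 \<le> (z + 2 * m * t)\<^sup>2" by simp
  then have "z\<^sup>2 / 2 - m\<^sup>2 * t\<^sup>2 \<le> (z + m * t)\<^sup>2"
    by (simp add: power2_eq_square algebra_simps)
  then have "(z\<^sup>2 / 2 - m\<^sup>2 * t\<^sup>2) / (4 * t) \<le> (z + m * t)\<^sup>2 / (4 * t)"
    using assms by (intro divide_right_mono) auto
  moreover have "(z\<^sup>2 / 2 - m\<^sup>2 * t\<^sup>2) / (4 * t) = z\<^sup>2 / (8 * t) - m\<^sup>2 * t / 4"
    using assms by (simp add: field_simps power2_eq_square)
  moreover have "p * t \<le> 0" using assms by (simp add: mult_nonpos_nonneg)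
  ultimately have "p * t + - (z + m * t)\<^sup>2 / (4 * t) \<le> m\<^sup>2 * t / 4 + - z\<^sup>2 / (8 * t)" by simp
  then show ?thesis
    unfolding semigroup_kernel_def exp_add[symmetric] using assms
    by (intro divide_right_mono) auto
qed

lemma semigroup_kernel_ge_gauss:
  assumes "0 < t"
  shows "exp (p * t - m\<^sup>2 * t / 2) * exp (- z\<^sup>2 / (2 * t)) / sqrt (4 * pi * t) \<le> semigroup_kernel m p t z"
proof -
  have "0 \<le> (z - m * t)\<^sup>2" by simp
  then have "(z + m * t)\<^sup>2 \<le> 2 * z\<^sup>2 + 2 * m\<^sup>2 * t\<^sup>2"
    by (simp add: power2_eq_square algebra_simps)
  then have "(z + m * t)\<^sup>2 / (4 * t) \<le> (2 * z\<^sup>2 + 2 * m\<^sup>2 * t\<^sup>2) / (4 * t)"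
    using assms by (intro divide_right_mono) auto
  moreover have "(2 * z\<^sup>2 + 2 * m\<^sup>2 * t\<^sup>2) / (4 * t) = z\<^sup>2 / (2 * t) + m\<^sup>2 * t / 2"
    using assms by (simp add: field_simps power2_eq_square)
  ultimately have "p * t - m\<^sup>2 * t / 2 + - z\<^sup>2 / (2 * t) \<le> p * t + - (z + m * t)\<^sup>2 / (4 * t)" by simp
  then show ?thesis
    unfolding semigroup_kernel_def exp_add[symmetric] using assms
    by (intro divide_right_mono) auto
qed

text \<open>From \<open>X \<le> exp X\<close> with \<open>X = z\<^sup>2 / (8 * t)\<close>. The bound
  tends to 0 both for \<open>t \<rightarrow> 0\<close> at fixed \<open>z\<close> and for large
  \<open>z\<close> uniformly in \<open>t \<le> T\<close>; the two limits confine the set where the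
  kernel exceeds a given level.\<close>

lemma semigroup_kernel_le_inverse_square:
  assumes "0 < t" "t \<le> T" "p \<le> 0" "z \<noteq> 0"
  shows "semigroup_kernel m p t z \<le> exp (m\<^sup>2 * T / 4) * 8 * sqrt t / z\<^sup>2"
proof -
  have "z\<^sup>2 / (8 * t) \<le> exp (z\<^sup>2 / (8 * t))"
    using exp_ge_add_one_self[of "z\<^sup>2 / (8 * t)"] by linarith
  then have "exp (- z\<^sup>2 / (8 * t)) \<le> 8 * t / z\<^sup>2"
    using assms by (simp add: exp_minus field_simps)
  moreover have "exp (m\<^sup>2 * t / 4) \<le> exp (m\<^sup>2 * T / 4)"
    using assms by (simp add: mult_left_mono)
  moreover have "1 * sqrt t \<le> sqrt (4 * pi) * sqrt t"
    using pi_ge_two by (intro mult_right_mono) (auto simp: assms less_imp_le)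
  ultimately have "exp (m\<^sup>2 * t / 4) * exp (- z\<^sup>2 / (8 * t)) / sqrt (4 * pi * t)
      \<le> exp (m\<^sup>2 * T / 4) * (8 * t / z\<^sup>2) / sqrt t"
    using assms by (intro frac_le mult_mono) (auto simp: real_sqrt_mult)
  also have "\<dots> = exp (m\<^sup>2 * T / 4) * 8 * sqrt t / z\<^sup>2"
    using assms by (simp add: field_simps flip: power2_eq_square)
  finally show ?thesis using semigroup_kernel_le_gauss[OF assms(1,3), of m z] by linarith
qed

lemma nn_integral_semigroup_kernel:
  assumes "0 < t"
  shows "(\<integral>\<^sup>+y. ennreal (semigroup_kernel m p t (x - y)) \<partial>lborel) = ennreal (exp (p * t))"
proof -
  have "(\<integral>\<^sup>+y. ennreal (semigroup_kernel m p t (x - y)) \<partial>lborel)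
      = (\<integral>\<^sup>+y. ennreal (exp (p * t) * normal_density 0 (sqrt (2 * t)) (x + m * t - y)) \<partial>lborel)"
    using assms by (simp add: semigroup_kernel_eq_normal algebra_simps)
  also have "\<dots> = (\<integral>\<^sup>+y. ennreal (exp (p * t) * normal_density 0 (sqrt (2 * t)) y) \<partial>lborel)"
    by (subst nn_integral_real_affine[of _ "-1" "x + m * t"]) auto
  also have "\<dots> = ennreal (exp (p * t))"
    using assms by (simp add: ennreal_mult' nn_integral_cmult nn_integral_eq_integral)
  finally show ?thesis .
qed

lemma semigroup_kernel_convolution:
  assumes "0 < r" "0 < t"
  shows "(\<integral>\<^sup>+y. ennreal (semigroup_kernel m p r (z - y)) * ennreal (semigroup_kernel m p t (y - x)) \<partial>lborel)
     = ennreal (semigroup_kernel m p (r + t) (z - x))"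
proof -
  define \<sigma> where "\<sigma> = sqrt (2 * r)"
  define \<tau> where "\<tau> = sqrt (2 * t)"
  have st: "0 < \<sigma>" "0 < \<tau>" "sqrt (\<sigma>\<^sup>2 + \<tau>\<^sup>2) = sqrt (2 * (r + t))"
    using assms by (auto simp: \<sigma>_def \<tau>_def distrib_left)
  define X where "X = z - x + m * (r + t)"
  have "(\<integral>\<^sup>+y. ennreal (semigroup_kernel m p r (z - y)) * ennreal (semigroup_kernel m p t (y - x)) \<partial>lborel)
     = (\<integral>\<^sup>+y. ennreal (exp (p * (r + t))) * ennreal (normal_density 0 \<sigma> (z - y + m * r) * normal_density 0 \<tau> (y - x + m * t)) \<partial>lborel)"
    using assms by (intro nn_integral_cong)
      (simp add: semigroup_kernel_eq_normal \<sigma>_def \<tau>_def algebra_simps exp_add flip: ennreal_mult)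
  also have "\<dots> = ennreal (exp (p * (r + t))) * (\<integral>\<^sup>+y. ennreal (normal_density 0 \<sigma> (z - y + m * r) * normal_density 0 \<tau> (y - x + m * t)) \<partial>lborel)"
    by (intro nn_integral_cmult) auto
  also have "(\<integral>\<^sup>+y. ennreal (normal_density 0 \<sigma> (z - y + m * r) * normal_density 0 \<tau> (y - x + m * t)) \<partial>lborel)
     = (\<integral>\<^sup>+y. ennreal (normal_density 0 \<sigma> (X - y) * normal_density 0 \<tau> y) \<partial>lborel)"
    by (subst nn_integral_real_affine[of _ "1" "x - m * t"]) (auto simp: X_def algebra_simps)
  also have "\<dots> = normal_density 0 (sqrt (\<sigma>\<^sup>2 + \<tau>\<^sup>2)) X"
    using conv_normal_density_zero_mean[OF st(1,2)] by metis
  finally show ?thesis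
    using assms by (simp add: st(3) semigroup_kernel_eq_normal[of "r + t"] X_def ennreal_mult' algebra_simps)
qed

lemma continuous_on_semigroup_kernel:
  assumes "continuous_on A f" "continuous_on A g" "\<And>a. a \<in> A \<Longrightarrow> 0 < f a"
  shows "continuous_on A (\<lambda>a. semigroup_kernel m p (f a) (g a))"
proof -
  have "f a \<noteq> 0" if "a \<in> A" for a using assms(3)[OF that] by simp
  then show ?thesis unfolding semigroup_kernel_def using assms(1,2)
    by (intro continuous_intros) (auto simp: less_imp_le)
qed

text \<open>The kernel with pole \<open>(T, x)\<close>, as a function of its starting point
  \<open>(s, y)\<close>, solves the adjoint equation. \<open>\<eta>\<close> is its logarithmic
  derivative in \<open>y\<close>, so every derivative is \<open>\<kappa>\<close> times a polynomial
  in \<open>\<eta>\<close> and the equation becomes an algebraic identity.\<close>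

locale backward_kernel =
  fixes m p T x :: real
begin

definition "\<kappa> s y = semigroup_kernel m p (T - s) (x - y)"
definition "\<eta> s y = (x - y + m * (T - s)) / (2 * (T - s))"
definition "\<kappa>y s y = \<kappa> s y * \<eta> s y"
definition "\<kappa>yy s y = \<kappa> s y * ((\<eta> s y)\<^sup>2 - 1 / (2 * (T - s)))"
definition "\<kappa>s s y = - (\<kappa> s y * (p - 1 / (2 * (T - s)) - m * \<eta> s y + (\<eta> s y)\<^sup>2))"

lemma backward_equation: "\<kappa>s s y + \<kappa>yy s y - m * \<kappa>y s y + p * \<kappa> s y = 0"
  unfolding \<kappa>s_def \<kappa>yy_def \<kappa>y_def by (simp add: algebra_simps)

lemma kernel_pos: "s < T \<Longrightarrow> 0 < \<kappa> s y"
  by (simp add: \<kappa>_def semigroup_kernel_pos)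

lemma kernel_continuous: "continuous_on ({0..<T} \<times> UNIV) (\<lambda>x. \<kappa> (fst x) (snd x))"
  unfolding \<kappa>_def by (intro continuous_on_semigroup_kernel continuous_intros) auto

lemma kernel_derivs_continuous:
  shows "continuous_on ({0<..<T} \<times> UNIV) (\<lambda>x. \<kappa> (fst x) (snd x))"
    and "continuous_on ({0<..<T} \<times> UNIV) (\<lambda>x. \<kappa>y (fst x) (snd x))"
    and "continuous_on ({0<..<T} \<times> UNIV) (\<lambda>x. \<kappa>yy (fst x) (snd x))"
    and "continuous_on ({0<..<T} \<times> UNIV) (\<lambda>x. \<kappa>s (fst x) (snd x))"
proof -
  show c\<kappa>: "continuous_on ({0<..<T} \<times> UNIV) (\<lambda>x. \<kappa> (fst x) (snd x))"
    by (rule continuous_on_subset[OF kernel_continuous]) auto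
  have ne: "2 * (T - fst z) \<noteq> 0" if "z \<in> {0<..<T} \<times> UNIV" for z :: "real \<times> real"
    using that by auto
  have c\<eta>: "continuous_on ({0<..<T} \<times> UNIV) (\<lambda>x. \<eta> (fst x) (snd x))"
    unfolding \<eta>_def by (intro continuous_intros) auto
  show "continuous_on ({0<..<T} \<times> UNIV) (\<lambda>x. \<kappa>y (fst x) (snd x))"
    "continuous_on ({0<..<T} \<times> UNIV) (\<lambda>x. \<kappa>yy (fst x) (snd x))"
    "continuous_on ({0<..<T} \<times> UNIV) (\<lambda>x. \<kappa>s (fst x) (snd x))"
    unfolding \<kappa>y_def \<kappa>yy_def \<kappa>s_def using ne by (intro continuous_intros c\<kappa> c\<eta>; simp)+
qed

lemma kernel_derivs:
  assumes "s < T"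
  shows "((\<lambda>y. \<kappa> s y) has_real_derivative \<kappa>y s y) (at y within Y)"
    and "((\<lambda>y. \<kappa>y s y) has_real_derivative \<kappa>yy s y) (at y within Y)"
    and "((\<lambda>s. \<kappa> s y) has_real_derivative \<kappa>s s y) (at s within S)"
  unfolding \<kappa>y_def \<kappa>yy_def \<kappa>s_def
proof -
  have pos: "0 < T - s" using assms by simp
  have e1: "((\<lambda>y. - ((x - y + m * (T - s))\<^sup>2 / (4 * (T - s)))) has_real_derivative \<eta> s y) (at y within Y)"
  proof -
    define A where "A = x - y + m * (T - s)"
    define B where "B = T - s"
    have "((\<lambda>y. - ((x - y + m * (T - s))\<^sup>2 / (4 * (T - s)))) has_real_derivative - ((2 * A * (- 1)) / (4 * B))) (at y within Y)"
      unfolding A_def B_def using pos by (auto intro!: derivative_eq_intros)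
    moreover have "- ((2 * A * (- 1)) / (4 * B)) = A / (2 * B)" by simp
    moreover have "A / (2 * B) = \<eta> s y" by (simp only: A_def B_def \<eta>_def)
    ultimately show ?thesis by metis
  qed
  have k: "\<kappa> s y = exp (p * (T - s)) * exp (- ((x - y + m * (T - s))\<^sup>2 / (4 * (T - s)))) * inverse (sqrt (4 * pi * (T - s)))" for s y
    by (simp add: \<kappa>_def semigroup_kernel_def divide_inverse)
  show 1: "((\<lambda>y. \<kappa> s y) has_real_derivative \<kappa> s y * \<eta> s y) (at y within Y)"
    unfolding k by (rule derivative_eq_intros e1 refl | simp)+
  have 2: "((\<lambda>y. \<eta> s y) has_real_derivative - 1 / (2 * (T - s))) (at y within Y)"
    unfolding \<eta>_def by (rule DERIV_cdivide) (auto intro!: derivative_eq_intros)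
  show "((\<lambda>y. \<kappa> s y * \<eta> s y) has_real_derivative \<kappa> s y * ((\<eta> s y)\<^sup>2 - 1 / (2 * (T - s)))) (at y within Y)"
    by (rule DERIV_cong[OF DERIV_mult[OF 1 2]]) (simp add: algebra_simps power2_eq_square)
  have e: "((\<lambda>s. (x - y + m * (T - s))\<^sup>2 / (4 * (T - s))) has_real_derivative
      (\<eta> s y)\<^sup>2 - m * \<eta> s y) (at s within S)"
  proof -
    define A where "A = x - y + m * (T - s)"
    define B where "B = T - s"
    have "((\<lambda>s. (x - y + m * (T - s))\<^sup>2 / (4 * (T - s))) has_real_derivative
       ((2 * A * (- m)) * (4 * B) - A\<^sup>2 * (- 4)) / ((4 * B) * (4 * B))) (at s within S)"
      unfolding A_def B_def using pos by (auto intro!: derivative_eq_intros)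
    moreover have "((2 * A * (- m)) * (4 * B) - A\<^sup>2 * (- 4)) / ((4 * B) * (4 * B)) = (A / (2 * B))\<^sup>2 - m * (A / (2 * B))"
      using pos[folded B_def] by (simp add: field_simps power2_eq_square)
    moreover have "A / (2 * B) = \<eta> s y" by (simp only: A_def B_def \<eta>_def)
    ultimately show ?thesis by metis
  qed
  have q: "((\<lambda>s. inverse (sqrt (4 * pi * (T - s)))) has_real_derivative
      inverse (sqrt (4 * pi * (T - s))) * (1 / (2 * (T - s)))) (at s within S)"
  proof -
    define b where "b = sqrt (T - s)"
    have b: "b > 0" "T - s = b\<^sup>2" using pos by (auto simp: b_def)
    have "((\<lambda>s. sqrt (T - s)) has_real_derivative inverse b / 2 * (- 1)) (at s within S)"
      unfolding b_def by (rule DERIV_chain2[where f = sqrt and g = "\<lambda>s. T - s", OF DERIV_real_sqrt[OF pos]]) (auto intro!: derivative_eq_intros)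
    from DERIV_cmult[OF DERIV_inverse'[OF this], of "inverse (sqrt (4 * pi))"] b(1)
    have "((\<lambda>s. inverse (sqrt (4 * pi)) * inverse (sqrt (T - s))) has_real_derivative
        inverse (sqrt (4 * pi)) * - (inverse b * (inverse b / 2 * (- 1)) * inverse b)) (at s within S)"
      by (simp add: b_def)
    moreover have "inverse (sqrt (4 * pi)) * - (inverse b * (inverse b / 2 * (- 1)) * inverse b)
        = inverse (sqrt (4 * pi * (T - s))) * (1 / (2 * (T - s)))"
      using b(1) unfolding b(2) by (simp add: real_sqrt_mult field_simps power2_eq_square)
    moreover have "inverse (sqrt (4 * pi * (T - s))) = inverse (sqrt (4 * pi)) * inverse (sqrt (T - s))" for s
      by (simp add: real_sqrt_mult)
    ultimately show ?thesis by (simp only:)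
  qed
  show "((\<lambda>s. \<kappa> s y) has_real_derivative
      - (\<kappa> s y * (p - 1 / (2 * (T - s)) - m * \<eta> s y + (\<eta> s y)\<^sup>2))) (at s within S)"
    unfolding k
    by (rule derivative_eq_intros e q refl | simp)+ (simp add: algebra_simps)
qed

end

subsection \<open>Green's identity and growth of supersolutions\<close>

text \<open>The source \<open>F\<close> is an arbitrary given function: the delayed term is treated
  as known, and the linear theory contains no delay.\<close>

definition classical_solution ::
  "real \<Rightarrow> real \<Rightarrow> (real \<Rightarrow> real \<Rightarrow> real) \<Rightarrow> (real \<Rightarrow> real \<Rightarrow> real) \<Rightarrow> bool" where
  "classical_solution m p F w \<longleftrightarrow>
     continuous_on ({0..} \<times> UNIV) (\<lambda>(t, z). w t z) \<and>
     (\<exists>wt wz wzz.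
        continuous_on ({0<..} \<times> UNIV) (\<lambda>(t, z). wt t z) \<and>
        continuous_on ({0<..} \<times> UNIV) (\<lambda>(t, z). wz t z) \<and>
        continuous_on ({0<..} \<times> UNIV) (\<lambda>(t, z). wzz t z) \<and>
        (\<forall>t>0. \<forall>z.
           ((\<lambda>s. w s z) has_real_derivative wt t z) (at t) \<and>
           ((\<lambda>y. w t y) has_real_derivative wz t z) (at z) \<and>
           ((\<lambda>y. wz t y) has_real_derivative wzz t z) (at z) \<and>
           wt t z = wzz t z + m * wz t z + p * w t z + F t z))"

lemma continuous_on_case_prod_subset:
  assumes "continuous_on A (\<lambda>(t, z). f t z)" "B \<subseteq> A"
  shows "continuous_on B (\<lambda>x. f (fst x) (snd x))"
  using continuous_on_subset[OF assms] by (simp add: split_beta)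

lemma continuous_on_slice:
  assumes "continuous_on A (\<lambda>x. f (fst x) (snd x))" "{r} \<times> Y \<subseteq> A"
  shows "continuous_on Y (\<lambda>y. f r y)"
proof -
  have "continuous_on Y (\<lambda>y. (r, y))" by (intro continuous_intros)
  from continuous_on_compose2[OF assms(1) this] assms(2) show ?thesis by auto
qed

lemma classical_solution_continuous:
  assumes "classical_solution m p F w"
  shows "continuous_on ({0..} \<times> UNIV) (\<lambda>(t, z). w t z)"
  using assms unfolding classical_solution_def by blast

text \<open>Continuity is read off from the equation. It could not be obtained by composition, since
  the delayed term involves the datum before time 0, for which no regularity is assumed.\<close>

lemma classical_solution_source_continuous:
  assumes "classical_solution m p F w"
  shows "continuous_on ({0<..} \<times> UNIV) (\<lambda>(t, z). F t z)"
proof -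
  from assms obtain wt wz wzz where
    *: "continuous_on ({0<..} \<times> UNIV) (\<lambda>(t, z). wt t z)"
       "continuous_on ({0<..} \<times> UNIV) (\<lambda>(t, z). wz t z)"
       "continuous_on ({0<..} \<times> UNIV) (\<lambda>(t, z). wzz t z)"
    and eq: "\<And>t z. t > 0 \<Longrightarrow> wt t z = wzz t z + m * wz t z + p * w t z + F t z"
    unfolding classical_solution_def by blast
  have "continuous_on ({0<..} \<times> UNIV) (\<lambda>(t, z). w t z)"
    by (rule continuous_on_subset[OF classical_solution_continuous[OF assms]]) auto
  with * have "continuous_on ({0<..} \<times> UNIV) (\<lambda>x. wt (fst x) (snd x) - wzz (fst x) (snd x) - m * wz (fst x) (snd x) - p * w (fst x) (snd x))"
    unfolding split_beta by (intro continuous_intros)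
  moreover have "F t z = wt t z - wzz t z - m * wz t z - p * w t z" if "t > 0" for t z
    using eq[OF that] by simp
  ultimately show ?thesis
    by (subst continuous_on_cong[OF refl]) auto
qed

text \<open>Differentiation under the integral, followed by two integrations by parts in
  \<open>y\<close>. The conditions \<open>zero\<close> remove all boundary terms, so nothing has to
  be known about \<open>w\<close> and its derivatives at \<open>a\<close> and
  \<open>b\<close>.\<close>

lemma green_derivative:
  fixes w F \<phi> \<phi>s \<phi>y \<phi>yy :: "real \<Rightarrow> real \<Rightarrow> real"
  assumes sol: "classical_solution m p F w" and "a \<le> b" and s: "s \<in> {0<..<T}"
    and cont: "continuous_on ({0<..<T} \<times> UNIV) (\<lambda>(s, y). \<phi> s y)"
      "continuous_on ({0<..<T} \<times> UNIV) (\<lambda>(s, y). \<phi>s s y)"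
      "continuous_on ({0<..<T} \<times> UNIV) (\<lambda>(s, y). \<phi>y s y)"
      "continuous_on ({0<..<T} \<times> UNIV) (\<lambda>(s, y). \<phi>yy s y)"
    and ds: "\<And>s y. s \<in> {0<..<T} \<Longrightarrow> ((\<lambda>s. \<phi> s y) has_real_derivative \<phi>s s y) (at s)"
    and dy: "\<And>s y. s \<in> {0<..<T} \<Longrightarrow> ((\<lambda>y. \<phi> s y) has_real_derivative \<phi>y s y) (at y)"
    and dyy: "\<And>s y. s \<in> {0<..<T} \<Longrightarrow> ((\<lambda>y. \<phi>y s y) has_real_derivative \<phi>yy s y) (at y)"
    and zero: "\<phi> s a = 0" "\<phi> s b = 0" "\<phi>y s a = 0" "\<phi>y s b = 0"
  shows "((\<lambda>s. integral {a..b} (\<lambda>y. w s y * \<phi> s y)) has_real_derivative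
      integral {a..b} (\<lambda>y. w s y * (\<phi>s s y + \<phi>yy s y - m * \<phi>y s y + p * \<phi> s y) + F s y * \<phi> s y)) (at s)"
proof -
  let ?L = "\<lambda>y. w s y * (\<phi>s s y + \<phi>yy s y - m * \<phi>y s y + p * \<phi> s y) + F s y * \<phi> s y"
  from sol obtain wt wz wzz where
    cw: "continuous_on ({0<..} \<times> UNIV) (\<lambda>(t, z). wt t z)"
       "continuous_on ({0<..} \<times> UNIV) (\<lambda>(t, z). wz t z)"
       "continuous_on ({0<..} \<times> UNIV) (\<lambda>(t, z). wzz t z)"
    and all: "\<forall>t>0. \<forall>z.
           ((\<lambda>s. w s z) has_real_derivative wt t z) (at t) \<and>
           ((\<lambda>y. w t y) has_real_derivative wz t z) (at z) \<and>
           ((\<lambda>y. wz t y) has_real_derivative wzz t z) (at z) \<and>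
           wt t z = wzz t z + m * wz t z + p * w t z + F t z"
    unfolding classical_solution_def by (elim conjE exE) (rule that)
  have dw: "((\<lambda>s. w s z) has_real_derivative wt t z) (at t)"
       "((\<lambda>y. w t y) has_real_derivative wz t z) (at z)"
       "((\<lambda>y. wz t y) has_real_derivative wzz t z) (at z)"
    and eq: "wt t z = wzz t z + m * wz t z + p * w t z + F t z" if "t > 0" for t z
    using all[rule_format, OF that, of z] by blast+
  note cw = cw classical_solution_continuous[OF sol] classical_solution_source_continuous[OF sol]
  have cu: "continuous_on ({0<..<T} \<times> cbox a b) (\<lambda>x. f (fst x) (snd x))"
    if "continuous_on ({0<..<T} \<times> UNIV) (\<lambda>(s, y). f s y)" for f :: "real \<Rightarrow> real \<Rightarrow> real"
    by (rule continuous_on_case_prod_subset[OF that]) auto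
  have cu': "continuous_on ({0<..<T} \<times> cbox a b) (\<lambda>x. f (fst x) (snd x))"
    if "continuous_on ({0<..} \<times> UNIV) (\<lambda>(s, y). f s y)" for f :: "real \<Rightarrow> real \<Rightarrow> real"
    by (rule continuous_on_case_prod_subset[OF that]) auto
  have cu'': "continuous_on ({0<..<T} \<times> cbox a b) (\<lambda>x. w (fst x) (snd x))"
    by (rule continuous_on_case_prod_subset[OF cw(4)]) auto
  note cs = cu[OF cont(1)] cu[OF cont(2)] cu[OF cont(3)] cu[OF cont(4)] cu'[OF cw(1)] cu'[OF cw(2)] cu'[OF cw(3)] cu'' cu'[OF cw(5)]
  have sl: "continuous_on {a..b} (\<lambda>y. f r y)" if "continuous_on ({0<..<T} \<times> cbox a b) (\<lambda>x. f (fst x) (snd x))" "r \<in> {0<..<T}"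
    for f :: "real \<Rightarrow> real \<Rightarrow> real" and r
    by (rule continuous_on_slice[OF that(1)]) (use that(2) in auto)
  have "((\<lambda>s. integral (cbox a b) (\<lambda>y. w s y * \<phi> s y)) has_real_derivative
      integral (cbox a b) (\<lambda>y. wt s y * \<phi> s y + w s y * \<phi>s s y)) (at s within {0<..<T})"
  proof (rule leibniz_rule_field_derivative)
    show "((\<lambda>x. w x y * \<phi> x y) has_real_derivative wt r y * \<phi> r y + w r y * \<phi>s r y) (at r within {0<..<T})"
      if "r \<in> {0<..<T}" "y \<in> cbox a b" for r y
    proof -
      from that have "((\<lambda>s. w s y) has_real_derivative wt r y) (at r within {0<..<T})"
        "((\<lambda>s. \<phi> s y) has_real_derivative \<phi>s r y) (at r within {0<..<T})"
        by (simp_all add: dw(1) ds has_field_derivative_at_within)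
      from DERIV_mult[OF this] show ?thesis by (simp add: mult.commute)
    qed
    show "(\<lambda>y. w r y * \<phi> r y) integrable_on cbox a b" if "r \<in> {0<..<T}" for r
      unfolding cbox_interval
      by (intro integrable_continuous_real continuous_intros sl cs that)
    show "continuous_on ({0<..<T} \<times> cbox a b) (\<lambda>(r, y). wt r y * \<phi> r y + w r y * \<phi>s r y)"
      unfolding split_beta by (intro continuous_intros cs)
  qed (use s in auto)
  moreover have "at s within {0<..<T} = at s" using s by (intro at_within_open) auto
  moreover have "integral {a..b} (\<lambda>y. wt s y * \<phi> s y + w s y * \<phi>s s y) =
     integral {a..b} (\<lambda>y. ?L y)"
  proof -
    let ?f = "\<lambda>y. wzz s y * \<phi> s y - w s y * \<phi>yy s y + m * (wz s y * \<phi> s y + w s y * \<phi>y s y)"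
    let ?g = "\<lambda>y. wz s y * \<phi> s y - w s y * \<phi>y s y + m * (w s y * \<phi> s y)"
    \<comment> \<open>\<open>?f\<close> is the difference between the integrand
      \<open>wt s y * \<phi> s y + w s y * \<phi>s s y\<close> and the one with the adjoint
      operator; it is the exact derivative of \<open>?g\<close>, which vanishes at both
      ends.\<close>
    have "(?f has_integral (?g b - ?g a)) {a..b}"
    proof (rule fundamental_theorem_of_calculus[OF \<open>a \<le> b\<close>])
      fix y
      have "(?g has_real_derivative ?f y) (at y)"
        by (rule derivative_eq_intros dw(2,3) dy dyy refl | use s in \<open>simp add: algebra_simps\<close>)+
      then show "(?g has_vector_derivative ?f y) (at y within {a..b})"
        by (simp add: has_real_derivative_iff_has_vector_derivative has_vector_derivative_at_within)
    qed
    then have f0: "(?f has_integral 0) {a..b}" using zero by simp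
    have "(\<lambda>y. ?L y) integrable_on {a..b}"
      by (intro integrable_continuous_real continuous_intros sl cs s)
    from has_integral_add[OF f0 integrable_integral[OF this]]
    have "((\<lambda>y. ?f y + (?L y)) has_integral
       integral {a..b} (\<lambda>y. ?L y)) {a..b}"
      by simp
    moreover have "?f y + (?L y)
       = wt s y * \<phi> s y + w s y * \<phi>s s y" for y
      using eq[of s y] s by (simp add: algebra_simps)
    ultimately show ?thesis by (simp add: integral_unique)
  qed
  ultimately show ?thesis by simp
qed

section \<open>Truncation of positive backward solutions\<close>

lemma has_real_derivative_max_power:
  "((\<lambda>x::real. max 0 x ^ (n + 2)) has_real_derivative real (n + 2) * max 0 x ^ (n + 1)) (at x)"
proof -
  consider "x > 0" | "x < 0" | "x = 0" by linarith
  then show ?thesis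
  proof cases
    case 1
    have "((\<lambda>x. x ^ (n + 2)) has_real_derivative real (n + 2) * max 0 x ^ (n + 1)) (at x)"
      using DERIV_pow[of "n + 2" x UNIV] 1 by (simp add: max_def)
    then show ?thesis
      by (rule has_field_derivative_transform_within_open[of _ _ _ "{0<..}"]) (use 1 in auto)
  next
    case 2
    have "((\<lambda>x. 0) has_real_derivative real (n + 2) * max 0 x ^ (n + 1)) (at x)"
      using 2 by (auto simp: max_def)
    then show ?thesis
      by (rule has_field_derivative_transform_within_open[of _ _ _ "{..<0}"]) (use 2 in auto)
  next
    case 3
    \<comment> \<open>The quotient is \<open>h ^ (n + 1)\<close> on the right and 0 on the left of
      the origin; an exponent of at least 2 is what makes both sides agree in the limit.\<close>
    have "((\<lambda>h::real. max 0 h ^ (n + 2) / h) \<longlongrightarrow> 0) (at 0)"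
    proof (rule Lim_null_comparison)
      show "\<forall>\<^sub>F h in at 0. norm (max 0 h ^ (n + 2) / h) \<le> max 0 (h :: real) ^ (n + 1)"
        by (intro always_eventually) (auto simp: max_def power_abs)
      have "((\<lambda>h::real. max 0 h ^ (n + 1)) \<longlongrightarrow> max 0 0 ^ (n + 1)) (at 0)"
        by (intro tendsto_intros)
      then show "((\<lambda>h::real. max 0 h ^ (n + 1)) \<longlongrightarrow> 0) (at 0)" by simp
    qed
    then show ?thesis using 3 by (simp add: has_field_derivative_iff)
  qed
qed

text \<open>\<open>trunc_id d\<close> is convex and of class \<open>C^2\<close> on the positive reals, vanishes up to \<open>d\<close> and is at
  most the identity. Hence its composition with a positive backward solution is a subsolution, with
  compact support if the solution decays at infinity.\<close>

definition trunc_id :: "real \<Rightarrow> real \<Rightarrow> real" where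
  "trunc_id d r = r * max 0 (1 - d / r) ^ 3"

lemma trunc_id_derivs:
  assumes "r > 0"
  shows "(trunc_id d has_real_derivative max 0 (1 - d / r) ^ 2 * (1 + 2 * d / r)) (at r)"
    and "((\<lambda>r. max 0 (1 - d / r) ^ 2 * (1 + 2 * d / r)) has_real_derivative
        6 * d\<^sup>2 * max 0 (1 - d / r) / r ^ 3) (at r)"
proof -
  have q: "((\<lambda>r. 1 - d / r) has_real_derivative d / r\<^sup>2) (at r)"
    using assms by (auto intro!: derivative_eq_intros simp: power2_eq_square)
  have q': "((\<lambda>r. 1 + 2 * d / r) has_real_derivative - (2 * d / r\<^sup>2)) (at r)"
    using assms by (auto intro!: derivative_eq_intros simp: power2_eq_square)
  note P3 = DERIV_chain2[OF has_real_derivative_max_power[of 1] q, simplified]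
  note P2 = DERIV_chain2[OF has_real_derivative_max_power[of 0] q, simplified]
  define P where "P = max 0 (1 - d / r)"
  define e where "e = d / r"
  \<comment> \<open>Either the truncation is active and everything carries a factor
    \<open>P = 0\<close>, or \<open>P\<close> can be eliminated in favour of \<open>e\<close>. This
    spares a case distinction in the differentiation itself.\<close>
  have P: "P = 0 \<or> e = 1 - P" unfolding P_def e_def max_def by argo
  have "(trunc_id d has_real_derivative 1 * P ^ 3 + r * (3 * P\<^sup>2 * (d / r\<^sup>2))) (at r)"
    unfolding trunc_id_def P_def
    using DERIV_mult[OF DERIV_ident P3] by (simp add: numeral_eq_Suc algebra_simps)
  also have "1 * P ^ 3 + r * (3 * P\<^sup>2 * (d / r\<^sup>2)) = P\<^sup>2 * (P + 3 * e)"
    using assms by (simp add: e_def field_simps power2_eq_square power3_eq_cube)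
  also have "\<dots> = P\<^sup>2 * (1 + 2 * e)"
    using P by (elim disjE) simp_all
  finally show "(trunc_id d has_real_derivative max 0 (1 - d / r) ^ 2 * (1 + 2 * d / r)) (at r)"
    unfolding P_def e_def by simp
  have "((\<lambda>r. max 0 (1 - d / r) ^ 2 * (1 + 2 * d / r)) has_real_derivative
     (2 * P * (d / r\<^sup>2)) * (1 + 2 * d / r) + P\<^sup>2 * (- (2 * d / r\<^sup>2))) (at r)"
    unfolding P_def
    using DERIV_mult[OF P2 q'] by (simp add: numeral_eq_Suc algebra_simps)
  also have "(2 * P * (d / r\<^sup>2)) * (1 + 2 * d / r) + P\<^sup>2 * (- (2 * d / r\<^sup>2))
      = 2 * P * (d / r\<^sup>2) * (1 + 2 * e - P)"
    using assms by (simp add: e_def field_simps power2_eq_square)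
  also have "\<dots> = 2 * P * (d / r\<^sup>2) * (3 * e)"
    using P by (elim disjE) simp_all
  also have "\<dots> = 6 * d\<^sup>2 * P / r ^ 3"
    using assms by (simp add: e_def field_simps power2_eq_square power3_eq_cube)
  finally show "((\<lambda>r. max 0 (1 - d / r) ^ 2 * (1 + 2 * d / r)) has_real_derivative
        6 * d\<^sup>2 * max 0 (1 - d / r) / r ^ 3) (at r)" unfolding P_def .
qed

text \<open>The last bound says that \<open>trunc_id d r\<close> is at most \<open>r\<close> times
  its derivative, as for every convex function vanishing at 0; it gives the zero-order term
  \<open>p \<le> 0\<close> the right sign after composition. The factor \<open>1/8\<close> is
  \<open>(1/2) ^ 3\<close>, from \<open>1/2 \<le> 1 - d / r\<close>.\<close>

lemma trunc_id_bounds: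
  assumes "r > 0" "d > 0"
  shows "0 \<le> trunc_id d r" "trunc_id d r \<le> r"
    and "2 * d \<le> r \<Longrightarrow> r / 8 \<le> trunc_id d r"
    and "r \<le> d \<Longrightarrow> trunc_id d r = 0"
    and "trunc_id d r \<le> max 0 (1 - d / r) ^ 2 * (1 + 2 * d / r) * r"
proof -
  define P where "P = max 0 (1 - d / r)"
  have P: "0 \<le> P" "P \<le> 1" "trunc_id d r = r * P ^ 3" using assms by (auto simp: P_def trunc_id_def)
  show "0 \<le> trunc_id d r" using P assms by simp
  show "trunc_id d r \<le> r" using P assms by (simp add: mult_left_le power_le_one)
  show "r / 8 \<le> trunc_id d r" if "2 * d \<le> r"
  proof -
    have "1/2 \<le> P" using that assms by (auto simp: P_def field_simps)
    then have "(1/2) ^ 3 \<le> P ^ 3" by (intro power_mono) auto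
    then have "r * (1/8) \<le> r * P ^ 3" using assms by (intro mult_left_mono) (auto simp: power3_eq_cube)
    then show ?thesis using P by simp
  qed
  show "trunc_id d r = 0" if "r \<le> d" using that assms by (simp add: trunc_id_def max_def)
  have "r * P ^ 3 = P\<^sup>2 * (P * r)" by (simp add: power2_eq_square power3_eq_cube)
  also have "P * r \<le> 1 * r" using assms P by (intro mult_right_mono) auto
  then have "P * r \<le> r + 2 * d" using assms by linarith
  then have "P\<^sup>2 * (P * r) \<le> P\<^sup>2 * (r + 2 * d)" by (intro mult_left_mono) auto
  also have "\<dots> = P\<^sup>2 * (1 + 2 * d / r) * r" using assms by (simp add: field_simps)
  finally show "trunc_id d r \<le> max 0 (1 - d / r) ^ 2 * (1 + 2 * d / r) * r"
    using P by (simp add: P_def)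
qed

lemma integral_semigroup_kernel_le_1:
  assumes "0 < t" "p \<le> 0" "a \<le> b"
  shows "integral {a..b} (\<lambda>y. semigroup_kernel m p t (x - y)) \<le> 1"
proof -
  let ?k = "semigroup_kernel m p"
  have "continuous_on {a..b} (\<lambda>y. ?k t (x - y))"
    using assms by (intro continuous_on_semigroup_kernel continuous_intros) auto
  then have "((\<lambda>y. ?k t (x - y)) has_integral
      integral {a..b} (\<lambda>y. ?k t (x - y))) {a..b}"
    by (intro integrable_integral integrable_continuous_real)
  from nn_integral_has_integral_lebesgue[OF _ this] assms
  have "ennreal (integral {a..b} (\<lambda>y. ?k t (x - y)))
     = (\<integral>\<^sup>+y. ennreal (indicator {a..b} y * ?k t (x - y)) \<partial>lborel)" by simp
  also have "\<dots> \<le> (\<integral>\<^sup>+y. ennreal (?k t (x - y)) \<partial>lborel)"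
    using assms by (intro nn_integral_mono) (auto split: split_indicator)
  also have "\<dots> = ennreal (exp (p * t))" by (rule nn_integral_semigroup_kernel[OF assms(1)])
  also have "\<dots> \<le> 1" using assms by (simp add: mult_nonpos_nonneg)
  finally show ?thesis by simp
qed

lemma solution_bounded:
  fixes w :: "real \<Rightarrow> real \<Rightarrow> real"
  assumes "continuous_on ({0..} \<times> UNIV) (\<lambda>(t, z). w t z)"
  obtains M where "M \<ge> 0" "\<And>s y. 0 \<le> s \<Longrightarrow> s \<le> T \<Longrightarrow> a \<le> y \<Longrightarrow> y \<le> b \<Longrightarrow> \<bar>w s y\<bar> \<le> M"
proof -
  have "compact ((\<lambda>x. w (fst x) (snd x)) ` ({0..T} \<times> {a..b}))"
    by (intro compact_continuous_image continuous_on_case_prod_subset[OF assms] compact_Times compact_Icc) auto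
  then obtain M where M: "\<forall>x\<in>(\<lambda>x. w (fst x) (snd x)) ` ({0..T} \<times> {a..b}). norm x \<le> M"
    using compact_imp_bounded bounded_iff by metis
  have "\<bar>w s y\<bar> \<le> max 0 M" if "0 \<le> s" "s \<le> T" "a \<le> y" "y \<le> b" for s y
  proof -
    have "w s y \<in> (\<lambda>x. w (fst x) (snd x)) ` ({0..T} \<times> {a..b})"
      by (rule image_eqI[of _ _ "(s, y)"]) (use that in auto)
    with M have "norm (w s y) \<le> M" by blast
    then show ?thesis by simp
  qed
  then show ?thesis by (intro that[of "max 0 M"]) auto
qed

text \<open>The pairing of \<open>S\<close> with the truncated kernel is nondecreasing in time,
  because the truncated kernel is a backward subsolution and \<open>F\<close> is nonnegative. It may
  therefore be moved to a time so close to the pole that the truncated kernel lives in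
  \<open>\<bar>x - y\<bar> \<le> 1\<close>; there \<open>S \<le> M0\<close>, and the mass of the
  kernel is at most 1. The truncation depends on \<open>s\<close> and \<open>R\<close>, but the
  final bound \<open>8 * M0\<close> does not.\<close>

lemma supersolution_kernel_growth:
  assumes sol: "classical_solution m p F S"
    and S: "\<And>t z. 0 \<le> t \<Longrightarrow> 0 \<le> S t z" and F: "\<And>t z. 0 < t \<Longrightarrow> 0 \<le> F t z"
    and p: "p \<le> 0" and T: "0 < T"
  shows "\<exists>M\<ge>0. \<forall>s R. 0 < s \<and> s < T \<and> 0 < R \<longrightarrow>
    integral {x - R..x + R} (\<lambda>y. S s y * semigroup_kernel m p (T - s) (x - y)) \<le> M"
proof -
  let ?B = "\<lambda>R. {x - R..x + R}"
  interpret backward_kernel m p T x .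
  note pos = kernel_pos and c\<kappa> = kernel_derivs_continuous(1) and cK = kernel_derivs_continuous(2-4) and dK = kernel_derivs
  note cS = classical_solution_continuous[OF sol]
  note cF = classical_solution_source_continuous[OF sol]
  have ne: "\<kappa> (fst z) (snd z) \<noteq> 0" if "z \<in> {0<..<T} \<times> UNIV" for z :: "real \<times> real"
    using that pos[of "fst z" "snd z"] by auto
  obtain M0 where M0: "M0 \<ge> 0" "\<And>s y. 0 \<le> s \<Longrightarrow> s \<le> T \<Longrightarrow> x - 1 \<le> y \<Longrightarrow> y \<le> x + 1 \<Longrightarrow> \<bar>S s y\<bar> \<le> M0"
    using solution_bounded[OF cS] by metis
  have "integral (?B R) (\<lambda>y. S s y * \<kappa> s y) \<le> 8 * M0" if s: "0 < s" "s < T" and R: "0 < R" for s R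
  proof -
    have c\<kappa>s: "continuous_on Y (\<lambda>y. \<kappa> r y)" if "r \<in> {0<..<T}" for r Y
      by (rule continuous_on_slice[OF c\<kappa>]) (use that in auto)
    have cSs: "continuous_on Y (\<lambda>y. S r y)" if "r \<in> {0<..<T}" for r Y
      by (rule continuous_on_slice[OF cS[unfolded split_beta]]) (use that in auto)
    have "\<exists>y0\<in>(?B R). \<forall>y\<in>(?B R). \<kappa> s y0 \<le> \<kappa> s y"
      using R s by (intro continuous_attains_inf c\<kappa>s) auto
    then obtain y0 where y0: "\<And>y. y \<in> (?B R) \<Longrightarrow> \<kappa> s y0 \<le> \<kappa> s y" by blast
    \<comment> \<open>On the interval of radius \<open>R\<close> the kernel is then at least
      \<open>2 * d\<close>, so the truncation costs only a factor 8 there.\<close>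
    define d where "d = \<kappa> s y0 / 2"
    have d: "d > 0" using pos[of s y0] s by (simp add: d_def)
    define C where "C = exp (m\<^sup>2 * T / 4) * 8"
    have C: "C > 0" by (simp add: C_def)
    have \<kappa>C: "\<kappa> r y \<le> C * sqrt (T - r) / (x - y)\<^sup>2" if "0 < r" "r < T" "x \<noteq> y" for r y
      unfolding \<kappa>_def C_def using that p by (intro semigroup_kernel_le_inverse_square) auto
    \<comment> \<open>So small that \<open>C * sqrt \<tau> \<le> d\<close>: at time
      \<open>s1 = T - \<tau>\<close> the kernel exceeds \<open>d\<close> only at distance less than
      1 from \<open>x\<close>.\<close>
    define \<tau> where "\<tau> = min ((T - s) / 2) ((d / C)\<^sup>2)"
    have \<tau>: "0 < \<tau>" "\<tau> < T - s" "\<tau> \<le> (d / C)\<^sup>2" using s d C by (auto simp: \<tau>_def min_less_iff_disj)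
    define s1 where "s1 = T - \<tau>"
    have s1: "s < s1" "s1 < T" using \<tau> by (auto simp: s1_def)
    have "sqrt \<tau> \<le> d / C" using \<tau> d C real_sqrt_le_mono[OF \<tau>(3)] by simp
    then have small: "C * sqrt (T - s1) \<le> d" using C by (simp add: s1_def field_simps)
    \<comment> \<open>So large that the kernel is at most \<open>d\<close> at \<open>x - R'\<close>
      and \<open>x + R'\<close> at all times in question; hence the truncated kernel and its
      derivative vanish there, as Green's identity demands.\<close>
    define R' where "R' = max R (max 1 (sqrt (C * sqrt T / d)))"
    have "R' \<ge> R" "R' \<ge> 1" "R' \<ge> sqrt (C * sqrt T / d)" by (auto simp: R'_def)
    have "(sqrt (C * sqrt T / d))\<^sup>2 \<le> R'\<^sup>2"
      using \<open>R' \<ge> sqrt _\<close> C d T by (intro power_mono) auto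
    then have R'2: "C * sqrt T / R'\<^sup>2 \<le> d" using C d T \<open>R' \<ge> 1\<close> by (simp add: field_simps)
    have ends: "\<kappa> r y \<le> d" if "0 < r" "r < T" "\<bar>x - y\<bar> = R'" for r y
    proof -
      have "(x - y)\<^sup>2 = R'\<^sup>2" using that(3) power2_abs[of "x - y"] by simp
      moreover have "C * sqrt (T - r) / R'\<^sup>2 \<le> C * sqrt T / R'\<^sup>2"
        using that C by (intro divide_right_mono mult_left_mono) auto
      ultimately show ?thesis using \<kappa>C[OF that(1,2), of y] R'2 that(3) \<open>R' \<ge> 1\<close> by (cases "x = y") auto
    qed
    define J1 where "J1 r = max 0 (1 - d / r) ^ 2 * (1 + 2 * d / r)" for r
    define J2 where "J2 r = 6 * d\<^sup>2 * max 0 (1 - d / r) / r ^ 3" for r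
    have J1: "(trunc_id d has_real_derivative J1 r) (at r)" and J2: "(J1 has_real_derivative J2 r) (at r)" if "r > 0" for r
      using trunc_id_derivs[OF that, of d] by (simp_all add: J1_def[abs_def] J2_def)
    have cJ: "continuous_on ({0<..<T} \<times> UNIV) (\<lambda>x. trunc_id d (\<kappa> (fst x) (snd x)))"
      "continuous_on ({0<..<T} \<times> UNIV) (\<lambda>x. J1 (\<kappa> (fst x) (snd x)))"
      "continuous_on ({0<..<T} \<times> UNIV) (\<lambda>x. J2 (\<kappa> (fst x) (snd x)))"
      unfolding trunc_id_def J1_def J2_def using ne by (intro continuous_intros c\<kappa>; simp)+
    define A where "A s = integral (?B R') (\<lambda>y. S s y * trunc_id d (\<kappa> s y))" for s
    define \<phi>s where "\<phi>s s y = J1 (\<kappa> s y) * \<kappa>s s y" for s y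
    define \<phi>y where "\<phi>y s y = J1 (\<kappa> s y) * \<kappa>y s y" for s y
    define \<phi>yy where "\<phi>yy s y = J2 (\<kappa> s y) * (\<kappa>y s y)\<^sup>2 + J1 (\<kappa> s y) * \<kappa>yy s y" for s y
    have dA: "\<exists>D. (A has_real_derivative D) (at r) \<and> 0 \<le> D" if "r \<in> {s..s1}" for r
    proof -
      have r: "r \<in> {0<..<T}" using that s s1 by auto
      have "(A has_real_derivative
        integral (?B R') (\<lambda>y. S r y * (\<phi>s r y + \<phi>yy r y - m * \<phi>y r y + p * trunc_id d (\<kappa> r y)) + F r y * trunc_id d (\<kappa> r y))) (at r)"
        unfolding A_def
      proof (rule green_derivative[OF sol _ r])
        show "x - R' \<le> x + R'" using \<open>R' \<ge> 1\<close> by simp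
        show "continuous_on ({0<..<T} \<times> UNIV) (\<lambda>(s, y). trunc_id d (\<kappa> s y))"
          "continuous_on ({0<..<T} \<times> UNIV) (\<lambda>(s, y). \<phi>s s y)"
          "continuous_on ({0<..<T} \<times> UNIV) (\<lambda>(s, y). \<phi>y s y)"
          "continuous_on ({0<..<T} \<times> UNIV) (\<lambda>(s, y). \<phi>yy s y)"
          unfolding split_beta \<phi>s_def \<phi>y_def \<phi>yy_def by (intro continuous_intros cJ cK)+
        fix q y assume q: "q \<in> {0<..<T}"
        then have q': "q < T" "0 < \<kappa> q y" using pos by auto
        show "((\<lambda>s. trunc_id d (\<kappa> s y)) has_real_derivative \<phi>s q y) (at q)"
          unfolding \<phi>s_def by (rule DERIV_chain2[OF J1[OF q'(2)] dK(3)[OF q'(1)]])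
        show "((\<lambda>y. trunc_id d (\<kappa> q y)) has_real_derivative \<phi>y q y) (at y)"
          unfolding \<phi>y_def by (rule DERIV_chain2[OF J1[OF q'(2)] dK(1)[OF q'(1)]])
        have "((\<lambda>y. J1 (\<kappa> q y)) has_real_derivative J2 (\<kappa> q y) * \<kappa>y q y) (at y)"
          by (rule DERIV_chain2[OF J2[OF q'(2)] dK(1)[OF q'(1)]])
        from DERIV_mult[OF this dK(2)[OF q'(1)]]
        show "((\<lambda>y. \<phi>y q y) has_real_derivative \<phi>yy q y) (at y)"
          unfolding \<phi>y_def \<phi>yy_def by (simp add: power2_eq_square algebra_simps)
      next
        have e: "\<kappa> r (x - R') \<le> d" "\<kappa> r (x + R') \<le> d" using r \<open>R' \<ge> 1\<close> by (auto intro!: ends)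
        have "J1 r = 0" if "0 < r" "r \<le> d" for r using that by (simp add: J1_def max_def)
        then show "trunc_id d (\<kappa> r (x - R')) = 0" "trunc_id d (\<kappa> r (x + R')) = 0"
            "\<phi>y r (x - R') = 0" "\<phi>y r (x + R') = 0"
          using e pos[of r] r d by (auto simp: trunc_id_bounds(4) \<phi>y_def)
      qed
      moreover have "0 \<le> integral (?B R') (\<lambda>y. S r y * (\<phi>s r y + \<phi>yy r y - m * \<phi>y r y + p * trunc_id d (\<kappa> r y)) + F r y * trunc_id d (\<kappa> r y))"
      proof (rule integral_nonneg)
        have cr: "continuous_on (?B R') (\<lambda>y. f r y)" if "continuous_on ({0<..<T} \<times> UNIV) (\<lambda>x. f (fst x) (snd x))"
          for f :: "real \<Rightarrow> real \<Rightarrow> real"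
          by (rule continuous_on_slice[OF that]) (use r in auto)
        have cFs: "continuous_on (?B R') (\<lambda>y. F r y)"
          by (rule continuous_on_slice[OF cF[unfolded split_beta]]) (use r in auto)
        note cr' = cr[OF cK(1)] cr[OF cK(2)] cr[OF cK(3)] cr[OF cJ(1)] cr[OF cJ(2)] cr[OF cJ(3)]
        show "(\<lambda>y. S r y * (\<phi>s r y + \<phi>yy r y - m * \<phi>y r y + p * trunc_id d (\<kappa> r y)) + F r y * trunc_id d (\<kappa> r y))
           integrable_on (?B R')"
          unfolding \<phi>s_def \<phi>y_def \<phi>yy_def
          by (intro integrable_continuous_real continuous_intros cr' cFs cSs r)
        fix y
        have k: "0 < \<kappa> r y" using pos r by simp
        \<comment> \<open>The chain rule leaves, besides the backward equation for
          \<open>\<kappa>\<close>, the convexity term with \<open>J2\<close> and a defect of the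
          zero-order term, both nonnegative.\<close>
        have "\<phi>s r y + \<phi>yy r y - m * \<phi>y r y + p * trunc_id d (\<kappa> r y)
          = J2 (\<kappa> r y) * (\<kappa>y r y)\<^sup>2 + J1 (\<kappa> r y) * (\<kappa>s r y + \<kappa>yy r y - m * \<kappa>y r y + p * \<kappa> r y)
             + (- p) * (J1 (\<kappa> r y) * \<kappa> r y - trunc_id d (\<kappa> r y))"
          unfolding \<phi>s_def \<phi>y_def \<phi>yy_def by (simp add: algebra_simps)
        also have "\<dots> = J2 (\<kappa> r y) * (\<kappa>y r y)\<^sup>2 + (- p) * (J1 (\<kappa> r y) * \<kappa> r y - trunc_id d (\<kappa> r y))"
          by (simp add: backward_equation)
        also have "\<dots> \<ge> 0"
          using k d p trunc_id_bounds(5)[OF k d]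
          by (intro add_nonneg_nonneg mult_nonneg_nonneg) (auto simp: J1_def J2_def)
        finally show "0 \<le> S r y * (\<phi>s r y + \<phi>yy r y - m * \<phi>y r y + p * trunc_id d (\<kappa> r y)) + F r y * trunc_id d (\<kappa> r y)"
          using S[of r y] F[of r y] r trunc_id_bounds(1)[OF k d] by simp
      qed
      ultimately show ?thesis by blast
    qed
    have s0: "s \<in> {0<..<T}" and s1': "s1 \<in> {0<..<T}" using s s1 by auto
    have int: "f integrable_on {a..b}" if "continuous_on {a..b} f" for f :: "real \<Rightarrow> real" and a b
      using that by (rule integrable_continuous_real)
    have cT: "continuous_on Y (\<lambda>y. trunc_id d (\<kappa> r y))" if "r \<in> {0<..<T}" for r Y
      by (rule continuous_on_slice[OF cJ(1)]) (use that in auto)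
    have "integral (?B R) (\<lambda>y. S s y * \<kappa> s y) = 8 * integral (?B R) (\<lambda>y. S s y * (\<kappa> s y / 8))"
      by simp
    also have "integral (?B R) (\<lambda>y. S s y * (\<kappa> s y / 8)) \<le> integral (?B R) (\<lambda>y. S s y * trunc_id d (\<kappa> s y))"
    proof (rule integral_le)
      fix y assume "y \<in> (?B R)"
      then show "S s y * (\<kappa> s y / 8) \<le> S s y * trunc_id d (\<kappa> s y)"
        using s S[of s y] pos[of s y] d y0[of y] by (intro mult_left_mono trunc_id_bounds(3)) (auto simp: d_def)
    qed (intro int continuous_intros cSs c\<kappa>s cT s0; simp)+
    also have "\<dots> \<le> A s" unfolding A_def
    proof (rule integral_subset_le)
      show "(?B R) \<subseteq> (?B R')" using \<open>R' \<ge> R\<close> by auto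
      show "\<forall>y\<in>(?B R'). 0 \<le> S s y * trunc_id d (\<kappa> s y)"
        using s S pos[of s] d by (simp add: trunc_id_bounds(1))
    qed (intro int continuous_intros cSs c\<kappa>s cT s0; simp)+
    also have "A s \<le> A s1" using s1 by (intro DERIV_nonneg_imp_nondecreasing[of s s1 A]) (auto intro: dA)
    also have "A s1 \<le> integral (?B R') (\<lambda>y. M0 * \<kappa> s1 y)" unfolding A_def
    proof (rule integral_le)
      fix y
      have k: "0 < \<kappa> s1 y" using pos s1 by simp
      show "S s1 y * trunc_id d (\<kappa> s1 y) \<le> M0 * \<kappa> s1 y"
      proof (cases "\<bar>x - y\<bar> \<le> 1")
        case True
        then have "S s1 y \<le> M0" using M0(2)[of s1 y] s s1 by (auto simp: abs_le_iff)
        then show ?thesis using M0(1) trunc_id_bounds(1,2)[OF k d] by (intro mult_mono) auto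
      next
        case False
        then have "1 \<le> (x - y)\<^sup>2" using abs_le_square_iff[of 1 "x - y"] by simp
        then have "C * sqrt (T - s1) / (x - y)\<^sup>2 \<le> C * sqrt (T - s1) / 1"
          using C s1 by (intro divide_left_mono) auto
        then have "\<kappa> s1 y \<le> d" using \<kappa>C[of s1 y] small s s1 False by (cases "x = y") auto
        then show ?thesis using k M0(1) d by (simp add: trunc_id_bounds(4))
      qed
    qed (intro int continuous_intros cSs c\<kappa>s cT s1'; simp)+
    also have "\<dots> = M0 * integral (?B R') (\<lambda>y. \<kappa> s1 y)" by simp
    also have "\<dots> \<le> M0 * 1" unfolding \<kappa>_def using s1 p \<open>R' \<ge> 1\<close> M0
      by (intro mult_left_mono integral_semigroup_kernel_le_1) auto
    finally show ?thesis by simp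
  qed
  then show ?thesis using M0(1) unfolding \<kappa>_def by (intro exI[of _ "8 * M0"]) auto
qed

text \<open>The kernel with pole at time \<open>9 t\<close> has, at times up to \<open>t\<close>, tails heavier than
  \<open>exp (- (x - y)\<^sup>2 / (16 * t))\<close>.\<close>

lemma supersolution_gauss_growth:
  assumes sol: "classical_solution m p F S"
    and S: "\<And>t z. 0 \<le> t \<Longrightarrow> 0 \<le> S t z" and F: "\<And>t z. 0 < t \<Longrightarrow> 0 \<le> F t z"
    and p: "p \<le> 0" and t: "0 < t"
  obtains M where "M \<ge> 0" "\<And>s R. 0 < s \<Longrightarrow> s \<le> t \<Longrightarrow> 0 < R \<Longrightarrow>
    integral {x - R..x + R} (\<lambda>y. S s y * exp (- (x - y)\<^sup>2 / (16 * t))) \<le> M"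
proof -
  let ?e = "\<lambda>y. exp (- (x - y)\<^sup>2 / (16 * t))" and ?B = "\<lambda>R. {x - R..x + R}"
  let ?k = "\<lambda>s y. semigroup_kernel m p (9 * t - s) (x - y)"
  obtain M where M: "M \<ge> 0" "\<And>s R. 0 < s \<Longrightarrow> s < 9 * t \<Longrightarrow> 0 < R \<Longrightarrow>
    integral (?B R) (\<lambda>y. S s y * ?k s y) \<le> M"
    using supersolution_kernel_growth[OF sol S F p, of "9 * t" x] t by auto
  define c where "c = exp (p * (9 * t) - m\<^sup>2 * (9 * t) / 2) / sqrt (4 * pi * (9 * t))"
  have c: "c > 0" using t by (simp add: c_def)
  have ge: "c * ?e y \<le> ?k s y"
    if "0 < s" "s \<le> t" for s y
  proof -
    let ?\<tau> = "9 * t - s"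
    have \<tau>: "8 * t \<le> ?\<tau>" "?\<tau> \<le> 9 * t" "0 < ?\<tau>" using that t by auto
    have "(x - y)\<^sup>2 / (2 * ?\<tau>) \<le> (x - y)\<^sup>2 / (16 * t)"
      using \<tau> t by (intro divide_left_mono) auto
    moreover have "p * (9 * t) \<le> p * ?\<tau>" using \<tau> p by (intro mult_left_mono_neg) auto
    moreover have "m\<^sup>2 * ?\<tau> / 2 \<le> m\<^sup>2 * (9 * t) / 2" using \<tau> by (intro divide_right_mono mult_left_mono) auto
    ultimately have "exp (p * (9 * t) - m\<^sup>2 * (9 * t) / 2) * ?e y
       \<le> exp (p * ?\<tau> - m\<^sup>2 * ?\<tau> / 2) * exp (- (x - y)\<^sup>2 / (2 * ?\<tau>))"
      unfolding exp_add[symmetric] by simp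
    then have "c * ?e y \<le>
       exp (p * ?\<tau> - m\<^sup>2 * ?\<tau> / 2) * exp (- (x - y)\<^sup>2 / (2 * ?\<tau>)) / sqrt (4 * pi * ?\<tau>)"
      unfolding c_def times_divide_eq_left using \<tau> t by (intro frac_le real_sqrt_le_mono mult_left_mono) auto
    also have "\<dots> \<le> semigroup_kernel m p ?\<tau> (x - y)" by (rule semigroup_kernel_ge_gauss[OF \<tau>(3)])
    finally show ?thesis .
  qed
  have "integral (?B R) (\<lambda>y. S s y * ?e y) \<le> M / c"
    if s: "0 < s" "s \<le> t" and R: "0 < R" for s R
  proof -
    have cS: "continuous_on (?B R) (\<lambda>y. S s y)"
      by (rule continuous_on_slice[OF classical_solution_continuous[OF sol, unfolded split_beta]]) (use s in auto)
    have "c * integral (?B R) (\<lambda>y. S s y * ?e y)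
      = integral (?B R) (\<lambda>y. S s y * (c * ?e y))"
      unfolding mult.left_commute[of _ c] by simp
    also have "\<dots> \<le> integral (?B R) (\<lambda>y. S s y * ?k s y)"
    proof (rule integral_le)
      show "(\<lambda>y. S s y * (c * ?e y)) integrable_on (?B R)"
        using t by (intro integrable_continuous_real continuous_intros cS) auto
      show "(\<lambda>y. S s y * ?k s y) integrable_on (?B R)"
        using s t by (intro integrable_continuous_real continuous_on_mult cS continuous_on_semigroup_kernel continuous_intros) auto
      show "S s y * (c * ?e y) \<le> S s y * ?k s y" for y
        using s S ge by (intro mult_left_mono) auto
    qed
    also have "\<dots> \<le> M" using s t R by (intro M) auto
    finally show ?thesis using c by (simp add: field_simps)
  qed
  with M(1) c show ?thesis by (intro that[of "M / c"]) auto
qed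

subsection \<open>Duhamel bound without growth conditions\<close>

text \<open>The substitution \<open>y = x + m * \<tau> - sqrt (2 * \<tau>) * X\<close> turns the
  shrinking kernel into the fixed standard normal density. The singular limit becomes dominated
  convergence of a bounded function against this density.\<close>

lemma kernel_concentration:
  fixes w :: "real \<Rightarrow> real \<Rightarrow> real"
  assumes cw: "continuous_on ({0..} \<times> UNIV) (\<lambda>(t, z). w t z)" and c\<zeta>: "continuous_on UNIV \<zeta>"
    and t: "0 < t" and R: "0 < R"
  shows "(\<lambda>n. integral {x - R..x + R} (\<lambda>y. w (t - t / real (n + 2)) y * (\<zeta> y * semigroup_kernel m p (t / real (n + 2)) (x - y))))
    \<longlonglongrightarrow> w t x * \<zeta> x"
proof -
  let ?k = "semigroup_kernel m p"
  \<comment> \<open>The offset 2, rather than 1, keeps \<open>t - \<tau> n\<close> strictly positive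
    also for \<open>n = 0\<close>.\<close>
  define \<tau> where "\<tau> n = t / real (n + 2)" for n :: nat
  have \<tau>: "0 < \<tau> n" "\<tau> n \<le> t" for n using t by (auto simp: \<tau>_def field_simps)
  let ?Y = "\<lambda>n X. x + m * \<tau> n - sqrt (2 * \<tau> n) * X" and ?D = "\<lambda>n X. exp (p * \<tau> n) * std_normal_density X"
  have \<tau>0: "\<tau> \<longlonglongrightarrow> 0"
    unfolding \<tau>_def using LIMSEQ_ignore_initial_segment[OF lim_const_over_n, of t 2] by simp
  define h where "h s y = indicator {x - R..x + R} y *\<^sub>R (w s y * \<zeta> y)" for s y
  have cws: "continuous_on Y (\<lambda>y. w s y)" if "0 \<le> s" for s Y
    by (rule continuous_on_slice[OF cw[unfolded split_beta]]) (use that in auto)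
  have c\<zeta>': "continuous_on Y \<zeta>" for Y by (rule continuous_on_subset[OF c\<zeta>]) simp
  have hm [measurable]: "h s \<in> borel_measurable borel" if "0 \<le> s" for s
    unfolding h_def by (intro borel_measurable_continuous_on_indicator continuous_intros cws c\<zeta>' that) simp
  obtain B1 where B1: "B1 \<ge> 0" "\<And>s y. 0 \<le> s \<Longrightarrow> s \<le> t \<Longrightarrow> x - R \<le> y \<Longrightarrow> y \<le> x + R \<Longrightarrow> \<bar>w s y\<bar> \<le> B1"
    using solution_bounded[OF cw] by metis
  have "compact (\<zeta> ` {x - R..x + R})" by (intro compact_continuous_image c\<zeta>' compact_Icc)
  then obtain B2 where B2: "\<forall>c\<in>\<zeta> ` {x - R..x + R}. norm c \<le> B2"
    using compact_imp_bounded bounded_iff by metis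
  have B2': "\<bar>\<zeta> y\<bar> \<le> max 0 B2" if "x - R \<le> y" "y \<le> x + R" for y
  proof -
    have "norm (\<zeta> y) \<le> B2" using B2 that by simp
    then show ?thesis by simp
  qed
  define B where "B = B1 * max 0 B2"
  have B: "B \<ge> 0" using B1 by (simp add: B_def)
  have hB: "\<bar>h s y\<bar> \<le> B" if "0 \<le> s" "s \<le> t" for s y
    using B1(2)[OF that] B2' B B1(1) unfolding h_def B_def
    by (auto simp: abs_mult split: split_indicator intro!: mult_mono)
  have eq: "integral {x - R..x + R} (\<lambda>y. w (t - \<tau> n) y * (\<zeta> y * ?k (\<tau> n) (x - y)))
     = (LINT X|lborel. h (t - \<tau> n) (?Y n X) * (?D n X))"
    for n
  proof -
    let ?s = "t - \<tau> n"
    have s: "0 \<le> ?s" using \<tau>[of n] by simp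
    have "set_integrable lborel {x - R..x + R} (\<lambda>y. w ?s y * (\<zeta> y * ?k (\<tau> n) (x - y)))"
      using \<tau>[of n] by (intro borel_integrable_atLeastAtMost' continuous_on_mult cws c\<zeta>' continuous_on_semigroup_kernel s continuous_intros) auto
    from set_borel_integral_eq_integral(2)[OF this]
    have "integral {x - R..x + R} (\<lambda>y. w ?s y * (\<zeta> y * ?k (\<tau> n) (x - y)))
      = (LINT y|lborel. h ?s y * ?k (\<tau> n) (x - y))"
      unfolding set_lebesgue_integral_def h_def by (simp add: mult.assoc)
    also have "\<dots> = \<bar>- sqrt (2 * \<tau> n)\<bar> *\<^sub>R (LINT X|lborel. h ?s ((x + m * \<tau> n) + (- sqrt (2 * \<tau> n)) * X)
        * ?k (\<tau> n) (x - ((x + m * \<tau> n) + (- sqrt (2 * \<tau> n)) * X)))"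
      using \<tau>[of n] by (intro lborel_integral_real_affine) auto
    also have "\<dots> = (LINT X|lborel. \<bar>- sqrt (2 * \<tau> n)\<bar> * (h ?s ((x + m * \<tau> n) + (- sqrt (2 * \<tau> n)) * X)
        * ?k (\<tau> n) (x - ((x + m * \<tau> n) + (- sqrt (2 * \<tau> n)) * X))))"
      by simp
    also have "\<dots> = (LINT X|lborel. h ?s (?Y n X) * (?D n X))"
    proof (rule Bochner_Integration.integral_cong[OF refl])
      fix X
      let ?\<sigma> = "sqrt (2 * \<tau> n)" and ?H = "h ?s (?Y n X)"
      have 1: "?k (\<tau> n) (x - ((x + m * \<tau> n) + (- ?\<sigma>) * X))
        = exp (p * \<tau> n) * normal_density 0 ?\<sigma> (?\<sigma> * X)"
        using \<tau>[of n] by (simp add: semigroup_kernel_eq_normal algebra_simps)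
      have 2: "?\<sigma> * normal_density 0 ?\<sigma> (?\<sigma> * X) = std_normal_density X"
        using \<tau>[of n] by (simp add: normal_density_def real_sqrt_mult power_mult_distrib field_simps)
      have 3: "\<bar>- ?\<sigma>\<bar> = ?\<sigma>" using \<tau>[of n] by simp
      have 4: "(x + m * \<tau> n) + (- ?\<sigma>) * X = x + m * \<tau> n - ?\<sigma> * X" by simp
      have "\<bar>- ?\<sigma>\<bar> * (h ?s ((x + m * \<tau> n) + (- ?\<sigma>) * X)
        * ?k (\<tau> n) (x - ((x + m * \<tau> n) + (- ?\<sigma>) * X)))
        = ?\<sigma> * (?H * (exp (p * \<tau> n) * normal_density 0 ?\<sigma> (?\<sigma> * X)))"
        unfolding 1 3 unfolding 4 ..
      also have "\<dots> = ?H * (exp (p * \<tau> n) * (?\<sigma> * normal_density 0 ?\<sigma> (?\<sigma> * X)))" by (simp only: mult.left_commute)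
      finally show "\<bar>- ?\<sigma>\<bar> * (h ?s ((x + m * \<tau> n) + (- ?\<sigma>) * X)
        * ?k (\<tau> n) (x - ((x + m * \<tau> n) + (- ?\<sigma>) * X)))
        = ?H * (?D n X)"
        unfolding 2 .
    qed
    finally show ?thesis .
  qed
  have "(\<lambda>n. LINT X|lborel. h (t - \<tau> n) (?Y n X) * (?D n X))
     \<longlonglongrightarrow> (LINT X|lborel. w t x * \<zeta> x * std_normal_density X)"
  proof (rule integral_dominated_convergence[where M = lborel and f = "\<lambda>X. w t x * \<zeta> x * std_normal_density X"
      and s = "\<lambda>n X. h (t - \<tau> n) (?Y n X) * (?D n X)" and w = "\<lambda>X. B * exp (\<bar>p\<bar> * t) * std_normal_density X"])
    show "(\<lambda>X. w t x * \<zeta> x * std_normal_density X) \<in> borel_measurable lborel" by measurable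
    fix n
    have [measurable]: "h (t - \<tau> n) \<in> borel_measurable borel" using \<tau>[of n] by (intro hm) simp
    show "(\<lambda>X. h (t - \<tau> n) (?Y n X) * (?D n X)) \<in> borel_measurable lborel"
      by measurable
  next
    show "integrable lborel (\<lambda>X. B * exp (\<bar>p\<bar> * t) * std_normal_density X)"
      by (intro integrable_mult_right) simp
  next
    fix n
    have e: "p * \<tau> n \<le> \<bar>p\<bar> * t" using \<tau>[of n] by (metis abs_ge_self abs_ge_zero mult_mono less_imp_le)
    show "AE X in lborel. norm (h (t - \<tau> n) (?Y n X) * (?D n X))
       \<le> B * exp (\<bar>p\<bar> * t) * std_normal_density X"
      unfolding mult.assoc norm_mult
      using \<tau>[of n] hB[of "t - \<tau> n"] B e by (intro always_eventually allI mult_mono) auto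
  next
    show "AE X in lborel. (\<lambda>n. h (t - \<tau> n) (?Y n X) * (?D n X))
       \<longlonglongrightarrow> w t x * \<zeta> x * std_normal_density X"
    proof (intro always_eventually allI)
      fix X
      define y where "y n = x + m * \<tau> n - sqrt (2 * \<tau> n) * X" for n
      have y: "y \<longlonglongrightarrow> x"
      proof -
        have "y \<longlonglongrightarrow> x + m * 0 - sqrt (2 * 0) * X" unfolding y_def by (intro tendsto_intros \<tau>0)
        then show ?thesis by simp
      qed
      have "\<forall>\<^sub>F n in sequentially. y n \<in> {x - R<..<x + R}"
        by (rule topological_tendstoD[OF y]) (use R in auto)
      then have ev: "\<forall>\<^sub>F n in sequentially. h (t - \<tau> n) (y n) = w (t - \<tau> n) (y n) * \<zeta> (y n)"
        by eventually_elim (auto simp: h_def)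
      have "(\<lambda>n. w (t - \<tau> n) (y n)) \<longlonglongrightarrow> w t x"
      proof -
        have "(\<lambda>n. (t - \<tau> n, y n)) \<longlonglongrightarrow> (t - 0, x)" by (intro tendsto_intros \<tau>0 y)
        from continuous_on_tendsto_compose[OF cw[unfolded split_beta] this] t \<tau>
        show ?thesis by (simp add: less_imp_le)
      qed
      moreover have "(\<lambda>n. \<zeta> (y n)) \<longlonglongrightarrow> \<zeta> x"
        by (rule continuous_on_tendsto_compose[OF c\<zeta> y]) auto
      ultimately have "(\<lambda>n. w (t - \<tau> n) (y n) * \<zeta> (y n)) \<longlonglongrightarrow> w t x * \<zeta> x" by (intro tendsto_mult)
      then have 1: "(\<lambda>n. h (t - \<tau> n) (y n)) \<longlonglongrightarrow> w t x * \<zeta> x"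
        using tendsto_cong[OF ev] by blast
      have "(\<lambda>n. exp (p * \<tau> n)) \<longlonglongrightarrow> exp (p * 0)" by (intro tendsto_intros \<tau>0)
      then have 2: "(\<lambda>n. exp (p * \<tau> n)) \<longlonglongrightarrow> 1" by simp
      have "(\<lambda>n. h (t - \<tau> n) (y n) * (?D n X)) \<longlonglongrightarrow> w t x * \<zeta> x * (1 * std_normal_density X)"
        by (intro tendsto_mult 1 2 tendsto_const)
      then show "(\<lambda>n. h (t - \<tau> n) (?Y n X) * (?D n X))
         \<longlonglongrightarrow> w t x * \<zeta> x * std_normal_density X" unfolding y_def by simp
    qed
  qed
  moreover have "(LINT X|lborel. w t x * \<zeta> x * std_normal_density X) = w t x * \<zeta> x"
    by simp
  ultimately show ?thesis unfolding eq[symmetric] by (simp add: \<tau>_def)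
qed

text \<open>Half of the remaining Gaussian exponent absorbs the polynomial which the derivatives of
  the cutoff produce; \<open>96 = 6 * 16\<close>, and the constant term has room to spare.\<close>

lemma exp_quadratic_bound:
  fixes X :: real
  assumes "0 \<le> X"
  shows "exp (- X / 8) * (30 + 6 * X) \<le> 96 * exp (- X / 16)"
proof -
  have "30 + 6 * X \<le> 96 * (1 + X / 16)" by simp
  also have "\<dots> \<le> 96 * exp (X / 16)" by (intro mult_left_mono exp_ge_add_one_self) auto
  finally have "exp (- X / 8) * (30 + 6 * X) \<le> exp (- X / 8) * (96 * exp (X / 16))"
    by (intro mult_left_mono) auto
  also have "\<dots> = 96 * exp (- X / 16)" by (simp flip: exp_add)
  finally show ?thesis .
qed

text \<open>Green's identity is applied to the kernel times a cutoff of radius \<open>R\<close>. The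
  cutoff error is bounded by a multiple of \<open>1 / R\<^sup>2\<close> times a Gaussian mean of
  \<open>S\<close>, so it disappears for large \<open>R\<close>. The assumptions on \<open>F\<close>
  and \<open>w 0\<close> speak of bounded intervals and of compact subintervals of
  \<open>{0<..<t}\<close>, because only there is the pairing formed before passing to the
  limit.\<close>

lemma classical_solution_duhamel_bound:
  assumes solS: "classical_solution m p G S" and solw: "classical_solution m p F w"
    and S: "\<And>t z. 0 \<le> t \<Longrightarrow> 0 \<le> S t z" and G: "\<And>t z. 0 < t \<Longrightarrow> 0 \<le> G t z"
    and wS: "\<And>t z. 0 \<le> t \<Longrightarrow> \<bar>w t z\<bar> \<le> S t z"
    and p: "p \<le> 0" and t: "0 < t"
    and I: "\<And>s R. 0 < s \<Longrightarrow> s < t \<Longrightarrow> 0 < R \<Longrightarrow>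
      integral {x - R..x + R} (\<lambda>y. semigroup_kernel m p (t - s) (x - y) * \<bar>F s y\<bar>) \<le> I s"
    and K0: "\<And>R. 0 < R \<Longrightarrow> integral {x - R..x + R} (\<lambda>y. semigroup_kernel m p t (x - y) * \<bar>w 0 y\<bar>) \<le> K0"
    and K1: "\<And>s0 s1. 0 < s0 \<Longrightarrow> s0 < s1 \<Longrightarrow> s1 < t \<Longrightarrow> I integrable_on {s0..s1} \<and> integral {s0..s1} I \<le> K1"
  shows "\<bar>w t x\<bar> \<le> K0 + K1"
proof -
  let ?e = "\<lambda>y. exp (- (x - y)\<^sup>2 / (16 * t))" and ?B = "\<lambda>R. {x - R..x + R}"
  obtain M where M: "M \<ge> 0" "\<And>s R. 0 < s \<Longrightarrow> s \<le> t \<Longrightarrow> 0 < R \<Longrightarrow>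
    integral (?B R) (\<lambda>y. S s y * ?e y) \<le> M"
    using supersolution_gauss_growth[OF solS S G p t, of x] by blast
  interpret backward_kernel m p t x .
  note pos = kernel_pos and c\<kappa> = kernel_continuous and c\<kappa>' = kernel_derivs_continuous(1)
    and cK = kernel_derivs_continuous(2-4) and dK = kernel_derivs
  note cw = classical_solution_continuous[OF solw]
  note cF = classical_solution_source_continuous[OF solw]
  note cS = classical_solution_continuous[OF solS]
  define C where "C = 96 * exp (m\<^sup>2 * t / 4)"
  have C: "C > 0" by (simp add: C_def)
  \<comment> \<open>The exponent \<open>4 * (t - s)\<close> of the kernel becomes
    \<open>8 * (t - s)\<close> by removing the drift and \<open>16 * (t - s)\<close> by absorbing
    the polynomial. This is at most \<open>16 * t\<close>, the width for which the means of
    \<open>S\<close> are bounded by \<open>M\<close>.\<close>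
  have gauss: "\<kappa> s y * (30 + 6 * ((x - y)\<^sup>2 / (t - s))) \<le> C / sqrt (t - s) * ?e y"
    if s: "0 < s" "s < t" for s y
  proof -
    define X where "X = (x - y)\<^sup>2 / (t - s)"
    have X: "X \<ge> 0" using s by (simp add: X_def)
    have e: "(x - y)\<^sup>2 / (16 * t) \<le> X / 16"
      using s by (simp add: X_def frac_le)
    have "\<kappa> s y * (30 + 6 * X) \<le> (exp (m\<^sup>2 * (t - s) / 4) * exp (- (x - y)\<^sup>2 / (8 * (t - s))) / sqrt (4 * pi * (t - s))) * (30 + 6 * X)"
      unfolding \<kappa>_def using s p X by (intro mult_right_mono semigroup_kernel_le_gauss) auto
    also have "\<dots> = exp (m\<^sup>2 * (t - s) / 4) * (exp (- X / 8) * (30 + 6 * X)) / sqrt (4 * pi * (t - s))"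
      by (simp add: X_def mult.commute)
    also have "\<dots> \<le> exp (m\<^sup>2 * t / 4) * (96 * exp (- X / 16)) / sqrt (1 * (t - s))"
    proof (rule frac_le)
      show "exp (m\<^sup>2 * (t - s) / 4) * (exp (- X / 8) * (30 + 6 * X)) \<le> exp (m\<^sup>2 * t / 4) * (96 * exp (- X / 16))"
        using s X by (intro mult_mono[OF _ exp_quadratic_bound[OF X]]) (auto intro: mult_left_mono)
      show "sqrt (1 * (t - s)) \<le> sqrt (4 * pi * (t - s))"
        using s pi_ge_two by (intro real_sqrt_le_mono mult_right_mono) auto
    qed (use s X in auto)
    also have "\<dots> \<le> exp (m\<^sup>2 * t / 4) * (96 * ?e y) / sqrt (1 * (t - s))"
      using e s by (intro divide_right_mono mult_left_mono) auto
    finally show ?thesis by (simp add: X_def C_def mult_ac)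
  qed
  have main: "\<bar>w t x\<bar> \<le> K0 + K1 + 2 * C * M * sqrt t / R\<^sup>2" if R: "0 < R" for R
  proof -
    txt \<open>The cutoff is \<open>\<omega>^3\<close>. Its derivative has the factor \<open>x - y\<close>, which compensates the
      singularity of \<open>\<kappa>y\<close> at the pole; so no plateau around \<open>x\<close> is needed.\<close>
    define \<omega> where "\<omega> y = 1 - (x - y)\<^sup>2 / R\<^sup>2" for y
    define \<zeta> where "\<zeta> y = \<omega> y ^ 3" for y
    define \<zeta>1 where "\<zeta>1 y = 6 * (x - y) / R\<^sup>2 * (\<omega> y)\<^sup>2" for y
    define \<zeta>2 where "\<zeta>2 y = 24 * (x - y)\<^sup>2 / (R\<^sup>2 * R\<^sup>2) * \<omega> y - 6 / R\<^sup>2 * (\<omega> y)\<^sup>2" for y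
    have d\<omega>: "(\<omega> has_real_derivative 2 * (x - y) / R\<^sup>2) (at y)" for y
      unfolding \<omega>_def using R by (auto intro!: derivative_eq_intros simp: field_simps)
    have d\<zeta>: "(\<zeta> has_real_derivative \<zeta>1 y) (at y)" for y
      unfolding \<zeta>_def[abs_def] \<zeta>1_def by (auto intro!: derivative_eq_intros d\<omega>)
    have d\<zeta>1: "(\<zeta>1 has_real_derivative \<zeta>2 y) (at y)" for y
    proof -
      have "(\<zeta>1 has_real_derivative (- 6 / R\<^sup>2) * (\<omega> y)\<^sup>2 + 6 * (x - y) / R\<^sup>2 * (2 * \<omega> y * (2 * (x - y) / R\<^sup>2))) (at y)"
      proof -
        have 1: "((\<lambda>y. 6 * (x - y) / R\<^sup>2) has_real_derivative - 6 / R\<^sup>2) (at y)"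
          by (rule DERIV_cdivide) (auto intro!: derivative_eq_intros)
        have 2: "((\<lambda>y. (\<omega> y)\<^sup>2) has_real_derivative 2 * \<omega> y * (2 * (x - y) / R\<^sup>2)) (at y)"
          by (auto intro!: derivative_eq_intros d\<omega>)
        show ?thesis using DERIV_mult[OF 1 2] unfolding \<zeta>1_def[abs_def] by (simp only: mult.commute)
      qed
      moreover have "(- 6 / R\<^sup>2) * (\<omega> y)\<^sup>2 + 6 * (x - y) / R\<^sup>2 * (2 * \<omega> y * (2 * (x - y) / R\<^sup>2)) = \<zeta>2 y"
      proof -
        have "(- 6 / r) * w\<^sup>2 + 6 * u / r * (2 * w * (2 * u / r)) = 24 * u\<^sup>2 / (r * r) * w - 6 / r * w\<^sup>2" for r u w :: real
          by (simp add: power2_eq_square)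
        then show ?thesis unfolding \<zeta>2_def .
      qed
      ultimately show ?thesis by metis
    qed
    have c\<omega>: "continuous_on Y \<omega>" for Y unfolding \<omega>_def using R by (intro continuous_intros) auto
    have c\<zeta>: "continuous_on Y \<zeta>" "continuous_on Y \<zeta>1" "continuous_on Y \<zeta>2" for Y
      unfolding \<zeta>_def \<zeta>1_def \<zeta>2_def using R by (intro continuous_intros c\<omega>; simp)+
    have c\<zeta>s: "continuous_on Z (\<lambda>x. \<zeta> (snd x))" "continuous_on Z (\<lambda>x. \<zeta>1 (snd x))" "continuous_on Z (\<lambda>x. \<zeta>2 (snd x))"
      for Z :: "(real \<times> real) set"
      by (intro continuous_on_compose2[OF c\<zeta>(1)[of UNIV]] continuous_on_compose2[OF c\<zeta>(2)[of UNIV]]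
          continuous_on_compose2[OF c\<zeta>(3)[of UNIV]] continuous_on_snd continuous_on_id; simp)+
    have \<omega>: "0 \<le> \<omega> y" "\<omega> y \<le> 1" "(x - y)\<^sup>2 \<le> R\<^sup>2" if "y \<in> (?B R)" for y
    proof -
      show "(x - y)\<^sup>2 \<le> R\<^sup>2" using that R by (intro abs_le_square_iff[THEN iffD1]) auto
      then show "0 \<le> \<omega> y" "\<omega> y \<le> 1" using R by (auto simp: \<omega>_def field_simps)
    qed
    have \<zeta>01: "0 \<le> \<zeta> y" "\<zeta> y \<le> 1" if "y \<in> (?B R)" for y
      using \<omega>[OF that] by (auto simp: \<zeta>_def power_le_one)
    \<comment> \<open>What the cutoff leaves of the adjoint equation:
      \<open>\<kappa> * (\<zeta>2 + \<zeta>1 * (2 * \<eta> - m))\<close>. The drift cancels in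
      \<open>2 * \<eta> - m\<close>.\<close>
    define L where "L s y = \<kappa> s y * (\<zeta>2 y + \<zeta>1 y * (x - y) / (t - s))" for s y
    have L: "\<bar>L s y\<bar> \<le> C / (R\<^sup>2 * sqrt (t - s)) * ?e y"
      if s: "0 < s" "s < t" and y: "y \<in> (?B R)" for s y
    proof -
      note \<omega>y = \<omega>[OF y]
      have w2: "0 \<le> (\<omega> y)\<^sup>2" "(\<omega> y)\<^sup>2 \<le> 1" using \<omega>y by (auto simp: power_le_one)
      have "(x - y)\<^sup>2 * \<omega> y \<le> R\<^sup>2 * 1" using \<omega>y by (intro mult_mono) auto
      then have 1: "24 * (x - y)\<^sup>2 / (R\<^sup>2 * R\<^sup>2) * \<omega> y \<le> 24 / R\<^sup>2" "0 \<le> 24 * (x - y)\<^sup>2 / (R\<^sup>2 * R\<^sup>2) * \<omega> y"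
      proof -
        show "0 \<le> 24 * (x - y)\<^sup>2 / (R\<^sup>2 * R\<^sup>2) * \<omega> y" using \<omega>y by simp
        have "24 * (x - y)\<^sup>2 / (R\<^sup>2 * R\<^sup>2) * \<omega> y = 24 * ((x - y)\<^sup>2 * \<omega> y) / (R\<^sup>2 * R\<^sup>2)" by simp
        also have "\<dots> \<le> 24 * (R\<^sup>2 * 1) / (R\<^sup>2 * R\<^sup>2)"
          using \<open>(x - y)\<^sup>2 * \<omega> y \<le> R\<^sup>2 * 1\<close> by (intro divide_right_mono mult_left_mono) auto
        also have "24 * (r * 1) / (r * r) = 24 / r" for r :: real by simp
        finally show "24 * (x - y)\<^sup>2 / (R\<^sup>2 * R\<^sup>2) * \<omega> y \<le> 24 / R\<^sup>2" .
      qed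
      have 2: "6 / R\<^sup>2 * (\<omega> y)\<^sup>2 \<le> 6 / R\<^sup>2 * 1" "0 \<le> 6 / R\<^sup>2 * (\<omega> y)\<^sup>2"
        using w2 by (intro mult_left_mono) auto
      \<comment> \<open>\<open>30 = 24 + 6\<close>, the sizes of the two terms of
        \<open>\<zeta>2\<close>.\<close>
      have \<zeta>2: "\<bar>\<zeta>2 y\<bar> \<le> 30 / R\<^sup>2" 
      proof -
        have "24 / R\<^sup>2 \<le> 30 / R\<^sup>2" "6 / R\<^sup>2 * 1 \<le> 30 / R\<^sup>2" by (simp_all add: divide_right_mono)
        then show ?thesis unfolding \<zeta>2_def using 1 2 by linarith
      qed
      have e: "\<zeta>1 y * (x - y) / (t - s) = 6 * ((x - y)\<^sup>2 / (t - s)) / R\<^sup>2 * (\<omega> y)\<^sup>2"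
        unfolding \<zeta>1_def by (simp add: power2_eq_square mult_ac)
      also have "6 * ((x - y)\<^sup>2 / (t - s)) / R\<^sup>2 * (\<omega> y)\<^sup>2 \<le> 6 * ((x - y)\<^sup>2 / (t - s)) / R\<^sup>2 * 1"
        using w2 s by (intro mult_left_mono) auto
      finally have 3: "\<zeta>1 y * (x - y) / (t - s) \<le> 6 * ((x - y)\<^sup>2 / (t - s)) / R\<^sup>2" by simp
      have 4: "0 \<le> \<zeta>1 y * (x - y) / (t - s)"
        unfolding e using w2 s by (intro mult_nonneg_nonneg divide_nonneg_nonneg) auto
      have "\<bar>\<zeta>2 y + \<zeta>1 y * (x - y) / (t - s)\<bar> \<le> 30 / R\<^sup>2 + 6 * ((x - y)\<^sup>2 / (t - s)) / R\<^sup>2"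
        using \<zeta>2 3 4 by linarith
      also have "\<dots> = (30 + 6 * ((x - y)\<^sup>2 / (t - s))) / R\<^sup>2" by (simp add: add_divide_distrib)
      finally have "\<bar>L s y\<bar> \<le> \<kappa> s y * ((30 + 6 * ((x - y)\<^sup>2 / (t - s))) / R\<^sup>2)"
        unfolding L_def abs_mult using pos[OF s(2), of y] by (intro mult_mono) auto
      also have "\<dots> = \<kappa> s y * (30 + 6 * ((x - y)\<^sup>2 / (t - s))) / R\<^sup>2" by simp
      also have "\<dots> \<le> (C / sqrt (t - s) * ?e y) / R\<^sup>2"
        using s by (intro divide_right_mono gauss) auto
      finally show ?thesis by (simp add: mult.commute)
    qed
    define A where "A s = integral (?B R) (\<lambda>y. w s y * (\<zeta> y * \<kappa> s y))" for s
    define A' where "A' s = integral (?B R) (\<lambda>y. w s y * L s y + F s y * (\<zeta> y * \<kappa> s y))" for s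
    have dA: "(A has_real_derivative A' r) (at r)" if r: "r \<in> {0<..<t}" for r
    proof -
      define \<phi>s where "\<phi>s s y = \<zeta> y * \<kappa>s s y" for s y
      define \<phi>y where "\<phi>y s y = \<zeta>1 y * \<kappa> s y + \<zeta> y * \<kappa>y s y" for s y
      define \<phi>yy where "\<phi>yy s y = \<zeta>2 y * \<kappa> s y + 2 * \<zeta>1 y * \<kappa>y s y + \<zeta> y * \<kappa>yy s y" for s y
      have "(A has_real_derivative
        integral (?B R) (\<lambda>y. w r y * (\<phi>s r y + \<phi>yy r y - m * \<phi>y r y + p * (\<zeta> y * \<kappa> r y)) + F r y * (\<zeta> y * \<kappa> r y))) (at r)"
        unfolding A_def
      proof (rule green_derivative[OF solw _ r])
        show "x - R \<le> x + R" using R by simp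
        show "continuous_on ({0<..<t} \<times> UNIV) (\<lambda>(s, y). \<zeta> y * \<kappa> s y)"
          "continuous_on ({0<..<t} \<times> UNIV) (\<lambda>(s, y). \<phi>s s y)"
          "continuous_on ({0<..<t} \<times> UNIV) (\<lambda>(s, y). \<phi>y s y)"
          "continuous_on ({0<..<t} \<times> UNIV) (\<lambda>(s, y). \<phi>yy s y)"
          unfolding split_beta \<phi>s_def \<phi>y_def \<phi>yy_def by (intro continuous_intros c\<zeta>s c\<kappa>' cK)+
        fix q y assume q: "q \<in> {0<..<t}"
        then have q': "q < t" by auto
        show "((\<lambda>s. \<zeta> y * \<kappa> s y) has_real_derivative \<phi>s q y) (at q)"
          unfolding \<phi>s_def by (rule DERIV_cmult[OF dK(3)[OF q']])
        show "((\<lambda>y. \<zeta> y * \<kappa> q y) has_real_derivative \<phi>y q y) (at y)"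
          using DERIV_mult[OF d\<zeta>[of y] dK(1)[OF q', of y]] by (simp add: \<phi>y_def algebra_simps)
        show "((\<lambda>y. \<phi>y q y) has_real_derivative \<phi>yy q y) (at y)"
          using DERIV_add[OF DERIV_mult[OF d\<zeta>1[of y] dK(1)[OF q', of y]] DERIV_mult[OF d\<zeta>[of y] dK(2)[OF q', of y]]]
          unfolding \<phi>y_def \<phi>yy_def by (simp add: algebra_simps)
      next
        have "\<omega> (x - R) = 0" "\<omega> (x + R) = 0" using R by (auto simp: \<omega>_def)
        then show "\<zeta> (x - R) * \<kappa> r (x - R) = 0" "\<zeta> (x + R) * \<kappa> r (x + R) = 0"
            "\<phi>y r (x - R) = 0" "\<phi>y r (x + R) = 0"
          by (auto simp: \<phi>y_def \<zeta>_def \<zeta>1_def)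
      qed
      moreover have "\<phi>s r y + \<phi>yy r y - m * \<phi>y r y + p * (\<zeta> y * \<kappa> r y) = L r y" for y
      proof -
        have "\<phi>s r y + \<phi>yy r y - m * \<phi>y r y + p * (\<zeta> y * \<kappa> r y)
          = \<zeta> y * (\<kappa>s r y + \<kappa>yy r y - m * \<kappa>y r y + p * \<kappa> r y) + \<kappa> r y * (\<zeta>2 y + \<zeta>1 y * (2 * \<eta> r y - m))"
          unfolding \<phi>s_def \<phi>y_def \<phi>yy_def \<kappa>y_def by (simp add: algebra_simps)
        moreover have "2 * \<eta> r y - m = (x - y) / (t - r)" using r by (simp add: \<eta>_def field_simps)
        ultimately show ?thesis by (simp add: backward_equation L_def)
      qed
      ultimately show ?thesis by (simp add: A'_def)
    qed
    have cw': "continuous_on Y (\<lambda>y. w s y)" if "0 \<le> s" for s Y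
      by (rule continuous_on_slice[OF cw[unfolded split_beta]]) (use that in auto)
    have cS': "continuous_on Y (\<lambda>y. S s y)" if "0 \<le> s" for s Y
      by (rule continuous_on_slice[OF cS[unfolded split_beta]]) (use that in auto)
    have cF': "continuous_on Y (\<lambda>y. F s y)" if "0 < s" for s Y
      by (rule continuous_on_slice[OF cF[unfolded split_beta]]) (use that in auto)
    have c\<kappa>s: "continuous_on Y (\<lambda>y. \<kappa> s y)" if "s \<in> {0..<t}" for s Y
      by (rule continuous_on_slice[OF c\<kappa>]) (use that in auto)
    have cL: "continuous_on Y (\<lambda>y. L s y)" if "s \<in> {0..<t}" for s Y
      unfolding L_def using that by (intro continuous_intros c\<kappa>s c\<zeta>) auto
    have A': "\<bar>A' s\<bar> \<le> I s + C * M / R\<^sup>2 * (1 / sqrt (t - s))" if s: "0 < s" "s < t" for s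
    proof -
      have s0: "0 \<le> s" "s \<in> {0..<t}" using s by auto
      have "norm (A' s) \<le> integral (?B R) (\<lambda>y. C / (R\<^sup>2 * sqrt (t - s)) * (S s y * ?e y) + \<kappa> s y * \<bar>F s y\<bar>)"
        unfolding A'_def
      proof (rule Henstock_Kurzweil_Integration.integral_norm_bound_integral)
        show "(\<lambda>y. w s y * L s y + F s y * (\<zeta> y * \<kappa> s y)) integrable_on (?B R)"
          by (intro integrable_continuous_real continuous_intros cw' cL cF' c\<zeta> c\<kappa>s s s0)
        show "(\<lambda>y. C / (R\<^sup>2 * sqrt (t - s)) * (S s y * ?e y) + \<kappa> s y * \<bar>F s y\<bar>) integrable_on (?B R)"
          using t by (intro integrable_continuous_real continuous_on_add continuous_on_mult[OF continuous_on_const] continuous_intros cS' cF' c\<kappa>s s s0) auto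
        fix y assume y: "y \<in> (?B R)"
        have "\<bar>w s y * L s y\<bar> \<le> S s y * (C / (R\<^sup>2 * sqrt (t - s)) * ?e y)"
          unfolding abs_mult using wS[OF s0(1)] S[OF s0(1)] L[OF s y] by (intro mult_mono) auto
        also have "\<dots> = C / (R\<^sup>2 * sqrt (t - s)) * (S s y * ?e y)"
          by (rule mult.left_commute)
        finally have 1: "\<bar>w s y * L s y\<bar> \<le> C / (R\<^sup>2 * sqrt (t - s)) * (S s y * ?e y)" .
        have "\<bar>F s y * (\<zeta> y * \<kappa> s y)\<bar> = (\<zeta> y * \<kappa> s y) * \<bar>F s y\<bar>"
          using \<zeta>01[OF y] pos[OF s(2), of y] by (simp add: abs_mult)
        also have "\<dots> \<le> (1 * \<kappa> s y) * \<bar>F s y\<bar>"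
          using \<zeta>01[OF y] pos[OF s(2), of y] by (intro mult_right_mono) auto
        finally have 2: "\<bar>F s y * (\<zeta> y * \<kappa> s y)\<bar> \<le> \<kappa> s y * \<bar>F s y\<bar>" by simp
        show "norm (w s y * L s y + F s y * (\<zeta> y * \<kappa> s y)) \<le> C / (R\<^sup>2 * sqrt (t - s)) * (S s y * ?e y) + \<kappa> s y * \<bar>F s y\<bar>"
          unfolding real_norm_def by (rule order_trans[OF abs_triangle_ineq add_mono[OF 1 2]])
      qed
      also have "\<dots> = C / (R\<^sup>2 * sqrt (t - s)) * integral (?B R) (\<lambda>y. S s y * ?e y)
          + integral (?B R) (\<lambda>y. \<kappa> s y * \<bar>F s y\<bar>)"
      proof (subst Henstock_Kurzweil_Integration.integral_add)
        show "(\<lambda>y. C / (R\<^sup>2 * sqrt (t - s)) * (S s y * ?e y)) integrable_on (?B R)"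
          using t by (intro integrable_continuous_real continuous_intros cS' s0) auto
        show "(\<lambda>y. \<kappa> s y * \<bar>F s y\<bar>) integrable_on (?B R)"
          by (intro integrable_continuous_real continuous_intros cF' c\<kappa>s s s0)
      qed simp
      also have "\<dots> \<le> C / (R\<^sup>2 * sqrt (t - s)) * M + I s"
        using I[OF s R] M(2)[OF s(1) _ R] s C R unfolding \<kappa>_def
        by (intro add_mono mult_left_mono) auto
      finally show ?thesis by (simp add: mult_ac)
    qed
    \<comment> \<open>\<open>A\<close> is differentiable only at interior times, hence the compact
      subinterval. The term \<open>2 * sqrt t\<close> bounds the integral of
      \<open>1 / sqrt (t - r)\<close>.\<close>
    have diff: "\<bar>A s1\<bar> \<le> \<bar>A s0\<bar> + (K1 + 2 * C * M * sqrt t / R\<^sup>2)" if s: "0 < s0" "s0 < s1" "s1 < t" for s0 s1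
    proof -
      have ftc: "(A' has_integral (A s1 - A s0)) {s0..s1}"
      proof (rule fundamental_theorem_of_calculus)
        show "(A has_vector_derivative A' r) (at r within {s0..s1})" if "r \<in> {s0..s1}" for r
          using dA[of r] that s
          by (simp add: has_real_derivative_iff_has_vector_derivative has_vector_derivative_at_within)
      qed (use s in simp)
      have sq: "((\<lambda>r. 1 / sqrt (t - r)) has_integral (- 2 * sqrt (t - s1) - (- 2 * sqrt (t - s0)))) {s0..s1}"
      proof (rule fundamental_theorem_of_calculus)
        fix r assume "r \<in> {s0..s1}"
        then have "((\<lambda>r. - 2 * sqrt (t - r)) has_real_derivative 1 / sqrt (t - r)) (at r)"
          using s by (auto intro!: derivative_eq_intros simp: field_simps)
        then show "((\<lambda>r. - 2 * sqrt (t - r)) has_vector_derivative 1 / sqrt (t - r)) (at r within {s0..s1})"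
          by (simp add: has_real_derivative_iff_has_vector_derivative has_vector_derivative_at_within)
      qed (use s in simp)
      have I1: "I integrable_on {s0..s1}" "integral {s0..s1} I \<le> K1" using K1[OF s] by auto
      have gi: "((\<lambda>r. I r + C * M / R\<^sup>2 * (1 / sqrt (t - r))) has_integral
          integral {s0..s1} I + C * M / R\<^sup>2 * (- 2 * sqrt (t - s1) - (- 2 * sqrt (t - s0)))) {s0..s1}"
        by (intro has_integral_add has_integral_mult_right sq integrable_integral I1)
      have "norm (integral {s0..s1} A') \<le> integral {s0..s1} (\<lambda>r. I r + C * M / R\<^sup>2 * (1 / sqrt (t - r)))"
      proof (rule Henstock_Kurzweil_Integration.integral_norm_bound_integral)
        show "norm (A' r) \<le> I r + C * M / R\<^sup>2 * (1 / sqrt (t - r))" if "r \<in> {s0..s1}" for r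
          using A'[of r] that s by simp
      qed (use ftc gi in \<open>auto intro: has_integral_integrable\<close>)
      also have "\<dots> = integral {s0..s1} I + C * M / R\<^sup>2 * (- 2 * sqrt (t - s1) - (- 2 * sqrt (t - s0)))"
        using gi by (rule integral_unique)
      also have "\<dots> \<le> K1 + C * M / R\<^sup>2 * (2 * sqrt t)"
        using I1(2) C M s by (intro add_mono mult_left_mono) (auto simp: less_imp_le intro: order_trans[of _ "2 * sqrt (t - s0)"])
      finally show ?thesis using integral_unique[OF ftc] by (simp add: mult_ac)
    qed
    have "continuous_on {0..<t} A"
      unfolding A_def cbox_interval[symmetric]
    proof (rule integral_continuous_on_param)
      have "continuous_on ({0..<t} \<times> cbox (x - R) (x + R)) (\<lambda>x. w (fst x) (snd x))"
        by (rule continuous_on_case_prod_subset[OF cw]) auto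
      moreover have "continuous_on ({0..<t} \<times> cbox (x - R) (x + R)) (\<lambda>x. \<kappa> (fst x) (snd x))"
        by (rule continuous_on_subset[OF c\<kappa>]) auto
      ultimately show "continuous_on ({0..<t} \<times> cbox (x - R) (x + R)) (\<lambda>(s, y). w s y * (\<zeta> y * \<kappa> s y))"
        unfolding split_beta by (intro continuous_intros c\<zeta>s)
    qed
    note cA = this
    have A0: "\<bar>A 0\<bar> \<le> K0"
    proof -
      have "norm (A 0) \<le> integral (?B R) (\<lambda>y. \<kappa> 0 y * \<bar>w 0 y\<bar>)"
        unfolding A_def
      proof (rule Henstock_Kurzweil_Integration.integral_norm_bound_integral)
        fix y assume y: "y \<in> (?B R)"
        have "\<bar>w 0 y\<bar> * (\<zeta> y * \<kappa> 0 y) \<le> \<bar>w 0 y\<bar> * (1 * \<kappa> 0 y)"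
          using \<zeta>01[OF y] pos[OF t, of y] by (intro mult_left_mono mult_right_mono) auto
        then show "norm (w 0 y * (\<zeta> y * \<kappa> 0 y)) \<le> \<kappa> 0 y * \<bar>w 0 y\<bar>"
          using \<zeta>01[OF y] pos[OF t, of y] by (simp add: abs_mult mult.commute)
      qed (use t in \<open>intro integrable_continuous_real continuous_intros cw' c\<zeta> c\<kappa>s; simp\<close>)+
      also have "\<dots> \<le> K0" using K0[OF R] by (simp add: \<kappa>_def)
      finally show ?thesis by simp
    qed
    \<comment> \<open>The lower end is sent to 0, using that both \<open>w\<close> and the kernel
      are continuous up to time 0.\<close>
    have As1: "\<bar>A s1\<bar> \<le> K0 + (K1 + 2 * C * M * sqrt t / R\<^sup>2)" if s1: "0 < s1" "s1 < t" for s1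
    proof -
      define \<sigma> where "\<sigma> n = s1 / real (n + 2)" for n :: nat
      have \<sigma>: "0 < \<sigma> n" "\<sigma> n < s1" for n using s1 by (auto simp: \<sigma>_def field_simps add_pos_nonneg)
      have \<sigma>0: "\<sigma> \<longlonglongrightarrow> 0"
        unfolding \<sigma>_def using LIMSEQ_ignore_initial_segment[OF lim_const_over_n, of s1 2] by simp
      have "(\<lambda>n. A (\<sigma> n)) \<longlonglongrightarrow> A 0"
      proof (rule continuous_on_tendsto_compose[OF cA \<sigma>0])
        show "\<forall>\<^sub>F n in sequentially. \<sigma> n \<in> {0..<t}"
          using \<sigma> s1 by (intro always_eventually) (auto intro: less_imp_le less_trans)
      qed (use t in auto)
      then have "(\<lambda>n. \<bar>A (\<sigma> n)\<bar> + (K1 + 2 * C * M * sqrt t / R\<^sup>2)) \<longlonglongrightarrow> \<bar>A 0\<bar> + (K1 + 2 * C * M * sqrt t / R\<^sup>2)"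
        by (intro tendsto_intros)
      then have "\<bar>A s1\<bar> \<le> \<bar>A 0\<bar> + (K1 + 2 * C * M * sqrt t / R\<^sup>2)"
        by (rule LIMSEQ_le_const) (use diff \<sigma> s1 in blast)
      then show ?thesis using A0 by simp
    qed
    \<comment> \<open>The upper end is sent to the pole, where the pairing concentrates at
      \<open>x\<close>.\<close>
    have "(\<lambda>n. A (t - t / real (n + 2))) \<longlonglongrightarrow> w t x * \<zeta> x"
      unfolding A_def \<kappa>_def using kernel_concentration[OF cw c\<zeta>(1) t R, of x m p] by simp
    moreover have "\<zeta> x = 1" by (simp add: \<zeta>_def \<omega>_def)
    ultimately have "(\<lambda>n. \<bar>A (t - t / real (n + 2))\<bar>) \<longlonglongrightarrow> \<bar>w t x\<bar>"
      using tendsto_rabs by fastforce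
    then have "\<bar>w t x\<bar> \<le> K0 + (K1 + 2 * C * M * sqrt t / R\<^sup>2)"
    proof (rule LIMSEQ_le_const2)
      have "\<bar>A (t - t / real (n + 2))\<bar> \<le> K0 + (K1 + 2 * C * M * sqrt t / R\<^sup>2)" for n
        using t by (intro As1) (auto simp: field_simps add_pos_nonneg)
      then show "\<exists>N. \<forall>n\<ge>N. \<bar>A (t - t / real (n + 2))\<bar> \<le> K0 + (K1 + 2 * C * M * sqrt t / R\<^sup>2)" by blast
    qed
    then show ?thesis by simp
  qed
  have "(\<lambda>n. K0 + K1 + 2 * C * M * sqrt t / (real (Suc n))\<^sup>2) \<longlonglongrightarrow> K0 + K1 + 2 * C * M * sqrt t * 0\<^sup>2"
    unfolding divide_inverse power_inverse[symmetric]
    by (intro tendsto_intros LIMSEQ_inverse_real_of_nat)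
  then have "(\<lambda>n. K0 + K1 + 2 * C * M * sqrt t / (real (Suc n))\<^sup>2) \<longlonglongrightarrow> K0 + K1" by simp
  then show ?thesis by (rule LIMSEQ_le_const) (use main in \<open>auto intro!: exI[of _ 0]\<close>)
qed

subsection \<open>The variation of constants formula in \<open>L^1\<close>\<close>

lemma semigroup_kernel_shift_measurable [measurable]:
  "(\<lambda>y. semigroup_kernel m p t (z - y)) \<in> borel_measurable lebesgue"
  by (rule measurable_completion) measurable

lemma integrable_semigroup_kernel_mult:
  assumes "0 < t" "integrable lebesgue f"
  shows "integrable lebesgue (\<lambda>y. semigroup_kernel m p t (z - y) * f y)"
proof (rule Bochner_Integration.integrable_bound)
  show "integrable lebesgue (\<lambda>y. exp (p * t) / sqrt (4 * pi * t) * f y)"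
    using assms by (intro integrable_mult_right) auto
  have "f \<in> borel_measurable lebesgue" using assms(2) by (rule borel_measurable_integrable)
  then show "(\<lambda>y. semigroup_kernel m p t (z - y) * f y) \<in> borel_measurable lebesgue"
    by (intro borel_measurable_times semigroup_kernel_shift_measurable)
  have "norm (semigroup_kernel m p t (z - y) * f y) \<le> norm (exp (p * t) / sqrt (4 * pi * t) * f y)" for y
    unfolding norm_mult using assms(1) semigroup_kernel_le[OF assms(1), of m p "z - y"]
    by (intro mult_right_mono) auto
  then show "AE y in lebesgue. norm (semigroup_kernel m p t (z - y) * f y) \<le> norm (exp (p * t) / sqrt (4 * pi * t) * f y)"
    by simp
qed

lemma kernel_integral_bound:
  assumes "0 < t" "integrable lebesgue f"
  shows "\<bar>LINT y|lebesgue. semigroup_kernel m p t (z - y) * f y\<bar> \<le> exp (p * t) / sqrt (4 * pi * t) * L1_norm f"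
proof -
  let ?k = "semigroup_kernel m p"
  have "norm (LINT y|lebesgue. ?k t (z - y) * f y)
      \<le> (LINT y|lebesgue. norm (?k t (z - y) * f y))"
    by (rule integral_norm_bound)
  also have "\<dots> \<le> (LINT y|lebesgue. exp (p * t) / sqrt (4 * pi * t) * \<bar>f y\<bar>)"
  proof (rule integral_mono)
    show "integrable lebesgue (\<lambda>y. norm (?k t (z - y) * f y))"
      by (intro integrable_norm integrable_semigroup_kernel_mult assms)
    show "integrable lebesgue (\<lambda>y. exp (p * t) / sqrt (4 * pi * t) * \<bar>f y\<bar>)"
      using assms by (intro integrable_mult_right integrable_abs)
    show "norm (?k t (z - y) * f y) \<le> exp (p * t) / sqrt (4 * pi * t) * \<bar>f y\<bar>" for y
      using mult_right_mono[OF semigroup_kernel_le[OF assms(1), of m p "z - y"], of "\<bar>f y\<bar>"] assms(1)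
      by (simp add: abs_mult)
  qed
  also have "\<dots> = exp (p * t) / sqrt (4 * pi * t) * L1_norm f"
    unfolding L1_norm_def by (rule integral_mult_right_zero)
  finally show ?thesis by simp
qed

lemma continuous_L1_on_tendsto:
  assumes f: "continuous_L1_on J f" and s: "s \<in> J" "\<And>n. \<sigma> n \<in> J" "\<sigma> \<longlonglongrightarrow> s"
  shows "(\<lambda>n. L1_norm (\<lambda>z. f (\<sigma> n) z - f s z)) \<longlonglongrightarrow> 0"
proof -
  let ?g = "\<lambda>r. L1_norm (\<lambda>z. f r z - f s z)"
  have g0: "?g s = 0" by (simp add: L1_norm_def)
  have "(?g \<longlongrightarrow> 0) (at s within J)" using f s(1) by (auto simp: continuous_L1_on_def)
  then have "continuous (at s within J) ?g" unfolding continuous_within g0 .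
  from continuous_within_tendsto_compose'[OF this s(2,3)] show ?thesis unfolding g0 .
qed

lemma continuous_L1_on_subset:
  assumes "continuous_L1_on J f" "K \<subseteq> J"
  shows "continuous_L1_on K f"
  using assms unfolding continuous_L1_on_def by (meson subsetD tendsto_within_subset)

lemma continuous_on_L1_norm:
  assumes f: "continuous_L1_on J f"
  shows "continuous_on J (\<lambda>s. L1_norm (f s))"
proof (rule continuous_on_sequentiallyI)
  fix \<sigma> s assume s: "\<forall>n. \<sigma> n \<in> J" "s \<in> J" "\<sigma> \<longlonglongrightarrow> s"
  have int: "integrable lebesgue (f r)" if "r \<in> J" for r using f that by (auto simp: continuous_L1_on_def)
  have "(\<lambda>n. L1_norm (\<lambda>z. f (\<sigma> n) z - f s z)) \<longlonglongrightarrow> 0"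
    using continuous_L1_on_tendsto[OF f s(2) _ s(3)] s(1) by blast
  moreover have "\<bar>L1_norm (f (\<sigma> n)) - L1_norm (f s)\<bar> \<le> L1_norm (\<lambda>z. f (\<sigma> n) z - f s z)" for n
  proof -
    have i: "integrable lebesgue (f (\<sigma> n))" "integrable lebesgue (f s)" using int s by auto
    have "L1_norm (f (\<sigma> n)) - L1_norm (f s) = (LINT z|lebesgue. \<bar>f (\<sigma> n) z\<bar> - \<bar>f s z\<bar>)"
      unfolding L1_norm_def using i by (intro Bochner_Integration.integral_diff[symmetric] integrable_abs)
    also have "norm \<dots> \<le> (LINT z|lebesgue. norm (\<bar>f (\<sigma> n) z\<bar> - \<bar>f s z\<bar>))"
      by (rule integral_norm_bound)
    also have "\<dots> \<le> (LINT z|lebesgue. \<bar>f (\<sigma> n) z - f s z\<bar>)"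
      using i by (intro integral_mono integrable_norm integrable_abs Bochner_Integration.integrable_diff) auto
    finally show ?thesis by (simp add: L1_norm_def)
  qed
  then have "\<forall>\<^sub>F n in sequentially. norm (L1_norm (f (\<sigma> n)) - L1_norm (f s)) \<le> L1_norm (\<lambda>z. f (\<sigma> n) z - f s z)"
    by (intro always_eventually) simp
  ultimately have "(\<lambda>n. L1_norm (f (\<sigma> n)) - L1_norm (f s)) \<longlonglongrightarrow> 0"
    by (rule Lim_null_comparison[rotated])
  then show "(\<lambda>n. L1_norm (f (\<sigma> n))) \<longlonglongrightarrow> L1_norm (f s)" by (simp add: LIM_zero_iff)
qed

text \<open>Along a convergent sequence of times below \<open>t\<close> the kernels are uniformly
  bounded. Hence replacing \<open>f (\<sigma> n)\<close> by \<open>f s\<close> costs only the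
  distance in \<open>L^1\<close>, and for fixed \<open>f s\<close> dominated convergence applies.
  Continuity is wanted jointly in time and space, since it supplies the Borel measurability for
  Tonelli's theorem in the decay estimate.\<close>

lemma continuous_on_kernel_integral:
  assumes f: "continuous_L1_on J f" and J: "\<And>s. s \<in> J \<Longrightarrow> s < t"
  shows "continuous_on (J \<times> UNIV) (\<lambda>(s, z). LINT y|lebesgue. semigroup_kernel m p (t - s) (z - y) * f s y)"
proof (rule continuous_on_sequentiallyI)
  fix \<upsilon> :: "nat \<Rightarrow> real \<times> real" and a assume \<upsilon>: "\<forall>n. \<upsilon> n \<in> J \<times> UNIV" "a \<in> J \<times> UNIV" "\<upsilon> \<longlonglongrightarrow> a"
  define \<sigma> where "\<sigma> n = fst (\<upsilon> n)" for n
  define \<zeta> where "\<zeta> n = snd (\<upsilon> n)" for n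
  define s where "s = fst a"
  define z where "z = snd a"
  have s: "s \<in> J" "\<And>n. \<sigma> n \<in> J" "\<sigma> \<longlonglongrightarrow> s" "\<zeta> \<longlonglongrightarrow> z"
    using \<upsilon> unfolding s_def z_def \<sigma>_def \<zeta>_def by (auto intro: tendsto_fst tendsto_snd simp: mem_Times_iff)
  have pos: "0 < t - s" "\<And>n. 0 < t - \<sigma> n" using s J by auto
  have int: "integrable lebesgue (f r)" if "r \<in> J" for r using f that by (auto simp: continuous_L1_on_def)
  define b where "b n = exp (p * (t - \<sigma> n)) / sqrt (4 * pi * (t - \<sigma> n))" for n
  have "b \<longlonglongrightarrow> exp (p * (t - s)) / sqrt (4 * pi * (t - s))"
    unfolding b_def using pos by (intro tendsto_intros s) auto
  then obtain B where B: "B > 0" "\<And>n. norm (b n) \<le> B"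
    using convergent_imp_Bseq[unfolded convergent_def] BseqE by metis
  have kB: "semigroup_kernel m p (t - \<sigma> n) x \<le> B" for n x
    using semigroup_kernel_le[OF pos(2), of m p n x] B(2)[of n] unfolding b_def real_norm_def
    by (meson abs_le_D1 order_trans)
  have 1: "(\<lambda>n. LINT y|lebesgue. semigroup_kernel m p (t - \<sigma> n) (\<zeta> n - y) * f s y)
     \<longlonglongrightarrow> (LINT y|lebesgue. semigroup_kernel m p (t - s) (z - y) * f s y)"
  proof (rule integral_dominated_convergence[where M = lebesgue and w = "\<lambda>y. B * \<bar>f s y\<bar>"
        and s = "\<lambda>n y. semigroup_kernel m p (t - \<sigma> n) (\<zeta> n - y) * f s y"
        and f = "\<lambda>y. semigroup_kernel m p (t - s) (z - y) * f s y"])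
    show "(\<lambda>y. semigroup_kernel m p (t - s) (z - y) * f s y) \<in> borel_measurable lebesgue"
      "(\<lambda>y. semigroup_kernel m p (t - \<sigma> n) (\<zeta> n - y) * f s y) \<in> borel_measurable lebesgue" for n
      using int s pos by (auto intro!: borel_measurable_integrable[OF integrable_semigroup_kernel_mult])
    show "integrable lebesgue (\<lambda>y. B * \<bar>f s y\<bar>)"
      using int s by (intro integrable_mult_right integrable_abs) auto
    have "norm (semigroup_kernel m p (t - \<sigma> n) (\<zeta> n - y) * f s y) \<le> B * \<bar>f s y\<bar>" for n y
      using mult_right_mono[OF kB[of n "\<zeta> n - y"], of "\<bar>f s y\<bar>"] pos(2)[of n] by (simp add: abs_mult)
    then show "AE y in lebesgue. norm (semigroup_kernel m p (t - \<sigma> n) (\<zeta> n - y) * f s y) \<le> B * \<bar>f s y\<bar>" for n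
      by simp
    have "(\<lambda>n. semigroup_kernel m p (t - \<sigma> n) (\<zeta> n - y) * f s y) \<longlonglongrightarrow> semigroup_kernel m p (t - s) (z - y) * f s y" for y
      unfolding semigroup_kernel_def using pos by (intro tendsto_intros s) auto
    then show "AE y in lebesgue. (\<lambda>n. semigroup_kernel m p (t - \<sigma> n) (\<zeta> n - y) * f s y) \<longlonglongrightarrow> semigroup_kernel m p (t - s) (z - y) * f s y"
      by simp
  qed
  have 2: "(\<lambda>n. LINT y|lebesgue. semigroup_kernel m p (t - \<sigma> n) (\<zeta> n - y) * (f (\<sigma> n) y - f s y)) \<longlonglongrightarrow> 0"
  proof (rule Lim_null_comparison)
    have "norm (LINT y|lebesgue. semigroup_kernel m p (t - \<sigma> n) (\<zeta> n - y) * (f (\<sigma> n) y - f s y))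
      \<le> B * L1_norm (\<lambda>y. f (\<sigma> n) y - f s y)" for n
    proof -
      have "\<bar>LINT y|lebesgue. semigroup_kernel m p (t - \<sigma> n) (\<zeta> n - y) * (f (\<sigma> n) y - f s y)\<bar>
        \<le> b n * L1_norm (\<lambda>y. f (\<sigma> n) y - f s y)"
        unfolding b_def using int s by (intro kernel_integral_bound pos Bochner_Integration.integrable_diff) auto
      also have "\<dots> \<le> B * L1_norm (\<lambda>y. f (\<sigma> n) y - f s y)"
        using B(2)[of n] by (intro mult_right_mono) (auto simp: L1_norm_def)
      finally show ?thesis by simp
    qed
    then show "\<forall>\<^sub>F n in sequentially. norm (LINT y|lebesgue. semigroup_kernel m p (t - \<sigma> n) (\<zeta> n - y) * (f (\<sigma> n) y - f s y))
      \<le> B * L1_norm (\<lambda>y. f (\<sigma> n) y - f s y)" by simp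
    show "(\<lambda>n. B * L1_norm (\<lambda>y. f (\<sigma> n) y - f s y)) \<longlonglongrightarrow> 0"
      using tendsto_mult_right_zero[OF continuous_L1_on_tendsto[OF f s(1,2,3)], of B] by simp
  qed
  have "(LINT y|lebesgue. semigroup_kernel m p (t - \<sigma> n) (\<zeta> n - y) * f (\<sigma> n) y)
     = (LINT y|lebesgue. semigroup_kernel m p (t - \<sigma> n) (\<zeta> n - y) * f s y)
     + (LINT y|lebesgue. semigroup_kernel m p (t - \<sigma> n) (\<zeta> n - y) * (f (\<sigma> n) y - f s y))" for n
  proof -
    have "integrable lebesgue (\<lambda>y. semigroup_kernel m p (t - \<sigma> n) (\<zeta> n - y) * f s y)"
      "integrable lebesgue (\<lambda>y. semigroup_kernel m p (t - \<sigma> n) (\<zeta> n - y) * (f (\<sigma> n) y - f s y))"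
      using int s pos by (auto intro!: integrable_semigroup_kernel_mult Bochner_Integration.integrable_diff)
    from Bochner_Integration.integral_add[OF this] show ?thesis by (simp add: algebra_simps)
  qed
  then have "(\<lambda>n. LINT y|lebesgue. semigroup_kernel m p (t - \<sigma> n) (\<zeta> n - y) * f (\<sigma> n) y)
     \<longlonglongrightarrow> (LINT y|lebesgue. semigroup_kernel m p (t - s) (z - y) * f s y)"
    using tendsto_add[OF 1 2] by simp
  then show "(\<lambda>n. case \<upsilon> n of (s, z) \<Rightarrow> LINT y|lebesgue. semigroup_kernel m p (t - s) (z - y) * f s y)
     \<longlonglongrightarrow> (case a of (s, z) \<Rightarrow> LINT y|lebesgue. semigroup_kernel m p (t - s) (z - y) * f s y)"
    by (simp add: split_beta \<sigma>_def \<zeta>_def s_def z_def)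
qed

lemma continuous_L1_on_shift:
  assumes u: "continuous_L1_on {-h..} u"
  shows "continuous_L1_on {0..} (\<lambda>s y. q * u (s - h) (y - d))"
  unfolding continuous_L1_on_def
proof (intro conjI ballI)
  fix t :: real assume t: "t \<in> {0..}"
  have int: "integrable lebesgue (u r)" if "r \<in> {-h..}" for r using u that by (auto simp: continuous_L1_on_def)
  have "integrable lebesgue (\<lambda>y. u (t - h) (- d + 1 * y))"
    using int[of "t - h"] t by (intro lebesgue_integrable_real_affine) auto
  then show "integrable lebesgue (\<lambda>y. q * u (t - h) (y - d))"
    by (intro integrable_mult_right) (simp add: algebra_simps)
  have eq: "L1_norm (\<lambda>z. q * u (s - h) (z - d) - q * u (t - h) (z - d)) = \<bar>q\<bar> * L1_norm (\<lambda>z. u (s - h) z - u (t - h) z)" for s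
  proof -
    have "L1_norm (\<lambda>z. q * u (s - h) (z - d) - q * u (t - h) (z - d))
      = (LINT z|lebesgue. \<bar>q\<bar> * \<bar>u (s - h) (z - d) - u (t - h) (z - d)\<bar>)"
      unfolding L1_norm_def abs_mult[symmetric] by (simp add: algebra_simps)
    also have "\<dots> = \<bar>q\<bar> * (LINT z|lebesgue. \<bar>u (s - h) (z - d) - u (t - h) (z - d)\<bar>)" by simp
    also have "(LINT z|lebesgue. \<bar>u (s - h) (z - d) - u (t - h) (z - d)\<bar>) = L1_norm (\<lambda>z. u (s - h) z - u (t - h) z)"
      unfolding L1_norm_def
      using lebesgue_integral_real_affine[of 1 "\<lambda>z. \<bar>u (s - h) z - u (t - h) z\<bar>" "- d"] by (simp add: algebra_simps)
    finally show ?thesis .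
  qed
  have "((\<lambda>s. L1_norm (\<lambda>z. u s z - u (t - h) z)) \<longlongrightarrow> 0) (at (t - h) within {-h..})"
    using u t by (auto simp: continuous_L1_on_def)
  moreover have "filterlim (\<lambda>s. s - h) (at (t - h) within {-h..}) (at t within {0..})"
    unfolding filterlim_at by (auto intro!: tendsto_intros simp: eventually_at_filter)
  ultimately have "((\<lambda>s. L1_norm (\<lambda>z. u (s - h) z - u (t - h) z)) \<longlongrightarrow> 0) (at t within {0..})"
    by (rule filterlim_compose)
  from tendsto_mult_right_zero[OF this, of "\<bar>q\<bar>"]
  show "((\<lambda>s. L1_norm (\<lambda>z. q * u (s - h) (z - d) - q * u (t - h) (z - d))) \<longlongrightarrow> 0) (at t within {0..})"
    unfolding eq .
qed

text \<open>A junk value: \<open>1 / sqrt 0 = 0\<close>.\<close>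

lemma semigroup_kernel_0 [simp]: "semigroup_kernel m p 0 z = 0"
  by (simp add: semigroup_kernel_def)

text \<open>The singularity at \<open>s = t\<close> is of order \<open>1 / sqrt (t - s)\<close>, as
  \<open>L1_norm (f s)\<close> stays bounded on \<open>{0..t}\<close>.\<close>

lemma duhamel_integrable:
  fixes m p t z :: real
  assumes f: "continuous_L1_on {0..} f" and t: "0 < t" and p: "p \<le> 0"
  defines "I \<equiv> \<lambda>s. LINT y|lebesgue. semigroup_kernel m p (t - s) (z - y) * f s y"
  shows "continuous_on {0..<t} I" "set_integrable lebesgue {0..t} I"
proof -
  have f': "continuous_L1_on {0..<t} f"
    by (rule continuous_L1_on_subset[OF f]) auto
  have int: "integrable lebesgue (f r)" if "0 \<le> r" for r using f that by (auto simp: continuous_L1_on_def)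
  have "continuous_on {0..<t} (\<lambda>s. (s, z))" by (intro continuous_intros)
  from continuous_on_compose2[OF continuous_on_kernel_integral[OF f', of t m p] this]
  show c: "continuous_on {0..<t} I" by (auto simp: I_def)
  have "compact ((\<lambda>s. L1_norm (f s)) ` {0..t})"
    by (intro compact_continuous_image continuous_on_subset[OF continuous_on_L1_norm[OF f]] compact_Icc) auto
  then obtain B0 where B0: "\<forall>c\<in>(\<lambda>s. L1_norm (f s)) ` {0..t}. norm c \<le> B0"
    using compact_imp_bounded bounded_iff by metis
  define B where "B = max 0 B0"
  have B: "B \<ge> 0" "\<And>s. 0 \<le> s \<Longrightarrow> s \<le> t \<Longrightarrow> L1_norm (f s) \<le> B"
  proof -
    show "L1_norm (f s) \<le> B" if "0 \<le> s" "s \<le> t" for s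
    proof -
      have "norm (L1_norm (f s)) \<le> B0" using B0 that by simp
      then show ?thesis by (simp add: B_def)
    qed
  qed (simp add: B_def)
  have "((\<lambda>s. 1 / sqrt (t - s)) has_integral (- 2 * sqrt (t - t) - (- 2 * sqrt (t - 0)))) {0..t}"
  proof (rule fundamental_theorem_of_calculus_interior)
    fix r assume "r \<in> {0<..<t}"
    then have "((\<lambda>r. - 2 * sqrt (t - r)) has_real_derivative 1 / sqrt (t - r)) (at r)"
      by (auto intro!: derivative_eq_intros simp: field_simps)
    then show "((\<lambda>r. - 2 * sqrt (t - r)) has_vector_derivative 1 / sqrt (t - r)) (at r)"
      by (simp add: has_real_derivative_iff_has_vector_derivative)
  qed (use t in \<open>auto intro!: continuous_intros\<close>)
  then have "(\<lambda>s. 1 / sqrt (t - s)) absolutely_integrable_on {0..t}"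
    by (intro nonnegative_absolutely_integrable_1) (auto intro: has_integral_integrable)
  then have bi: "integrable lebesgue (\<lambda>s. B * (indicator {0..t} s *\<^sub>R (1 / sqrt (t - s))))"
    unfolding set_integrable_def by (rule integrable_mult_right)
  \<comment> \<open>At \<open>s = t\<close> the kernel is the default value 0, so the closed
    interval may be exchanged for the half-open one, on which \<open>I\<close> is
    continuous.\<close>
  have ind: "indicator {0..t} s *\<^sub>R I s = indicator {0..<t} s *\<^sub>R I s" for s
    by (auto simp: I_def indicator_def)
  have "(\<lambda>s. indicator {0..<t} s *\<^sub>R I s) \<in> borel_measurable borel"
    by (intro borel_measurable_continuous_on_indicator c) simp
  then have meas: "(\<lambda>s. indicator {0..t} s *\<^sub>R I s) \<in> borel_measurable lebesgue"
    unfolding ind by (intro measurable_completion) simp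
  show "set_integrable lebesgue {0..t} I"
    unfolding set_integrable_def
  proof (rule Bochner_Integration.integrable_bound[OF bi meas], rule AE_I2)
    fix s
    show "norm (indicator {0..t} s *\<^sub>R I s) \<le> norm (B * (indicator {0..t} s *\<^sub>R (1 / sqrt (t - s))))"
    proof (cases "0 \<le> s \<and> s < t")
      case True
      then have ts: "0 < t - s" "0 \<le> s" "s \<le> t" by auto
      have e: "exp (p * (t - s)) \<le> 1" using p ts by (simp add: mult_nonpos_nonneg)
      have "1 * sqrt (t - s) \<le> sqrt (4 * pi) * sqrt (t - s)"
        using pi_ge_two ts by (intro mult_right_mono) auto
      then have "exp (p * (t - s)) / sqrt (4 * pi * (t - s)) \<le> 1 / sqrt (t - s)"
        using ts e by (intro frac_le) (auto simp: real_sqrt_mult)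
      then have "exp (p * (t - s)) / sqrt (4 * pi * (t - s)) * L1_norm (f s) \<le> 1 / sqrt (t - s) * B"
        using B ts by (intro mult_mono) (auto simp: L1_norm_def)
      with kernel_integral_bound[OF ts(1) int[OF ts(2)], of m p z]
      have "\<bar>I s\<bar> \<le> B * (1 / sqrt (t - s))" unfolding I_def by (simp add: mult.commute)
      then show ?thesis using True B(1) by simp
    next
      case False
      then show ?thesis unfolding ind using B(1) by (auto simp: indicator_def)
    qed
  qed
qed

subsection \<open>Comparison with the mild solution\<close>

lemma integral_le_lebesgue_integral:
  fixes \<phi> g :: "real \<Rightarrow> real"
  assumes "continuous_on {a..b} \<phi>" "\<And>y. y \<in> {a..b} \<Longrightarrow> \<phi> y \<le> g y" "\<And>y. 0 \<le> g y" "integrable lebesgue g"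
  shows "integral {a..b} \<phi> \<le> (LINT y|lebesgue. g y)"
proof -
  have gi: "set_integrable lebesgue {a..b} g"
    unfolding set_integrable_def using assms(4) by (intro integrable_mult_indicator) auto
  have "integral {a..b} \<phi> \<le> integral {a..b} g"
    using assms by (intro integral_le integrable_continuous_real set_lebesgue_integral_eq_integral(1)[OF gi]) auto
  also have "\<dots> = (LINT y:{a..b}|lebesgue. g y)"
    by (rule set_lebesgue_integral_eq_integral(2)[OF gi, symmetric])
  also have "\<dots> \<le> (LINT y|lebesgue. g y)"
    unfolding set_lebesgue_integral_def using gi[unfolded set_integrable_def] assms(3,4)
    by (intro integral_mono) (auto simp: indicator_def)
  finally show ?thesis .
qed

lemma classical_solution_lincomb:
  assumes "classical_solution m p F v" "classical_solution m p G w"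
  shows "classical_solution m p (\<lambda>t z. F t z + a * G t z) (\<lambda>t z. v t z + a * w t z)"
proof -
  from assms(1) obtain vt vz vzz where
    1: "continuous_on ({0<..} \<times> UNIV) (\<lambda>(t, z). vt t z)"
       "continuous_on ({0<..} \<times> UNIV) (\<lambda>(t, z). vz t z)"
       "continuous_on ({0<..} \<times> UNIV) (\<lambda>(t, z). vzz t z)"
    and 2: "\<forall>t>0. \<forall>z.
           ((\<lambda>s. v s z) has_real_derivative vt t z) (at t) \<and>
           ((\<lambda>y. v t y) has_real_derivative vz t z) (at z) \<and>
           ((\<lambda>y. vz t y) has_real_derivative vzz t z) (at z) \<and>
           vt t z = vzz t z + m * vz t z + p * v t z + F t z"
    unfolding classical_solution_def by (elim conjE exE) (rule that)
  from assms(2) obtain wt wz wzz where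
    3: "continuous_on ({0<..} \<times> UNIV) (\<lambda>(t, z). wt t z)"
       "continuous_on ({0<..} \<times> UNIV) (\<lambda>(t, z). wz t z)"
       "continuous_on ({0<..} \<times> UNIV) (\<lambda>(t, z). wzz t z)"
    and 4: "\<forall>t>0. \<forall>z.
           ((\<lambda>s. w s z) has_real_derivative wt t z) (at t) \<and>
           ((\<lambda>y. w t y) has_real_derivative wz t z) (at z) \<and>
           ((\<lambda>y. wz t y) has_real_derivative wzz t z) (at z) \<and>
           wt t z = wzz t z + m * wz t z + p * w t z + G t z"
    unfolding classical_solution_def by (elim conjE exE) (rule that)
  show ?thesis unfolding classical_solution_def
  proof (intro conjI exI allI impI)
    show "continuous_on ({0..} \<times> UNIV) (\<lambda>(t, z). v t z + a * w t z)"
      using assms[THEN classical_solution_continuous] unfolding split_beta by (intro continuous_intros)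
    show "continuous_on ({0<..} \<times> UNIV) (\<lambda>(t, z). vt t z + a * wt t z)"
      "continuous_on ({0<..} \<times> UNIV) (\<lambda>(t, z). vz t z + a * wz t z)"
      "continuous_on ({0<..} \<times> UNIV) (\<lambda>(t, z). vzz t z + a * wzz t z)"
      using 1 3 unfolding split_beta by (intro continuous_intros; simp)+
    fix t z :: real assume t: "t > 0"
    note 2 = 2[rule_format, OF t, of z] and 4 = 4[rule_format, OF t, of z]
    show "((\<lambda>s. v s z + a * w s z) has_real_derivative vt t z + a * wt t z) (at t)"
      "((\<lambda>y. v t y + a * w t y) has_real_derivative vz t z + a * wz t z) (at z)"
      "((\<lambda>y. vz t y + a * wz t y) has_real_derivative vzz t z + a * wzz t z) (at z)"
      using 2 4 by (intro DERIV_add DERIV_cmult; blast)+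
    show "vt t z + a * wt t z = vzz t z + a * wzz t z + m * (vz t z + a * wz t z)
       + p * (v t z + a * w t z) + (F t z + a * G t z)"
      using 2 4 by (simp add: algebra_simps)
  qed
qed

lemma continuous_on_xi: "continuous_on A f \<Longrightarrow> continuous_on A (\<lambda>x. xi l (f x))"
  unfolding xi_def by (intro continuous_intros)

lemma xi_pos [simp]: "0 < xi l z" by (simp add: xi_def)

lemma xi_nonneg [simp]: "0 \<le> xi l z" by (simp add: xi_def)

text \<open>Conjugation by the weight \<open>exp (- lam * z)\<close> replaces the derivative in
  \<open>z\<close> by the derivative plus \<open>lam\<close>. The operator with coefficients
  \<open>1\<close>, \<open>- c\<close>, \<open>- 1\<close> thereby acquires the coefficients
  \<open>1\<close>, \<open>2 * lam - c\<close>, \<open>lam\<^sup>2 - c * lam - 1\<close>, which are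
  the \<open>m\<close> and \<open>p\<close> of the theorem.\<close>

lemma weighted_classical_solution:
  assumes "delayed_rd_solution h c g v0 v"
  shows "classical_solution (2 * lam - c) (lam\<^sup>2 - c * lam - 1)
    (\<lambda>t z. xi lam z * g (v (t - h) (z - c * h))) (\<lambda>t z. xi lam z * v t z)"
proof -
  from assms obtain vt vz vzz where
    0: "continuous_on ({0..} \<times> UNIV) (\<lambda>(t, z). v t z)" and
    1: "continuous_on ({0<..} \<times> UNIV) (\<lambda>(t, z). vt t z)"
       "continuous_on ({0<..} \<times> UNIV) (\<lambda>(t, z). vz t z)"
       "continuous_on ({0<..} \<times> UNIV) (\<lambda>(t, z). vzz t z)"
    and 2: "\<forall>t>0. \<forall>z.
           ((\<lambda>s. v s z) has_real_derivative vt t z) (at t) \<and>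
           ((\<lambda>y. v t y) has_real_derivative vz t z) (at z) \<and>
           ((\<lambda>y. vz t y) has_real_derivative vzz t z) (at z) \<and>
           vt t z = vzz t z - c * vz t z - v t z + g (v (t - h) (z - c * h))"
    unfolding delayed_rd_solution_def by (elim conjE exE) (rule that)
  have cv': "continuous_on ({0<..} \<times> UNIV) (\<lambda>(t, z). v t z)"
    by (rule continuous_on_subset[OF 0]) auto
  have dxi: "(xi lam has_real_derivative - lam * xi lam z) (at z)" for z
    unfolding xi_def[abs_def] by (auto intro!: derivative_eq_intros)
  show ?thesis unfolding classical_solution_def
  proof (intro conjI exI allI impI)
    show "continuous_on ({0..} \<times> UNIV) (\<lambda>(t, z). xi lam z * v t z)"
      using 0 unfolding split_beta by (intro continuous_intros continuous_on_xi)
    show "continuous_on ({0<..} \<times> UNIV) (\<lambda>(t, z). xi lam z * vt t z)"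
      "continuous_on ({0<..} \<times> UNIV) (\<lambda>(t, z). - lam * xi lam z * v t z + xi lam z * vz t z)"
      "continuous_on ({0<..} \<times> UNIV) (\<lambda>(t, z). lam\<^sup>2 * (xi lam z * v t z) - 2 * lam * (xi lam z * vz t z) + xi lam z * vzz t z)"
      using 1 cv' unfolding split_beta by (intro continuous_intros continuous_on_xi; simp)+
    fix t z :: real assume t: "t > 0"
    note d = 2[rule_format, OF t, of z, THEN conjunct1]
      2[rule_format, OF t, of z, THEN conjunct2, THEN conjunct1]
      2[rule_format, OF t, of z, THEN conjunct2, THEN conjunct2, THEN conjunct1]
      2[rule_format, OF t, of z, THEN conjunct2, THEN conjunct2, THEN conjunct2]
    show "((\<lambda>s. xi lam z * v s z) has_real_derivative xi lam z * vt t z) (at t)"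
      by (intro DERIV_cmult d)
    show "((\<lambda>y. xi lam y * v t y) has_real_derivative - lam * xi lam z * v t z + xi lam z * vz t z) (at z)"
      using DERIV_mult[OF dxi[of z] d(2)] by (simp add: mult_ac)
    show "((\<lambda>y. - lam * xi lam y * v t y + xi lam y * vz t y) has_real_derivative
       lam\<^sup>2 * (xi lam z * v t z) - 2 * lam * (xi lam z * vz t z) + xi lam z * vzz t z) (at z)"
      using DERIV_add[OF DERIV_mult[OF DERIV_cmult[OF dxi[of z], of "- lam"] d(2)] DERIV_mult[OF dxi[of z] d(3)]]
      by (simp add: algebra_simps power2_eq_square)
    show "xi lam z * vt t z = lam\<^sup>2 * (xi lam z * v t z) - 2 * lam * (xi lam z * vz t z) + xi lam z * vzz t z
      + (2 * lam - c) * (- lam * xi lam z * v t z + xi lam z * vz t z)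
      + (lam\<^sup>2 - c * lam - 1) * (xi lam z * v t z) + xi lam z * g (v (t - h) (z - c * h))"
      unfolding d(4) by (simp add: algebra_simps power2_eq_square)
  qed
qed

lemma mild_solution_dominates:
  fixes h Lg c lam m p q :: real
  assumes h: "h > 0" and g0: "g ` {0..} \<subseteq> {0..}" and Lip: "Lg-lipschitz_on {0..} g"
    and v: "delayed_rd_solution h c g v0 v" and \<psi>: "delayed_rd_solution h c g \<psi>0 \<psi>"
    and u0: "u0 = (\<lambda>s z. xi lam z * \<bar>v0 s z - \<psi>0 s z\<bar>)"
    and m: "m = 2 * lam - c" and p: "p = lam\<^sup>2 - c * lam - 1" and p0: "p \<le> 0"
    and q: "q = Lg * exp (- lam * c * h)"
    and u: "delayed_mild_solution h m p q (c * h) u0 u"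
    and t: "- h \<le> t"
  shows "xi lam z * \<bar>v t z - \<psi> t z\<bar> \<le> u t z"
proof -
  let ?k = "semigroup_kernel m p"
  have vnn: "0 \<le> v t z" "0 \<le> \<psi> t z" if "- h \<le> t" for t z
    using v \<psi> that by (auto simp: delayed_rd_solution_def)
  have v0: "v s z = v0 s z" "\<psi> s z = \<psi>0 s z" if "s \<in> {-h..0}" for s z
    using v \<psi> that by (auto simp: delayed_rd_solution_def)
  have uL1: "continuous_L1_on {-h..} u" and uu0: "\<And>s z. s \<in> {-h..0} \<Longrightarrow> u s z = u0 s z"
    and umild: "\<And>t z. t > 0 \<Longrightarrow> u t z =
        (LINT y|lebesgue. ?k t (z - y) * u0 0 y) +
        (LINT s:{0..t}|lebesgue.
           (LINT y|lebesgue. ?k (t - s) (z - y) * (q * u (s - h) (y - c * h))))"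
    using u by (auto simp: delayed_mild_solution_def)
  define f where "f s y = q * u (s - h) (y - c * h)" for s y
  have fL1: "continuous_L1_on {0..} f"
    unfolding f_def by (rule continuous_L1_on_shift[OF uL1])
  have q0: "q \<ge> 0" using lipschitz_on_nonneg[OF Lip] by (simp add: q)
  define G where "G t z = xi lam z * g (v (t - h) (z - c * h)) + 1 * (xi lam z * g (\<psi> (t - h) (z - c * h)))" for t z
  define S where "S t z = xi lam z * v t z + 1 * (xi lam z * \<psi> t z)" for t z
  define F where "F t z = xi lam z * g (v (t - h) (z - c * h)) + (- 1) * (xi lam z * g (\<psi> (t - h) (z - c * h)))" for t z
  define w where "w t z = xi lam z * v t z + (- 1) * (xi lam z * \<psi> t z)" for t z
  have solS: "classical_solution m p G S" and solw: "classical_solution m p F w"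
    unfolding G_def S_def F_def w_def m p
    by (intro classical_solution_lincomb weighted_classical_solution[OF v] weighted_classical_solution[OF \<psi>])+
  have wabs: "\<bar>w t z\<bar> = xi lam z * \<bar>v t z - \<psi> t z\<bar>" for t z
    unfolding w_def using xi_pos[of lam z]
    by (metis abs_mult abs_of_pos mult_minus1 right_diff_distrib uminus_add_conv_diff add.commute)
  have S0: "0 \<le> S t z" if "0 \<le> t" for t z
    using vnn[of t z] that h xi_pos[of lam z] by (auto simp: S_def less_imp_le)
  have G0: "0 \<le> G t z" if "0 < t" for t z
  proof -
    have "0 \<le> g (v (t - h) (z - c * h))" "0 \<le> g (\<psi> (t - h) (z - c * h))"
      using g0 vnn[of "t - h" "z - c * h"] that by auto
    then show ?thesis using xi_pos[of lam z] by (simp add: G_def less_imp_le)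
  qed
  have wS: "\<bar>w t z\<bar> \<le> S t z" if "0 \<le> t" for t z
    unfolding wabs S_def using vnn[of t z] that h xi_pos[of lam z]
    by (simp add: distrib_left[symmetric] abs_le_iff)
  \<comment> \<open>The factor \<open>exp (- lam * c * h)\<close> in \<open>q\<close> is the ratio
    of the weights at \<open>z\<close> and at \<open>z - c * h\<close>; this is how the Lipschitz
    estimate for \<open>g\<close> becomes one for \<open>F\<close> with constant
    \<open>q\<close>.\<close>
  have xi_shift: "q * (xi lam (z - c * h) * a) = xi lam z * (Lg * a)" for z a
  proof -
    have "q * (xi lam (z - c * h) * a) = Lg * a * (exp (- lam * c * h) * exp (- lam * (z - c * h)))"
      by (simp only: q xi_def mult_ac)
    also have "exp (- lam * c * h) * exp (- lam * (z - c * h)) = xi lam z"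
      unfolding xi_def exp_add[symmetric] by (simp add: algebra_simps)
    finally show ?thesis by (simp only: mult_ac)
  qed
  have FL: "\<bar>F s y\<bar> \<le> q * \<bar>w (s - h) (y - c * h)\<bar>" if "0 \<le> s" for s y
  proof -
    have "\<bar>g (v (s - h) (y - c * h)) - g (\<psi> (s - h) (y - c * h))\<bar> \<le> Lg * \<bar>v (s - h) (y - c * h) - \<psi> (s - h) (y - c * h)\<bar>"
      using lipschitz_onD[OF Lip, of "v (s - h) (y - c * h)" "\<psi> (s - h) (y - c * h)"]
        vnn[of "s - h" "y - c * h"] that by (simp add: dist_real_def)
    then have "xi lam y * \<bar>g (v (s - h) (y - c * h)) - g (\<psi> (s - h) (y - c * h))\<bar>
       \<le> xi lam y * (Lg * \<bar>v (s - h) (y - c * h) - \<psi> (s - h) (y - c * h)\<bar>)"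
      by (intro mult_left_mono) auto
    moreover have "\<bar>F s y\<bar> = xi lam y * \<bar>g (v (s - h) (y - c * h)) - g (\<psi> (s - h) (y - c * h))\<bar>"
    proof -
      have "F s y = xi lam y * (g (v (s - h) (y - c * h)) - g (\<psi> (s - h) (y - c * h)))"
        by (simp add: F_def algebra_simps)
      then show ?thesis by (simp add: abs_mult)
    qed
    ultimately show ?thesis unfolding wabs xi_shift by simp
  qed
  have "\<forall>t z. - h \<le> t \<and> t \<le> real n * h \<longrightarrow> \<bar>w t z\<bar> \<le> u t z" for n
  proof (induction n)
    case 0
    then show ?case using uu0 v0 by (auto simp: wabs u0)
  next
    case (Suc n)
    show ?case
    proof (intro allI impI)
      fix t x assume t: "- h \<le> t \<and> t \<le> real (Suc n) * h"
      show "\<bar>w t x\<bar> \<le> u t x"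
      proof (cases "t \<le> 0")
        case True
        then show ?thesis using uu0 v0 t by (auto simp: wabs u0)
      next
        case False
        then have t0: "0 < t" by simp
        have Ff: "\<bar>F s y\<bar> \<le> f s y" if "0 \<le> s" "s \<le> t" for s y
        proof -
          have "\<bar>w (s - h) (y - c * h)\<bar> \<le> u (s - h) (y - c * h)"
            using Suc that t by (auto simp: algebra_simps)
          then show ?thesis using FL[OF that(1), of y] q0 mult_left_mono
            unfolding f_def by (meson order_trans)
        qed
        \<comment> \<open>Nonnegativity of the source of \<open>u\<close> comes with the induction
          hypothesis, since \<open>f\<close> dominates an absolute value; no separate maximum
          principle for \<open>u\<close> is invoked.\<close>
        then have f0: "0 \<le> f s y" if "0 \<le> s" "s \<le> t" for s y
          using that abs_ge_zero order_trans by blast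
        define I where "I s = (LINT y|lebesgue. ?k (t - s) (x - y) * f s y)" for s
        have cI: "continuous_on {0..<t} I" and iI: "set_integrable lebesgue {0..t} I"
          unfolding I_def using duhamel_integrable[OF fL1 t0 p0] by blast+
        have I0: "0 \<le> I s" if "0 \<le> s" "s \<le> t" for s
          unfolding I_def using f0 that by (intro Bochner_Integration.integral_nonneg mult_nonneg_nonneg) auto
        have fi: "integrable lebesgue (f s)" if "0 \<le> s" for s
          using fL1 that by (auto simp: continuous_L1_on_def)
        have u0i: "integrable lebesgue (u0 0)"
        proof -
          have "integrable lebesgue (u 0)" using uL1 h by (auto simp: continuous_L1_on_def)
          moreover have "u 0 = u0 0" using uu0 h by (auto simp: fun_eq_iff)
          ultimately show ?thesis by simp
        qed
        \<comment> \<open>The two bounds \<open>K0\<close> and \<open>K1\<close> are chosen as the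
          two terms of the variation of constants formula for \<open>u t x\<close>.\<close>
        have "\<bar>w t x\<bar> \<le> (LINT y|lebesgue. ?k t (x - y) * u0 0 y) + (LINT s:{0..t}|lebesgue. I s)"
        proof (rule classical_solution_duhamel_bound[OF solS solw S0 G0 wS p0 t0])
          fix s R :: real assume s: "0 < s" "s < t" and R: "0 < R"
          have cF: "continuous_on {x - R..x + R} (\<lambda>y. F s y)"
            by (rule continuous_on_slice[OF classical_solution_source_continuous[OF solw, unfolded split_beta]]) (use s in auto)
          show "integral {x - R..x + R} (\<lambda>y. ?k (t - s) (x - y) * \<bar>F s y\<bar>) \<le> I s"
            unfolding I_def
          proof (rule integral_le_lebesgue_integral)
            show "continuous_on {x - R..x + R} (\<lambda>y. ?k (t - s) (x - y) * \<bar>F s y\<bar>)"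
              using s by (intro continuous_on_mult continuous_on_semigroup_kernel continuous_intros cF) auto
            show "?k (t - s) (x - y) * \<bar>F s y\<bar> \<le> ?k (t - s) (x - y) * f s y" for y
              using s Ff by (intro mult_left_mono) auto
            show "0 \<le> ?k (t - s) (x - y) * f s y" for y
              using s f0 by (intro mult_nonneg_nonneg) auto
            show "integrable lebesgue (\<lambda>y. ?k (t - s) (x - y) * f s y)"
              using s by (intro integrable_semigroup_kernel_mult fi) auto
          qed
        next
          fix R :: real assume R: "0 < R"
          have cw: "continuous_on {x - R..x + R} (\<lambda>y. w 0 y)"
            by (rule continuous_on_slice[OF classical_solution_continuous[OF solw, unfolded split_beta]]) auto
          have wu: "\<bar>w 0 y\<bar> = u0 0 y" for y using v0[of 0] h by (auto simp: wabs u0)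
          show "integral {x - R..x + R} (\<lambda>y. ?k t (x - y) * \<bar>w 0 y\<bar>)
             \<le> (LINT y|lebesgue. ?k t (x - y) * u0 0 y)"
          proof (rule integral_le_lebesgue_integral)
            show "continuous_on {x - R..x + R} (\<lambda>y. ?k t (x - y) * \<bar>w 0 y\<bar>)"
              using t0 by (intro continuous_on_mult continuous_on_semigroup_kernel continuous_intros cw) auto
            show "0 \<le> ?k t (x - y) * u0 0 y" for y
              using t0 wu[of y] by (metis abs_ge_zero less_imp_le mult_nonneg_nonneg semigroup_kernel_nonneg)
            show "integrable lebesgue (\<lambda>y. ?k t (x - y) * u0 0 y)"
              using t0 by (intro integrable_semigroup_kernel_mult u0i)
          qed (simp add: wu)
        next
          fix s0 s1 :: real assume s: "0 < s0" "s0 < s1" "s1 < t"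
          have si: "set_integrable lebesgue {s0..s1} I"
            by (rule set_integrable_subset[OF iI]) (use s in auto)
          have "integral {s0..s1} I = (LINT s:{s0..s1}|lebesgue. I s)"
            by (rule set_lebesgue_integral_eq_integral(2)[OF si, symmetric])
          also have "\<dots> \<le> (LINT s:{0..t}|lebesgue. I s)"
            unfolding set_lebesgue_integral_def using si[unfolded set_integrable_def] iI[unfolded set_integrable_def] I0 s
            by (intro integral_mono) (auto simp: indicator_def)
          finally show "I integrable_on {s0..s1} \<and> integral {s0..s1} I \<le> (LINT s:{0..t}|lebesgue. I s)"
            using set_lebesgue_integral_eq_integral(1)[OF si] by blast
        qed
        also have "\<dots> = u t x" using umild[OF t0, of x] by (simp add: I_def f_def)
        finally show ?thesis .
      qed
    qed
  qed
  moreover obtain n where "t \<le> real n * h"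
    using reals_Archimedean3[OF h] less_imp_le by blast
  ultimately have "\<bar>w t z\<bar> \<le> u t z" using t by blast
  then show ?thesis by (simp add: wabs)
qed

subsection \<open>Decay\<close>

lemma nn_integral_le_increment:
  fixes G G' :: "real \<Rightarrow> real" and f :: "real \<Rightarrow> ennreal"
  assumes "a \<le> b" and dG: "\<And>s. s \<in> {a..b} \<Longrightarrow> (G has_real_derivative G' s) (at s)"
    and "\<And>s. s \<in> {a..b} \<Longrightarrow> 0 \<le> G' s" and f: "\<And>s. s \<in> {a<..<b} \<Longrightarrow> f s \<le> ennreal (G' s)"
    and A: "A \<subseteq> {a..b}" "A - {a<..<b} \<subseteq> N" "N \<in> null_sets lborel"
  shows "(\<integral>\<^sup>+s. f s * indicator A s \<partial>lborel) \<le> ennreal (G b - G a)"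
proof -
  have "(G' has_integral (G b - G a)) {a..b}"
    using assms(1) dG by (intro fundamental_theorem_of_calculus)
      (auto simp: has_real_derivative_iff_has_vector_derivative intro: has_vector_derivative_at_within)
  from nn_integral_has_integral_lebesgue'[OF assms(3) this]
  have eq: "(\<integral>\<^sup>+s. ennreal (G' s) * indicator {a..b} s \<partial>lborel) = ennreal (G b - G a)" by simp
  have "AE s in lborel. f s * indicator A s \<le> ennreal (G' s) * indicator {a..b} s"
    using AE_not_in[OF A(3)]
  proof eventually_elim
    case (elim s)
    then show ?case using f[of s] A(1,2) by (cases "s \<in> A") (auto simp: indicator_def)
  qed
  then have "(\<integral>\<^sup>+s. f s * indicator A s \<partial>lborel) \<le> (\<integral>\<^sup>+s. ennreal (G' s) * indicator {a..b} s \<partial>lborel)"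
    by (rule nn_integral_mono_AE)
  then show ?thesis unfolding eq .
qed

text \<open>With \<open>x = a * (t - s)\<close> this is an incomplete integral for
  \<open>Gamma (1/2) = sqrt pi\<close>. In terms of the process, it is the contribution of the jumps
  before the clock runs out to the mean of \<open>1 / sqrt \<sigma>\<close>, where
  \<open>\<sigma>\<close> is the exponential waiting time of rate \<open>a\<close>.\<close>

lemma exponential_inverse_sqrt_integral:
  assumes a: "0 < a"
  shows "(\<integral>\<^sup>+s. ennreal (a * exp (- a * (t - s)) / sqrt (t - s)) * indicator {0<..<t} s \<partial>lborel) \<le> ennreal (sqrt (pi * a))"
proof -
  let ?f = "\<lambda>x::real. ennreal (indicator {0..} x * x powr (1/2 - 1) / exp x)"
  have "ennreal (sqrt pi) = (\<integral>\<^sup>+x. ?f x \<partial>lborel)"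
    using Gamma_conv_nn_integral_real[of "1/2"] by (simp add: Gamma_one_half_real)
  also have "\<dots> = ennreal \<bar>- a\<bar> * (\<integral>\<^sup>+s. ?f (a * t + (- a) * s) \<partial>lborel)"
    using a by (intro nn_integral_real_affine) auto
  also have "\<dots> = (\<integral>\<^sup>+s. ennreal a * ?f (a * t + (- a) * s) \<partial>lborel)"
    using a by (subst nn_integral_cmult) auto
  finally have eq: "ennreal (sqrt pi) = (\<integral>\<^sup>+s. ennreal a * ?f (a * t + (- a) * s) \<partial>lborel)" .
  have "(\<integral>\<^sup>+s. ennreal (a * exp (- a * (t - s)) / sqrt (t - s)) * indicator {0<..<t} s \<partial>lborel)
     \<le> (\<integral>\<^sup>+s. ennreal (sqrt a) * (ennreal a * ?f (a * t + (- a) * s)) \<partial>lborel)"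
  proof (rule nn_integral_mono)
    fix s
    show "ennreal (a * exp (- a * (t - s)) / sqrt (t - s)) * indicator {0<..<t} s
       \<le> ennreal (sqrt a) * (ennreal a * ?f (a * t + (- a) * s))"
    proof (cases "s \<in> {0<..<t}")
      case True
      then have ts: "0 < t - s" by simp
      have X: "a * t + (- a) * s = a * (t - s)" by (simp add: algebra_simps)
      define w where "w = sqrt (t - s)"
      define k where "k = sqrt a"
      have wk: "0 < w" "0 < k" using a ts by (auto simp: w_def k_def)
      have "(a * (t - s)) powr (1/2 - 1) = 1 / sqrt (a * (t - s))"
        using a ts by (simp add: powr_minus_divide powr_half_sqrt)
      also have "sqrt (a * (t - s)) = k * w" by (simp add: real_sqrt_mult k_def w_def)
      finally have pw: "(a * (t - s)) powr (1/2 - 1) = 1 / (k * w)" .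
      have ind: "indicator {0..} (a * (t - s)) = (1::real)" using a ts by simp
      have "k * (a * (1 * (1 / (k * w)) / exp u)) = a * inverse (exp u) / w" for u
        using wk by (simp add: field_simps)
      moreover have "exp (- a * (t - s)) = inverse (exp (a * (t - s)))"
        by (simp only: exp_minus mult_minus_left)
      ultimately have "sqrt a * (a * (indicator {0..} (a * (t - s)) * (a * (t - s)) powr (1/2 - 1) / exp (a * (t - s))))
         = a * exp (- a * (t - s)) / sqrt (t - s)"
        unfolding pw ind k_def[symmetric] w_def[symmetric] by (simp only:)
      then show ?thesis
        unfolding X using True a ts by (simp flip: ennreal_mult')
    qed simp
  qed
  also have "\<dots> = ennreal (sqrt a) * ennreal (sqrt pi)"
    unfolding eq by (rule nn_integral_cmult) measurable
  also have "\<dots> = ennreal (sqrt (pi * a))"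
    using a by (simp add: real_sqrt_mult mult.commute flip: ennreal_mult)
  finally show ?thesis .
qed

text \<open>The constant must stay below \<open>2 * pi / 3\<close>, about 2.094. The exponential is
  replaced by the reciprocal of its quadratic Taylor polynomial \<open>D\<close>, and
  \<open>2 * sqrt b\<close> by its tangent at \<open>b = 1/4\<close>; multiplication by
  \<open>D\<^sup>2\<close> leaves a polynomial inequality of degree 4.\<close>

lemma first_jump_numeric:
  fixes b :: real
  assumes "0 \<le> b"
  shows "(exp (- b) + sqrt (pi * b))\<^sup>2 \<le> 209/100 + pi * b"
proof -
  define D where "D = 1 + b + b\<^sup>2 / 2"
  have D1: "D \<ge> 1" using assms by (simp add: D_def)
  define E where "E = exp (- b)"
  have "D \<le> exp b" unfolding D_def using exp_lower_Taylor_quadratic[OF assms] by simp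
  then have E: "0 < E" "E * D \<le> 1"
    unfolding E_def by (auto simp: exp_minus field_simps)
  have sp: "sqrt pi \<le> 17725/10000"
    using pi_approx(2) by (intro real_le_lsqrt) (auto simp: power2_eq_square)
  have "0 \<le> (sqrt (2 * b) - sqrt (1/2))\<^sup>2" by simp
  then have "0 \<le> 2 * b + 1/2 - 2 * (sqrt (2 * b) * sqrt (1/2))"
    using assms by (simp add: power2_diff)
  moreover have "sqrt (2 * b) * sqrt (1/2) = sqrt b" by (simp flip: real_sqrt_mult)
  ultimately have sb: "2 * sqrt b \<le> 2 * b + 1/2" by simp
  have "2 * sqrt (pi * b) = sqrt pi * (2 * sqrt b)" by (simp add: real_sqrt_mult)
  also have "\<dots> \<le> 17725/10000 * (2 * b + 1/2)"
    using sp sb assms by (intro mult_mono) auto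
  finally have s: "2 * sqrt (pi * b) \<le> 17725/10000 * (2 * b + 1/2)" .
  have poly: "17725/10000 * (2 * b + 1/2) * D + 1 \<le> 209/100 * D\<^sup>2"
  proof -
    have "209/100 * D\<^sup>2 - (17725/10000 * (2 * b + 1/2) * D + 1)
      = (20375/100000 - 25125/100000 * b + 191875/1000000 * b\<^sup>2) + (3175/10000 * b ^ 3 + 5225/10000 * b ^ 4)"
      unfolding D_def by (simp add: field_simps power2_eq_square power3_eq_cube power4_eq_xxxx)
    moreover have "0 \<le> 20375/100000 - 25125/100000 * b + 191875/1000000 * b\<^sup>2"
    proof -
      \<comment> \<open>The tangent of the square at \<open>2/3\<close> already makes the quadratic
        part nonnegative.\<close>
      have "4/3 * b - 4/9 \<le> b\<^sup>2"
        using zero_le_power2[of "b - 2/3"] by (simp add: power2_eq_square field_simps)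
      then show ?thesis using assms by linarith
    qed
    moreover have "0 \<le> 3175/10000 * b ^ 3 + 5225/10000 * b ^ 4" using assms by simp
    ultimately show ?thesis by linarith
  qed
  have "E\<^sup>2 + 2 * sqrt (pi * b) * E \<le> 209/100"
  proof -
    have "(E\<^sup>2 + 2 * sqrt (pi * b) * E) * D\<^sup>2 = (E * D)\<^sup>2 + 2 * sqrt (pi * b) * (E * D) * D"
      by (simp add: power2_eq_square algebra_simps)
    also have "\<dots> \<le> 1\<^sup>2 + 2 * sqrt (pi * b) * 1 * D"
      using E D1 assms by (intro add_mono mult_mono power_mono) auto
    also have "\<dots> \<le> 1 + 17725/10000 * (2 * b + 1/2) * D"
      using s D1 by (simp add: mult_right_mono)
    also have "\<dots> \<le> 209/100 * D\<^sup>2" using poly by simp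
    finally show ?thesis using D1 by simp
  qed
  moreover have "(exp (- b) + sqrt (pi * b))\<^sup>2 = E\<^sup>2 + 2 * sqrt (pi * b) * E + pi * b"
    using assms by (simp add: power2_sum E_def mult_ac)
  ultimately show ?thesis by simp
qed

text \<open>The lower bound for the time spent diffusing, in the sense of the mean of \<open>1 / sqrt (r + \<tau>)\<close>.\<close>

definition diffusion_bound :: "real \<Rightarrow> real \<Rightarrow> real \<Rightarrow> real" where
  "diffusion_bound a h t = t / (pi * (1 + a * min t h))"

lemma diffusion_bound_pos: "0 < a \<Longrightarrow> 0 < h \<Longrightarrow> 0 < t \<Longrightarrow> 0 < diffusion_bound a h t"
  by (simp add: diffusion_bound_def add_pos_nonneg)

text \<open>The left side accounts for two events: no jump, in which case the whole time
  \<open>t\<close> is spent diffusing, or a first jump, after which only the diffusion before it is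
  counted. With \<open>b = a * t\<close>, the restriction on \<open>t\<close> means
  \<open>b - 1/3 \<le> a * h\<close>, so that \<open>pi * (1 + a * min t h)\<close> is at least
  \<open>2 * pi / 3 + pi * b\<close>.\<close>

lemma first_jump_bound:
  fixes a h t :: real
  assumes a: "0 < a" and h: "0 < h" and t: "0 < t" "t \<le> h + 1 / (3 * a)"
  shows "exp (- a * t) / sqrt t + sqrt (pi * a) \<le> 1 / sqrt (diffusion_bound a h t)"
proof -
  define b where "b = a * t"
  have b: "0 < b" using a t by (simp add: b_def)
  have "b - 1/3 \<le> a * h" using mult_left_mono[OF t(2), of a] a by (simp add: b_def distrib_left)
  then have mb: "b - 1/3 \<le> a * min t h" using b by (simp add: b_def min_def)
  have "209/100 + pi * b \<le> pi * (2/3) + pi * b" using pi_approx(1) by simp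
  also have "\<dots> = pi * (1 + (b - 1/3))" by (simp add: algebra_simps)
  also have "\<dots> \<le> pi * (1 + a * min t h)" using mb by (intro mult_left_mono) auto
  finally have "(exp (- b) + sqrt (pi * b))\<^sup>2 \<le> pi * (1 + a * min t h)"
    using first_jump_numeric[of b] b by simp
  then have "exp (- b) + sqrt (pi * b) \<le> sqrt (pi * (1 + a * min t h))"
    by (rule real_le_rsqrt)
  then have "(exp (- b) + sqrt (pi * b)) / sqrt t \<le> sqrt (pi * (1 + a * min t h)) / sqrt t"
    using t by (intro divide_right_mono) auto
  moreover have "(exp (- b) + sqrt (pi * b)) / sqrt t = exp (- a * t) / sqrt t + sqrt (pi * a)"
    using t by (simp add: b_def add_divide_distrib real_sqrt_mult)
  moreover have "sqrt (pi * (1 + a * min t h)) / sqrt t = 1 / sqrt (diffusion_bound a h t)"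
    unfolding diffusion_bound_def by (simp add: real_sqrt_divide)
  ultimately show ?thesis by simp
qed

text \<open>\<open>1 / sqrt (r + s)\<close> is a concave function of \<open>1 / sqrt s\<close>; the right-hand side is its tangent at
  \<open>s = M\<close>. By this, a bound of the mean of \<open>1 / sqrt \<tau>\<close> carries over to \<open>1 / sqrt (r + \<tau>)\<close>.\<close>

lemma inverse_sqrt_tangent:
  fixes r s M :: real
  assumes "0 \<le> r" "0 < s" "0 < M"
  shows "1 / sqrt (r + s) \<le> r / sqrt (r + M) ^ 3 + sqrt M ^ 3 / sqrt (r + M) ^ 3 * (1 / sqrt s)"
proof -
  define w where "w = sqrt s"
  define k where "k = sqrt M"
  define Q where "Q = sqrt (r + M)"
  define P where "P = sqrt (r + s)"
  have pos: "0 < w" "0 < k" "0 < Q" "0 < P" using assms by (auto simp: w_def k_def Q_def P_def)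
  have Q2: "Q\<^sup>2 = r + k\<^sup>2" and P2: "P\<^sup>2 = r + w\<^sup>2" using assms by (auto simp: w_def k_def Q_def P_def)
  \<comment> \<open>The claim is squared and cleared of denominators. The difference of the two
    sides splits into terms of the form \<open>w ^ 3 - 3 * w * k\<^sup>2 + 2 * k ^ 3 = (w -
    k)\<^sup>2 * (w + 2 * k)\<close>, the tangency at \<open>w = k\<close> being visible in the
    double zero.\<close>
  have "0 \<le> r * (r * (w * ((w - k)\<^sup>2 * (w + 2 * k))) + k ^ 3 * ((k - w)\<^sup>2 * (k + 2 * w)))"
    using pos assms by (intro mult_nonneg_nonneg add_nonneg_nonneg) auto
  also have "\<dots> = (r * w + k ^ 3)\<^sup>2 * (r + w\<^sup>2) - (r + k\<^sup>2) ^ 3 * w\<^sup>2"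
    by (simp add: power2_eq_square power3_eq_cube algebra_simps)
  finally have "(Q ^ 3 * w)\<^sup>2 \<le> ((r * w + k ^ 3) * P)\<^sup>2"
    unfolding power_mult_distrib P2 by (simp flip: Q2 power_mult add: mult.commute)
  then have le: "Q ^ 3 * w \<le> (r * w + k ^ 3) * P"
    using pos assms by (intro power2_le_imp_le[of "Q ^ 3 * w"]) auto
  have "1 / P \<le> (r * w + k ^ 3) / (Q ^ 3 * w)"
    using le pos by (simp add: field_simps)
  also have "\<dots> = r / Q ^ 3 + k ^ 3 / Q ^ 3 * (1 / w)"
    using pos by (simp add: add_divide_distrib)
  finally show ?thesis unfolding P_def Q_def k_def w_def .
qed

text \<open>The differential inequality which makes \<open>1 / sqrt (r + \<alpha> t)\<close> a supersolution, with \<open>N = \<alpha> t\<close>, if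
  \<open>1 / sqrt (r + M)\<close> is a bound at the delayed time.\<close>

lemma inverse_sqrt_delay_step:
  fixes a \<alpha> r M N :: real
  assumes a: "0 < a" and r: "0 \<le> r" and M: "0 < M" and N: "0 < N" and \<alpha>: "\<alpha> \<le> 1"
    and key: "a * (N - M) * N \<le> (1 - \<alpha>) * M"
  shows "a / sqrt (r + M) \<le> a / sqrt (r + N) + (1 - \<alpha>) / (2 * (r + N) * sqrt (r + N))"
proof (cases "N \<le> M")
  case True
  have "a / sqrt (r + M) \<le> a / sqrt (r + N)"
    using True a r M N by (intro divide_left_mono) (auto intro: mult_pos_pos add_nonneg_pos)
  moreover have "0 \<le> (1 - \<alpha>) / (2 * (r + N) * sqrt (r + N))" using \<alpha> r N by simp
  ultimately show ?thesis by simp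
next
  case False
  define \<delta> where "\<delta> = N - M"
  define y where "y = r + N"
  define x where "x = r + M"
  have pos: "0 < x" "0 < y" "0 < \<delta>" "y = x + \<delta>" using False r M N by (auto simp: \<delta>_def x_def y_def)
  have "a * \<delta> * N \<le> (1 - \<alpha>) * N"
    using key mult_left_mono[of M N "1 - \<alpha>"] False \<alpha> by (simp add: \<delta>_def)
  then have "a * \<delta> \<le> 1 - \<alpha>" using N by simp
  then have "a * \<delta> * r \<le> (1 - \<alpha>) * r" using r by (intro mult_right_mono) auto
  \<comment> \<open>Since \<open>a * \<delta> \<le> 1 - \<alpha>\<close>, the inequality assumed for
    \<open>N\<close> and \<open>M\<close> persists when \<open>r\<close> is added to both.\<close>
  with key have ky: "a * \<delta> * y \<le> (1 - \<alpha>) * x"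
    unfolding y_def x_def \<delta>_def by (simp add: algebra_simps)
  \<comment> \<open>The estimate \<open>sqrt (1 + e) \<le> 1 + e / 2\<close> with
    \<open>e = \<delta> / x\<close>, in squared form.\<close>
  have "y / x \<le> (1 + \<delta> / (2 * x))\<^sup>2"
  proof -
    have "(1 + \<delta> / (2 * x))\<^sup>2 = 1 + \<delta> / x + (\<delta> / (2 * x))\<^sup>2"
      by (simp add: power2_sum)
    moreover have "y / x = 1 + \<delta> / x" using pos by (simp add: field_simps)
    ultimately show ?thesis by simp
  qed
  then have "sqrt (y / x) \<le> 1 + \<delta> / (2 * x)" using pos by (intro real_le_lsqrt) auto
  then have "sqrt y / sqrt x \<le> 1 + \<delta> / (2 * x)" by (simp add: real_sqrt_divide)
  then have "a / sqrt y * (sqrt y / sqrt x) \<le> a / sqrt y * (1 + \<delta> / (2 * x))"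
    using a pos by (intro mult_left_mono) auto
  then have "a / sqrt x \<le> a / sqrt y + (a * \<delta>) / (2 * x) / sqrt y"
    using pos by (simp add: algebra_simps)
  also have "(a * \<delta>) / (2 * x) \<le> (1 - \<alpha>) / (2 * y)" using ky pos by (simp add: field_simps)
  then have "(a * \<delta>) / (2 * x) / sqrt y \<le> (1 - \<alpha>) / (2 * y) / sqrt y" using pos by (intro divide_right_mono) auto
  finally show ?thesis unfolding x_def y_def by simp
qed

text \<open>This is the condition \<open>key\<close> of \<open>inverse_sqrt_delay_step\<close> with
  \<open>N = \<alpha> * s\<close> and the bound at time \<open>s - h\<close> for \<open>M\<close>.
  For \<open>s - h \<le> h\<close> the latter is not yet linear, and a polynomial inequality in
  \<open>b = a * h\<close> and \<open>x = a * (s - h)\<close> remains. Afterwards it is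
  \<open>\<alpha> * (s - h)\<close> and a linear estimate suffices. In both cases
  \<open>3 < pi\<close> is what leaves enough room.\<close>

lemma diffusion_bound_delay:
  fixes a h s :: real
  assumes a: "0 < a" and h: "0 < h" and s: "h + 1 / (3 * a) \<le> s"
  defines "\<alpha> \<equiv> 1 / (pi * (1 + a * h))"
  shows "a * (\<alpha> * s - diffusion_bound a h (s - h)) * (\<alpha> * s) \<le> (1 - \<alpha>) * diffusion_bound a h (s - h)"
proof -
  define b where "b = a * h"
  have b: "0 < b" using a h by (simp add: b_def)
  have sh: "1 / (3 * a) \<le> s - h" using s by simp
  then have sh0: "0 < s - h" using a by (smt (verit) divide_pos_pos)
  have pi3: "3 < pi" by (rule pi_gt3)
  have \<alpha>: "0 < \<alpha>" "\<alpha> * (pi * (1 + b)) = 1" using b by (auto simp: \<alpha>_def b_def add_pos_pos)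
  show ?thesis
  proof (cases "s - h \<le> h")
    case True
    define x where "x = a * (s - h)"
    have x: "1/3 \<le> x" "x \<le> b"
      using mult_left_mono[OF sh, of a] mult_left_mono[OF True, of a] a by (auto simp: x_def b_def)
    define M where "M = diffusion_bound a h (s - h)"
    have M: "M = (s - h) / (pi * (1 + x))" using True by (simp add: M_def diffusion_bound_def x_def)
    have aM: "a * M = x / (pi * (1 + x))" by (simp add: M x_def)
    have as: "a * s = b + x" by (simp add: b_def x_def algebra_simps)
    have aN: "a * (\<alpha> * s) = (b + x) / (pi * (1 + b))" using as by (simp add: \<alpha>_def b_def mult.left_commute)
    define B where "B = 1 + b"
    define X where "X = 1 + x"
    have BX: "0 < B" "0 < X" using b x by (auto simp: B_def X_def)
    \<comment> \<open>Here the starting time \<open>h + 1 / (3 * a)\<close> pays off: it makes the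
      first factor nonnegative. The product controls \<open>b\<^sup>2\<close>, the one term of the
      left side of \<open>poly\<close> without a factor \<open>x\<close>.\<close>
    have "0 \<le> (3 * x - 1) * (b - x) * b" using b x by simp
    also have "\<dots> = 3 * (x * b\<^sup>2) - 3 * (x\<^sup>2 * b) - b\<^sup>2 + b * x"
      by (simp add: power2_eq_square algebra_simps)
    finally have 1: "b\<^sup>2 \<le> 3 * (x * b\<^sup>2) - 3 * (x\<^sup>2 * b) + b * x" by linarith
    have 2: "x ^ 3 \<le> x\<^sup>2 * b"
      using mult_left_mono[OF x(2), of "x\<^sup>2"] by (simp add: power3_eq_cube power2_eq_square)
    have 3: "0 \<le> x\<^sup>2 * b" using b by simp
    have "x * (3 * b\<^sup>2 + 2 * b) = 3 * (x * b\<^sup>2) + 2 * (b * x)" by (simp add: algebra_simps)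
    with 1 2 3 have "b\<^sup>2 + b * x + x\<^sup>2 * b + x ^ 3 \<le> x * (3 * b\<^sup>2 + 2 * b)" by linarith
    also have "\<dots> \<le> x * ((1 + b) * (3 * (1 + b) - 1))"
      using x b by (intro mult_left_mono) (auto simp: power2_eq_square algebra_simps)
    also have "\<dots> \<le> x * ((1 + b) * (pi * (1 + b) - 1))"
      using x b pi3 by (intro mult_left_mono diff_right_mono mult_right_mono) auto
    finally have poly: "(b + x\<^sup>2) * (b + x) \<le> x * (1 + b) * (pi * (1 + b) - 1)"
      by (simp add: power2_eq_square power3_eq_cube algebra_simps)
    have "a * (a * (\<alpha> * s - M) * (\<alpha> * s)) = (a * (\<alpha> * s) - a * M) * (a * (\<alpha> * s))"
      by (simp add: algebra_simps)
    also have "\<dots> = ((b + x\<^sup>2) * (b + x)) / (pi\<^sup>2 * B\<^sup>2 * X)"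
    proof -
      have "(b + x) / (pi * B) - x / (pi * X) = ((b + x) * X - x * B) / (pi * B * X)"
        using BX by (simp add: field_simps)
      also have "(b + x) * X - x * B = b + x\<^sup>2"
        by (simp add: B_def X_def algebra_simps power2_eq_square)
      finally have "(a * (\<alpha> * s) - a * M) * (a * (\<alpha> * s)) = (b + x\<^sup>2) / (pi * B * X) * ((b + x) / (pi * B))"
        unfolding aN aM B_def X_def by simp
      then show ?thesis by (simp add: power2_eq_square mult_ac)
    qed
    also have "\<dots> \<le> (x * B * (pi * B - 1)) / (pi\<^sup>2 * B\<^sup>2 * X)"
      using poly BX unfolding B_def X_def by (intro divide_right_mono) auto
    also have "\<dots> = (1 - 1 / (pi * B)) * (x / (pi * X))"
      using BX by (simp add: field_simps power2_eq_square)
    also have "\<dots> = (1 - 1 / (pi * (1 + b))) * (x / (pi * (1 + x)))"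
      unfolding B_def X_def ..
    also have "\<dots> = a * ((1 - \<alpha>) * M)" unfolding aM[symmetric] \<alpha>_def b_def by simp
    finally show ?thesis using a unfolding M_def by simp
  next
    case False
    have M: "diffusion_bound a h (s - h) = \<alpha> * (s - h)"
      using False by (simp add: diffusion_bound_def \<alpha>_def min_def)
    \<comment> \<open>The factor 2 stems from \<open>s \<le> 2 * (s - h)\<close>, valid since
      \<open>s - h\<close> exceeds \<open>h\<close>.\<close>
    have "2 * b + 1 \<le> pi * (1 + b)" using mult_right_mono[of 3 pi "1 + b"] pi3 b by simp
    then have "\<alpha> * (2 * b + 1) \<le> 1" using mult_left_mono[of _ _ \<alpha>] \<alpha> by (metis less_imp_le)
    then have 1: "2 * (b * \<alpha>) \<le> 1 - \<alpha>" by (simp add: algebra_simps)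
    have "b * \<alpha> * s \<le> b * \<alpha> * (2 * (s - h))" using False b \<alpha> by (intro mult_left_mono) auto
    also have "\<dots> = 2 * (b * \<alpha>) * (s - h)" by simp
    also have "\<dots> \<le> (1 - \<alpha>) * (s - h)" using 1 sh0 by (intro mult_right_mono) auto
    finally have "\<alpha> * (b * \<alpha> * s) \<le> \<alpha> * ((1 - \<alpha>) * (s - h))" using \<alpha> by (intro mult_left_mono) auto
    then show ?thesis unfolding M by (simp add: b_def algebra_simps)
  qed
qed

text \<open>The candidate \<open>1 / sqrt (r + \<alpha> * t)\<close> is followed backwards along
  \<open>r + t - s\<close> and weighted with the probability \<open>exp (- a * (t - s))\<close> of
  no jump. The bracket is the right side of \<open>inverse_sqrt_delay_step\<close> with
  \<open>r + t - s\<close> for \<open>r\<close> and \<open>N = \<alpha> * s\<close>; hence a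
  supersolution makes the jump integral at most an increment of this function.\<close>

lemma delayed_kernel_deriv:
  fixes a t r \<alpha> s :: real
  assumes "0 < r + t - s + \<alpha> * s"
  shows "((\<lambda>s. exp (- a * (t - s)) / sqrt (r + t - s + \<alpha> * s)) has_real_derivative
    exp (- a * (t - s)) * (a / sqrt (r + t - s + \<alpha> * s)
      + (1 - \<alpha>) / (2 * (r + t - s + \<alpha> * s) * sqrt (r + t - s + \<alpha> * s)))) (at s)"
proof -
  define y where "y = r + t - s + \<alpha> * s"
  have y: "0 < y" using assms by (simp add: y_def)
  have 1: "((\<lambda>s. exp (- a * (t - s))) has_real_derivative exp (- a * (t - s)) * a) (at s)"
    by (auto intro!: derivative_eq_intros)
  have "((\<lambda>s. r + t - s + \<alpha> * s) has_real_derivative \<alpha> - 1) (at s)"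
    by (auto intro!: derivative_eq_intros)
  from DERIV_chain2[where f = sqrt and g = "\<lambda>s. r + t - s + \<alpha> * s", OF DERIV_real_sqrt[OF assms] this]
  have 2: "((\<lambda>s. sqrt (r + t - s + \<alpha> * s)) has_real_derivative inverse (sqrt y) / 2 * (\<alpha> - 1)) (at s)"
    by (simp add: y_def)
  have "((\<lambda>s. exp (- a * (t - s)) / sqrt (r + t - s + \<alpha> * s)) has_real_derivative
     (exp (- a * (t - s)) * a * sqrt y - exp (- a * (t - s)) * (inverse (sqrt y) / 2 * (\<alpha> - 1))) / (sqrt y * sqrt y)) (at s)"
    using DERIV_divide[OF 1 2] y by (simp add: y_def)
  moreover have "(exp (- a * (t - s)) * a * sqrt y - exp (- a * (t - s)) * (inverse (sqrt y) / 2 * (\<alpha> - 1))) / (sqrt y * sqrt y)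
     = exp (- a * (t - s)) * (a / sqrt y + (1 - \<alpha>) / (2 * y * sqrt y))"
  proof -
    define k where "k = sqrt y"
    have k: "k > 0" "y = k * k" using y by (auto simp: k_def)
    have "(e * a * k - e * (inverse k / 2 * (\<alpha> - 1))) / (k * k) = e * (a / k + (1 - \<alpha>) / (2 * (k * k) * k))" for e
      using k(1) by (simp add: field_simps)
    then show ?thesis unfolding k_def[symmetric] by (simp add: k(2))
  qed
  ultimately show ?thesis unfolding y_def by simp
qed

text \<open>\<open>X t r z\<close> is the normalised solution at time \<open>t\<close>, smoothed by the kernel at time \<open>r\<close>.\<close>

lemma delayed_diffusion_decay:
  fixes X :: "real \<Rightarrow> real \<Rightarrow> real \<Rightarrow> ennreal" and a h d t r z :: real
  assumes a: "0 < a" and h: "0 < h"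
    and init: "\<And>s r z. - h \<le> s \<Longrightarrow> s \<le> 0 \<Longrightarrow> 0 < r \<Longrightarrow> X s r z \<le> ennreal (1 / sqrt r)"
    and rec: "\<And>t r z. 0 < t \<Longrightarrow> 0 \<le> r \<Longrightarrow> X t r z = ennreal (exp (- a * t)) * X 0 (r + t) z
      + (\<integral>\<^sup>+s. ennreal (a * exp (- a * (t - s))) * X (s - h) (r + t - s) (z - d) * indicator {0<..<t} s \<partial>lborel)"
    and meas: "\<And>t r z. 0 < t \<Longrightarrow> 0 \<le> r \<Longrightarrow>
      (\<lambda>s. X (s - h) (r + t - s) (z - d) * indicator {0<..<t} s) \<in> borel_measurable borel"
    and t: "0 < t" and r: "0 \<le> r"
  shows "X t r z \<le> ennreal (1 / sqrt (r + diffusion_bound a h t))"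
proof -
  let ?F = "\<lambda>t r z s. ennreal (a * exp (- a * (t - s))) * X (s - h) (r + t - s) (z - d)"
  let ?\<rho> = "\<lambda>\<alpha> t r s. a / sqrt (r + t - s + \<alpha> * s) + (1 - \<alpha>) / (2 * (r + t - s + \<alpha> * s) * sqrt (r + t - s + \<alpha> * s))"
  have null: "{u, v} \<in> null_sets lborel" for u v :: real by (intro finite_imp_null_set_lborel) simp
  \<comment> \<open>A comparison step usable with any slope \<open>\<alpha>\<close> in the unit
    interval: 0 gives the crude bound \<open>A\<close>, the value
    \<open>1 / (pi * (1 + a * h))\<close> the final one. The two forms of \<open>A\<close> differ by
    one point; the crude bound starts from the integral over an open interval, the final one from a
    restarted integral.\<close>
  have supersolution: "(\<integral>\<^sup>+s. ?F t r z s * indicator A s \<partial>lborel)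
      \<le> ennreal (1 / sqrt (r + \<alpha> * t) - exp (- a * (t - t0)) / sqrt (r + t - t0 + \<alpha> * t0))"
    if t: "0 \<le> t0" "t0 < t" "0 \<le> r" "0 < r + \<alpha> * t" "0 \<le> \<alpha>" "\<alpha> \<le> 1" and A: "A = {t0..<t} \<or> A = {t0<..<t}"
      and B: "\<And>s. t0 < s \<Longrightarrow> s < t \<Longrightarrow> ennreal a * X (s - h) (r + t - s) (z - d)
        \<le> ennreal (?\<rho> \<alpha> t r s)"
    for t r z t0 \<alpha> A
  proof -
    define y where "y s = r + t - s + \<alpha> * s" for s
    have y: "0 < y s" if "s \<in> {t0..t}" for s
    proof -
      have "0 \<le> (1 - \<alpha>) * (t - s)" using t that by (intro mult_nonneg_nonneg) auto
      then have "r + \<alpha> * t \<le> y s" unfolding y_def by (simp add: algebra_simps)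
      then show ?thesis using t(4) by simp
    qed
    define G where "G s = exp (- a * (t - s)) / sqrt (y s)" for s
    define G' where "G' s = exp (- a * (t - s)) * (a / sqrt (y s) + (1 - \<alpha>) / (2 * y s * sqrt (y s)))" for s
    have "(\<integral>\<^sup>+s. (?F t r z s) * indicator A s \<partial>lborel) \<le> ennreal (G t - G t0)"
    proof (rule nn_integral_le_increment[where a = t0 and b = t and G = G and G' = G' and N = "{t0, t}"])
      show "(G has_real_derivative G' s) (at s)" if "s \<in> {t0..t}" for s
        unfolding G_def[abs_def] G'_def using delayed_kernel_deriv[of r t s \<alpha> a] y[OF that] by (simp add: y_def)
      show "0 \<le> G' s" if "s \<in> {t0..t}" for s
        unfolding G'_def using y[OF that] a t by (intro mult_nonneg_nonneg add_nonneg_nonneg) auto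
      show "?F t r z s \<le> ennreal (G' s)" if s: "s \<in> {t0<..<t}" for s
      proof -
        have "?F t r z s
          = ennreal (exp (- a * (t - s))) * (ennreal a * X (s - h) (r + t - s) (z - d))"
          using a by (simp add: ennreal_mult' mult_ac)
        also have "\<dots> \<le> ennreal (exp (- a * (t - s))) * ennreal (a / sqrt (y s) + (1 - \<alpha>) / (2 * y s * sqrt (y s)))"
          unfolding y_def using s by (intro mult_left_mono B) auto
        also have "\<dots> = ennreal (G' s)" unfolding G'_def by (simp add: ennreal_mult')
        finally show ?thesis .
      qed
      show "A \<subseteq> {t0..t}" "A - {t0<..<t} \<subseteq> {t0, t}" using A by auto
    qed (use t null in auto)
    then show ?thesis by (simp add: G_def y_def)
  qed
  \<comment> \<open>The crude bound, which ignores the diffusion time \<open>\<tau> \<ge> 0\<close>.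
    It is confined to \<open>r > 0\<close>.\<close>
  have A: "X t r z \<le> ennreal (1 / sqrt r)" if "- h \<le> t" "0 < r" for t r z
  proof -
    have "\<forall>t r z. - h \<le> t \<and> t \<le> real n * h \<and> 0 < r \<longrightarrow> X t r z \<le> ennreal (1 / sqrt r)" for n
    proof (induction n)
      case 0
      then show ?case using init by auto
    next
      case (Suc n)
      show ?case
      proof (intro allI impI)
        fix t r z :: real assume tr: "- h \<le> t \<and> t \<le> real (Suc n) * h \<and> 0 < r"
        show "X t r z \<le> ennreal (1 / sqrt r)"
        proof (cases "t \<le> 0")
          case True
          then show ?thesis using init tr by auto
        next
          case False
          then have t: "0 < t" by simp
          have "(\<integral>\<^sup>+s. ?F t r z s * indicator {0<..<t} s \<partial>lborel)
            \<le> ennreal (1 / sqrt (r + 0 * t) - exp (- a * (t - 0)) / sqrt (r + t - 0 + 0 * 0))"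
          proof (rule supersolution)
            fix s assume s: "0 < s" "s < t"
            have "X (s - h) (r + t - s) (z - d) \<le> ennreal (1 / sqrt (r + t - s))"
              using Suc s tr h by (auto simp: algebra_simps)
            then have "ennreal a * X (s - h) (r + t - s) (z - d) \<le> ennreal a * ennreal (1 / sqrt (r + t - s))"
              by (intro mult_left_mono) auto
            also have "\<dots> = ennreal (a / sqrt (r + t - s))" using a by (simp flip: ennreal_mult')
            also have "\<dots> \<le> ennreal (?\<rho> 0 t r s)"
              using s tr by (intro ennreal_leI) simp
            finally show "ennreal a * X (s - h) (r + t - s) (z - d)
              \<le> ennreal (?\<rho> 0 t r s)" .
          qed (use t tr in auto)
          moreover have "ennreal (exp (- a * t)) * X 0 (r + t) z \<le> ennreal (exp (- a * t)) * ennreal (1 / sqrt (r + t))"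
            using init[of 0 "r + t" z] h t tr by (intro mult_left_mono) auto
          ultimately have "X t r z \<le> ennreal (exp (- a * t)) * ennreal (1 / sqrt (r + t))
             + ennreal (1 / sqrt r - exp (- a * t) / sqrt (r + t))"
            using rec[of t r z] t tr by (auto intro: add_mono)
          also have "\<dots> = ennreal (exp (- a * t) * (1 / sqrt (r + t)) + (1 / sqrt r - exp (- a * t) / sqrt (r + t)))"
          proof -
            have "exp (- a * t) / sqrt (r + t) \<le> 1 / sqrt r"
              using a t tr by (intro frac_le) (auto simp: mult_nonneg_nonneg)
            moreover have "0 \<le> exp (- a * t) * (1 / sqrt (r + t))" using t tr by simp
            ultimately show ?thesis
              unfolding ennreal_mult'[OF exp_ge_zero, symmetric] by (intro ennreal_plus[symmetric]) auto
          qed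
          also have "\<dots> = ennreal (1 / sqrt r)" by simp
          finally show ?thesis .
        qed
      qed
    qed
    moreover obtain n where "t \<le> real n * h"
      using reals_Archimedean3[OF h] less_imp_le by blast
    ultimately show ?thesis using that by blast
  qed
  \<comment> \<open>The Markov property at time \<open>t0\<close>: the part of the jump integral
    before \<open>t0\<close> recombines with the initial term to \<open>X t0\<close>, seen with the
    diffusion time \<open>t - t0\<close> added to \<open>r\<close>.\<close>
  have restart: "X t r z = ennreal (exp (- a * (t - t0))) * X t0 (r + t - t0) z
      + (\<integral>\<^sup>+s. ?F t r z s * indicator {t0..<t} s \<partial>lborel)"
    if t: "0 < t0" "t0 < t" and r: "0 \<le> r" for t t0 r z
  proof -
    define f where "f s = ennreal (a * exp (- a * (t - s))) * (X (s - h) (r + t - s) (z - d) * indicator {0<..<t} s)" for s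
    have [measurable]: "(\<lambda>s. X (s - h) (r + t - s) (z - d) * indicator {0<..<t} s) \<in> borel_measurable borel"
      using t r by (intro meas) auto
    have fm [measurable]: "f \<in> borel_measurable borel" unfolding f_def by measurable
    have "(\<integral>\<^sup>+s. ?F t r z s * indicator {0<..<t} s \<partial>lborel)
      = (\<integral>\<^sup>+s. f s * indicator {0<..<t0} s + f s * indicator {t0..<t} s \<partial>lborel)"
      using t by (intro nn_integral_cong) (auto simp: f_def indicator_def mult.assoc)
    also have "\<dots> = (\<integral>\<^sup>+s. f s * indicator {0<..<t0} s \<partial>lborel) + (\<integral>\<^sup>+s. f s * indicator {t0..<t} s \<partial>lborel)"
      by (intro nn_integral_add) measurable
    also have "(\<integral>\<^sup>+s. f s * indicator {t0..<t} s \<partial>lborel)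
      = (\<integral>\<^sup>+s. ?F t r z s * indicator {t0..<t} s \<partial>lborel)"
      using t by (intro nn_integral_cong) (auto simp: f_def indicator_def)
    also have "(\<integral>\<^sup>+s. f s * indicator {0<..<t0} s \<partial>lborel)
      = (\<integral>\<^sup>+s. ennreal (exp (- a * (t - t0))) * (?F t0 (r + t - t0) z s * indicator {0<..<t0} s) \<partial>lborel)"
    proof (rule nn_integral_cong)
      fix s
      have e: "exp (- a * (t - s)) = exp (- a * (t - t0)) * exp (- a * (t0 - s))"
        unfolding exp_add[symmetric] by (simp add: algebra_simps)
      have "a * exp (- a * (t - s)) = exp (- a * (t - t0)) * (a * exp (- a * (t0 - s)))"
        unfolding e by (rule mult.left_commute)
      then have "ennreal (a * exp (- a * (t - s))) = ennreal (exp (- a * (t - t0))) * ennreal (a * exp (- a * (t0 - s)))"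
        by (simp only: ennreal_mult'[OF exp_ge_zero])
      then show "f s * indicator {0<..<t0} s = ennreal (exp (- a * (t - t0))) * (?F t0 (r + t - t0) z s * indicator {0<..<t0} s)"
        using t by (auto simp: f_def indicator_def mult.assoc)
    qed
    also have "\<dots> = ennreal (exp (- a * (t - t0))) * (\<integral>\<^sup>+s. ?F t0 (r + t - t0) z s * indicator {0<..<t0} s \<partial>lborel)"
    proof (rule nn_integral_cmult)
      have "(\<lambda>s. X (s - h) ((r + t - t0) + t0 - s) (z - d) * indicator {0<..<t0} s) \<in> borel_measurable borel"
        using t r by (intro meas) auto
      then show "(\<lambda>s. ?F t0 (r + t - t0) z s * indicator {0<..<t0} s) \<in> borel_measurable lborel"
        unfolding mult.assoc by measurable
    qed
    finally have "X t r z = ennreal (exp (- a * t)) * X 0 (r + t) z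
        + (ennreal (exp (- a * (t - t0))) * (\<integral>\<^sup>+s. ?F t0 (r + t - t0) z s * indicator {0<..<t0} s \<partial>lborel)
        + (\<integral>\<^sup>+s. ?F t r z s * indicator {t0..<t} s \<partial>lborel))"
      using rec[of t r z] t r by simp
    moreover have "ennreal (exp (- a * t)) * X 0 (r + t) z = ennreal (exp (- a * (t - t0))) * (ennreal (exp (- a * t0)) * X 0 ((r + t - t0) + t0) z)"
    proof -
      have "exp (- a * t) = exp (- a * (t - t0)) * exp (- a * t0)" by (simp add: algebra_simps flip: exp_add)
      then have "ennreal (exp (- a * t)) = ennreal (exp (- a * (t - t0))) * ennreal (exp (- a * t0))"
        by (simp add: ennreal_mult')
      then show ?thesis by (simp add: mult.assoc)
    qed
    moreover have "X t0 (r + t - t0) z = ennreal (exp (- a * t0)) * X 0 ((r + t - t0) + t0) z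
       + (\<integral>\<^sup>+s. ?F t0 (r + t - t0) z s * indicator {0<..<t0} s \<partial>lborel)"
      using t r by (intro rec) auto
    ultimately show ?thesis by (simp add: distrib_left add.assoc)
  qed
  define t0 where "t0 = h + 1 / (3 * a)"
  have t0: "h < t0" "0 < t0" using a h by (auto simp: t0_def add_pos_pos)
  \<comment> \<open>The crude bound is inserted after the first jump. The tangent inequality at
    \<open>M = diffusion_bound a h t\<close> makes everything affine in
    \<open>1 / sqrt (t - s)\<close>, which reduces general \<open>r\<close> to the case
    \<open>r = 0\<close> settled by \<open>first_jump_bound\<close>.\<close>
  have B: "X t r z \<le> ennreal (1 / sqrt (r + diffusion_bound a h t))" if t: "0 < t" "t \<le> t0" and r: "0 \<le> r" for t r z
  proof -
    define M where "M = diffusion_bound a h t"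
    have M: "0 < M" unfolding M_def using a h t by (intro diffusion_bound_pos)
    define Q where "Q = sqrt (r + M)"
    have Q: "0 < Q" "Q\<^sup>2 = r + M" using M r by (auto simp: Q_def)
    define A' where "A' = r / Q ^ 3"
    define B' where "B' = sqrt M ^ 3 / Q ^ 3"
    have AB: "0 \<le> A'" "0 \<le> B'" using r M Q by (auto simp: A'_def B'_def)
    have tangent: "1 / sqrt (r + s) \<le> A' + B' * (1 / sqrt s)" if "0 < s" for s
      using inverse_sqrt_tangent[OF r that M] by (simp add: A'_def B'_def Q_def)
    let ?E = "\<lambda>s. ennreal (a * exp (- a * (t - s)))"
    let ?S = "\<lambda>s. ennreal (a * exp (- a * (t - s)) / sqrt (t - s))"
    have "(\<integral>\<^sup>+s. ?E s * X (s - h) (r + t - s) (z - d) * indicator {0<..<t} s \<partial>lborel)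
       \<le> (\<integral>\<^sup>+s. ennreal A' * (?E s * indicator {0<..<t} s) + ennreal B' * (?S s * indicator {0<..<t} s) \<partial>lborel)"
    proof (rule nn_integral_mono)
      fix s
      show "?E s * X (s - h) (r + t - s) (z - d) * indicator {0<..<t} s
        \<le> ennreal A' * (?E s * indicator {0<..<t} s) + ennreal B' * (?S s * indicator {0<..<t} s)"
      proof (cases "s \<in> {0<..<t}")
        case True
        then have s: "0 < s" "s < t" by auto
        have e: "0 \<le> a * exp (- a * (t - s))" using a by simp
        have "X (s - h) (r + t - s) (z - d) \<le> ennreal (1 / sqrt (r + (t - s)))"
          using A[of "s - h" "r + t - s" "z - d"] s r by (simp add: add_diff_eq)
        also have "\<dots> \<le> ennreal (A' + B' * (1 / sqrt (t - s)))"
          using tangent[of "t - s"] s by (intro ennreal_leI) auto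
        finally have "?E s * X (s - h) (r + t - s) (z - d) \<le> ?E s * ennreal (A' + B' * (1 / sqrt (t - s)))"
          by (intro mult_left_mono) auto
        also have "\<dots> = ennreal (A' * (a * exp (- a * (t - s))) + B' * (a * exp (- a * (t - s)) / sqrt (t - s)))"
          by (subst ennreal_mult'[symmetric, OF e]) (simp add: algebra_simps)
        also have "\<dots> = ennreal A' * ?E s + ennreal B' * ?S s"
          unfolding ennreal_mult'[OF AB(1), symmetric] ennreal_mult'[OF AB(2), symmetric]
          using AB a s by (intro ennreal_plus mult_nonneg_nonneg divide_nonneg_nonneg) auto
        finally show ?thesis using True by simp
      qed simp
    qed
    also have "\<dots> = ennreal A' * (\<integral>\<^sup>+s. ?E s * indicator {0<..<t} s \<partial>lborel)
        + ennreal B' * (\<integral>\<^sup>+s. ?S s * indicator {0<..<t} s \<partial>lborel)"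
      by (subst nn_integral_add) (auto simp: nn_integral_cmult)
    also have "\<dots> \<le> ennreal A' * ennreal (1 - exp (- a * t)) + ennreal B' * ennreal (sqrt (pi * a))"
    proof (intro add_mono mult_left_mono)
      have "(\<integral>\<^sup>+s. ?E s * indicator {0<..<t} s \<partial>lborel) \<le> ennreal (exp (- a * (t - t)) - exp (- a * (t - 0)))"
      proof (rule nn_integral_le_increment[where a = 0 and b = t and G = "\<lambda>s. exp (- a * (t - s))"
          and G' = "\<lambda>s. a * exp (- a * (t - s))" and N = "{0, t}"])
        show "((\<lambda>s. exp (- a * (t - s))) has_real_derivative a * exp (- a * (t - s))) (at s)" for s
          by (auto intro!: derivative_eq_intros)
      qed (use t a null in auto)
      then show "(\<integral>\<^sup>+s. ?E s * indicator {0<..<t} s \<partial>lborel) \<le> ennreal (1 - exp (- a * t))" by simp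
      show "(\<integral>\<^sup>+s. ?S s * indicator {0<..<t} s \<partial>lborel) \<le> ennreal (sqrt (pi * a))"
        by (rule exponential_inverse_sqrt_integral[OF a])
    qed auto
    finally have 1: "(\<integral>\<^sup>+s. ?E s * X (s - h) (r + t - s) (z - d) * indicator {0<..<t} s \<partial>lborel)
       \<le> ennreal (A' * (1 - exp (- a * t)) + B' * sqrt (pi * a))"
      using AB a t by (simp add: ennreal_mult' mult_nonneg_nonneg)
    have "ennreal (exp (- a * t)) * X 0 (r + t) z \<le> ennreal (exp (- a * t)) * ennreal (A' + B' * (1 / sqrt t))"
    proof (rule mult_left_mono)
      have "X 0 (r + t) z \<le> ennreal (1 / sqrt (r + t))" using A[of 0 "r + t" z] h r t by simp
      also have "\<dots> \<le> ennreal (A' + B' * (1 / sqrt t))" using tangent[OF t(1)] by (rule ennreal_leI)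
      finally show "X 0 (r + t) z \<le> ennreal (A' + B' * (1 / sqrt t))" .
    qed simp
    then have 2: "ennreal (exp (- a * t)) * X 0 (r + t) z \<le> ennreal (exp (- a * t) * (A' + B' * (1 / sqrt t)))"
      by (simp flip: ennreal_mult')
    have "X t r z \<le> ennreal (exp (- a * t) * (A' + B' * (1 / sqrt t))) + ennreal (A' * (1 - exp (- a * t)) + B' * sqrt (pi * a))"
      unfolding rec[OF t(1) r, of z] by (rule add_mono[OF 2 1])
    also have "\<dots> = ennreal (exp (- a * t) * (A' + B' * (1 / sqrt t)) + (A' * (1 - exp (- a * t)) + B' * sqrt (pi * a)))"
      using AB a t by (intro ennreal_plus[symmetric]) (auto intro!: add_nonneg_nonneg mult_nonneg_nonneg)
    also have "\<dots> = ennreal (A' + B' * (exp (- a * t) / sqrt t + sqrt (pi * a)))"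
      by (simp add: algebra_simps)
    also have "\<dots> \<le> ennreal (A' + B' * (1 / sqrt M))"
      using first_jump_bound[OF a h t(1)] t(2) AB unfolding M_def t0_def
      by (intro ennreal_leI add_left_mono mult_left_mono) auto
    \<comment> \<open>Nothing is lost here: the tangent touches at \<open>M\<close>.\<close>
    also have "A' + B' * (1 / sqrt M) = 1 / Q"
    proof -
      have "sqrt M ^ 3 * (1 / sqrt M) = M" using M by (simp add: power3_eq_cube)
      moreover have "B' * (1 / sqrt M) = (sqrt M ^ 3 * (1 / sqrt M)) / Q ^ 3" by (simp add: B'_def)
      ultimately have "B' * (1 / sqrt M) = M / Q ^ 3" by (simp only:)
      then have "A' + B' * (1 / sqrt M) = Q\<^sup>2 / Q ^ 3" unfolding A'_def Q(2) by (simp add: add_divide_distrib)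
      also have "\<dots> = 1 / Q" using Q(1) by (simp add: power2_eq_square power3_eq_cube)
      finally show ?thesis .
    qed
    finally show ?thesis by (simp add: Q_def M_def)
  qed
  define \<alpha> where "\<alpha> = 1 / (pi * (1 + a * h))"
  have \<alpha>: "0 < \<alpha>" "\<alpha> \<le> 1"
  proof -
    have "1 * 1 \<le> pi * (1 + a * h)" using pi_gt3 a h by (intro mult_mono) auto
    then show "0 < \<alpha>" "\<alpha> \<le> 1" by (auto simp: \<alpha>_def)
  qed
  have db: "diffusion_bound a h t = \<alpha> * t" if "h \<le> t" for t
    using that by (simp add: diffusion_bound_def \<alpha>_def min_def)
  \<comment> \<open>Beyond \<open>t0\<close> the equation is restarted there, so jumps start from
    times \<open>s > t0\<close> and land at \<open>s - h\<close>, which the previous step covers and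
    where the bound is positive.\<close>
  have "\<forall>t r z. 0 < t \<and> t \<le> t0 + real n * h \<and> 0 \<le> r \<longrightarrow> X t r z \<le> ennreal (1 / sqrt (r + diffusion_bound a h t))" for n
  proof (induction n)
    case 0
    then show ?case using B by auto
  next
    case (Suc n)
    show ?case
    proof (intro allI impI)
      fix t r z :: real assume tr: "0 < t \<and> t \<le> t0 + real (Suc n) * h \<and> 0 \<le> r"
      show "X t r z \<le> ennreal (1 / sqrt (r + diffusion_bound a h t))"
      proof (cases "t \<le> t0")
        case True
        then show ?thesis using B tr by auto
      next
        case False
        then have t: "t0 < t" by simp
        have "(\<integral>\<^sup>+s. ?F t r z s * indicator {t0..<t} s \<partial>lborel)
          \<le> ennreal (1 / sqrt (r + \<alpha> * t) - exp (- a * (t - t0)) / sqrt (r + t - t0 + \<alpha> * t0))"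
        proof (rule supersolution)
          fix s assume s: "t0 < s" "s < t"
          define M where "M = diffusion_bound a h (s - h)"
          have M: "0 < M" unfolding M_def using a h s t0 by (intro diffusion_bound_pos) auto
          have "0 < s - h" "s - h \<le> t0 + real n * h" "0 \<le> r + t - s"
            using s tr t0 by (auto simp: algebra_simps)
          with Suc have "X (s - h) (r + t - s) (z - d) \<le> ennreal (1 / sqrt (r + t - s + M))"
            unfolding M_def by blast
          then have "ennreal a * X (s - h) (r + t - s) (z - d) \<le> ennreal a * ennreal (1 / sqrt (r + t - s + M))"
            by (intro mult_left_mono) auto
          also have "\<dots> = ennreal (a / sqrt (r + t - s + M))" using a by (simp flip: ennreal_mult')
          also have "\<dots> \<le> ennreal (?\<rho> \<alpha> t r s)"
          proof (intro ennreal_leI inverse_sqrt_delay_step)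
            show "a * (\<alpha> * s - M) * (\<alpha> * s) \<le> (1 - \<alpha>) * M"
              unfolding M_def \<alpha>_def using s by (intro diffusion_bound_delay a h) (simp add: t0_def)
          qed (use a s tr M \<alpha> t0 in auto)
          finally show "ennreal a * X (s - h) (r + t - s) (z - d)
            \<le> ennreal (?\<rho> \<alpha> t r s)" .
        qed (use t t0 tr \<alpha> in \<open>auto intro!: add_nonneg_pos\<close>)
        moreover have "ennreal (exp (- a * (t - t0))) * X t0 (r + t - t0) z \<le> ennreal (exp (- a * (t - t0))) * ennreal (1 / sqrt (r + t - t0 + \<alpha> * t0))"
          using B[of t0 "r + t - t0" z] t t0 tr db[of t0] by (intro mult_left_mono) auto
        ultimately have "X t r z \<le> ennreal (exp (- a * (t - t0))) * ennreal (1 / sqrt (r + t - t0 + \<alpha> * t0))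
           + ennreal (1 / sqrt (r + \<alpha> * t) - exp (- a * (t - t0)) / sqrt (r + t - t0 + \<alpha> * t0))"
          using restart[of t0 t r z] t0 t tr by (auto intro: add_mono)
        also have "\<dots> = ennreal (exp (- a * (t - t0)) * (1 / sqrt (r + t - t0 + \<alpha> * t0))
           + (1 / sqrt (r + \<alpha> * t) - exp (- a * (t - t0)) / sqrt (r + t - t0 + \<alpha> * t0)))"
        proof -
          have "0 \<le> (1 - \<alpha>) * (t - t0)" using t \<alpha> by (intro mult_nonneg_nonneg) auto
          then have le: "r + \<alpha> * t \<le> r + t - t0 + \<alpha> * t0" by (simp add: algebra_simps)
          have "0 < r + \<alpha> * t" using \<alpha> tr by (auto intro!: add_nonneg_pos)
          then have "exp (- a * (t - t0)) / sqrt (r + t - t0 + \<alpha> * t0) \<le> 1 / sqrt (r + \<alpha> * t)"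
            using a t le by (intro frac_le) (auto simp: mult_nonneg_nonneg)
          moreover have "0 \<le> exp (- a * (t - t0)) * (1 / sqrt (r + t - t0 + \<alpha> * t0))"
            using le \<open>0 < r + \<alpha> * t\<close> by simp
          ultimately show ?thesis
            unfolding ennreal_mult'[OF exp_ge_zero, symmetric] by (intro ennreal_plus[symmetric]) auto
        qed
        also have "\<dots> = ennreal (1 / sqrt (r + \<alpha> * t))" by simp
        finally show ?thesis using db[of t] t t0 by simp
      qed
    qed
  qed
  moreover obtain n where "t \<le> real n * h"
    using reals_Archimedean3[OF h] less_imp_le by blast
  then have "t \<le> t0 + real n * h" using t0 by simp
  ultimately show ?thesis using t r by blast
qed

section \<open>Renewal equation for the smoothed mild solution\<close>

lemma nn_integral_lebesgue_eq:
  assumes "integrable lebesgue f" "\<And>y. 0 \<le> f y"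
  shows "(\<integral>\<^sup>+y. ennreal (f y) \<partial>lborel) = ennreal (LINT y|lebesgue. f y)"
  using nn_integral_eq_integral[OF assms(1)] assms(2) by (simp add: nn_integral_completion)

text \<open>Chapman-Kolmogorov with a datum. The function \<open>\<phi>\<close> is only Lebesgue
  measurable, whereas Tonelli's theorem is applied on products of \<open>lborel\<close>; so a Borel
  representative is substituted first.\<close>

lemma semigroup_kernel_nn_semigroup:
  assumes r: "0 < r" and t: "0 < t" and \<phi>: "\<phi> \<in> borel_measurable lebesgue" and \<phi>0: "\<And>x. 0 \<le> \<phi> x"
  shows "(\<integral>\<^sup>+y. ennreal (semigroup_kernel m p r (z - y)) * (\<integral>\<^sup>+x. ennreal (semigroup_kernel m p t (y - x) * \<phi> x) \<partial>lborel) \<partial>lborel)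
    = (\<integral>\<^sup>+x. ennreal (semigroup_kernel m p (r + t) (z - x) * \<phi> x) \<partial>lborel)"
proof -
  let ?k = "semigroup_kernel m p"
  obtain g where g [measurable]: "g \<in> borel_measurable lborel" and ae: "AE x in lborel. \<phi> x = g x"
    using completion_ex_borel_measurable_real[OF \<phi>] by blast
  have repl: "(\<integral>\<^sup>+x. ennreal (?k \<tau> (y - x) * \<phi> x) \<partial>lborel)
     = (\<integral>\<^sup>+x. ennreal (?k \<tau> (y - x)) * ennreal (g x) \<partial>lborel)" if "0 < \<tau>" for \<tau> y
  proof (rule nn_integral_cong_AE)
    show "AE x in lborel. ennreal (?k \<tau> (y - x) * \<phi> x) = ennreal (?k \<tau> (y - x)) * ennreal (g x)"
      using ae by eventually_elim (use that in \<open>simp add: ennreal_mult'\<close>)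
  qed
  let ?F = "\<lambda>y x. ennreal (?k r (z - y)) * (ennreal (?k t (y - x)) * ennreal (g x))"
  have "(\<integral>\<^sup>+y. ennreal (?k r (z - y)) * (\<integral>\<^sup>+x. ennreal (?k t (y - x) * \<phi> x) \<partial>lborel) \<partial>lborel)
    = (\<integral>\<^sup>+y. \<integral>\<^sup>+x. ?F y x \<partial>lborel \<partial>lborel)"
    unfolding repl[OF t] by (intro nn_integral_cong nn_integral_cmult[symmetric]) measurable
  also have "\<dots> = (\<integral>\<^sup>+x. \<integral>\<^sup>+y. ?F y x \<partial>lborel \<partial>lborel)"
    by (rule lborel_pair.Fubini') measurable
  also have "\<dots> = (\<integral>\<^sup>+x. ennreal (?k (r + t) (z - x)) * ennreal (g x) \<partial>lborel)"
  proof (rule nn_integral_cong)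
    fix x
    have "(\<integral>\<^sup>+y. ?F y x \<partial>lborel) = (\<integral>\<^sup>+y. ennreal (?k r (z - y)) * ennreal (?k t (y - x)) * ennreal (g x) \<partial>lborel)"
      by (simp add: mult.assoc)
    also have "\<dots> = (\<integral>\<^sup>+y. ennreal (?k r (z - y)) * ennreal (?k t (y - x)) \<partial>lborel) * ennreal (g x)"
      by (intro nn_integral_multc) measurable
    finally show "(\<integral>\<^sup>+y. ?F y x \<partial>lborel) = ennreal (?k (r + t) (z - x)) * ennreal (g x)"
      unfolding semigroup_kernel_convolution[OF r t] .
  qed
  also have "\<dots> = (\<integral>\<^sup>+x. ennreal (?k (r + t) (z - x) * \<phi> x) \<partial>lborel)"
    using repl[of "r + t" z] r t by simp
  finally show ?thesis .
qed

lemma kernel_nn_integral_measurable: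
  assumes t: "0 < t" and \<phi>: "\<phi> \<in> borel_measurable lebesgue"
  shows "(\<lambda>y. \<integral>\<^sup>+x. ennreal (semigroup_kernel m p t (y - x) * \<phi> x) \<partial>lborel) \<in> borel_measurable lborel"
proof -
  obtain g where g [measurable]: "g \<in> borel_measurable lborel" and ae: "AE x in lborel. \<phi> x = g x"
    using completion_ex_borel_measurable_real[OF \<phi>] by blast
  have "(\<integral>\<^sup>+x. ennreal (semigroup_kernel m p t (y - x) * \<phi> x) \<partial>lborel)
     = (\<integral>\<^sup>+x. ennreal (semigroup_kernel m p t (y - x) * g x) \<partial>lborel)" for y
    by (rule nn_integral_cong_AE) (use ae in eventually_elim, simp)
  then show ?thesis by simp
qed

lemma mild_solution_decay:
  fixes h m p q d \<gamma> C t z :: real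
  assumes h: "0 < h" and p: "p \<le> 0" and q: "0 < q"
    and mild: "delayed_mild_solution h m p q d u0 u"
    and nonneg: "\<And>t z. - h \<le> t \<Longrightarrow> 0 \<le> u t z"
    and \<gamma>: "\<gamma> \<le> 0" "p < \<gamma>" "\<gamma> - p = q * exp (- h * \<gamma>)"
    and C: "0 < C" "\<And>s. s \<in> {-h..0} \<Longrightarrow> L1_norm (u0 s) \<le> C" and t: "0 < t"
  shows "u t z \<le> 1/2 * C * sqrt (1 + h * (\<gamma> - p)) * (exp (\<gamma> * t) / sqrt t)"
proof -
  let ?k = "semigroup_kernel m p"
  have uL1: "continuous_L1_on {-h..} u" and uu0: "\<And>s z. s \<in> {-h..0} \<Longrightarrow> u s z = u0 s z"
    and umild: "\<And>t z. t > 0 \<Longrightarrow> u t z = (LINT y|lebesgue. ?k t (z - y) * u0 0 y) +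
        (LINT s:{0..t}|lebesgue. (LINT y|lebesgue. ?k (t - s) (z - y) * (q * u (s - h) (y - d))))"
    using mild by (auto simp: delayed_mild_solution_def)
  have ui: "integrable lebesgue (u s)" if "- h \<le> s" for s using uL1 that by (auto simp: continuous_L1_on_def)
  have um: "u s \<in> borel_measurable lebesgue" if "- h \<le> s" for s using ui[OF that] by (rule borel_measurable_integrable)
  define f where "f s y = q * u (s - h) (y - d)" for s y
  have fL1: "continuous_L1_on {0..} f" unfolding f_def by (rule continuous_L1_on_shift[OF uL1])
  have fi: "integrable lebesgue (f s)" if "0 \<le> s" for s using fL1 that by (auto simp: continuous_L1_on_def)
  have fm: "f s \<in> borel_measurable lebesgue" if "0 \<le> s" for s using fi[OF that] by (rule borel_measurable_integrable)
  have f0: "0 \<le> f s y" if "0 \<le> s" for s y using nonneg[of "s - h" "y - d"] q that by (simp add: f_def)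
  define V where "V s r z = (\<integral>\<^sup>+y. ennreal (?k r (z - y) * u s y) \<partial>lborel)" for s r z
  define I where "I \<tau> s z = (LINT y|lebesgue. ?k (\<tau> - s) (z - y) * f s y)" for \<tau> s z
  have nnI: "(\<integral>\<^sup>+y. ennreal (?k (\<tau> - s) (z - y) * f s y) \<partial>lborel) = ennreal (I \<tau> s z)" if "0 \<le> s" "s < \<tau>" for \<tau> s z
    unfolding I_def using that f0[OF that(1)]
    by (intro nn_integral_lebesgue_eq integrable_semigroup_kernel_mult fi mult_nonneg_nonneg) auto
  have I0: "0 \<le> I \<tau> s z" if "0 \<le> s" "s \<le> \<tau>" for \<tau> s z
    unfolding I_def using f0 that by (intro Bochner_Integration.integral_nonneg mult_nonneg_nonneg) auto
  \<comment> \<open>The translation by \<open>d\<close> in the delayed term passes from the datum to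
    the evaluation point.\<close>
  have IV: "ennreal (I \<tau> s z) = ennreal q * V (s - h) (\<tau> - s) (z - d)" if "0 \<le> s" "s < \<tau>" for \<tau> s z
  proof -
    have "ennreal (I \<tau> s z) = (\<integral>\<^sup>+y. ennreal (?k (\<tau> - s) (z - y) * f s y) \<partial>lebesgue)"
      using nnI[OF that, of z] by (simp add: nn_integral_completion)
    also have "\<dots> = ennreal \<bar>1\<bar> * (\<integral>\<^sup>+y. ennreal (?k (\<tau> - s) (z - (d + 1 * y)) * f s (d + 1 * y)) \<partial>lebesgue)"
    proof (rule nn_integral_real_affine_lebesgue)
      have "(\<lambda>y. ?k (\<tau> - s) (z - y) * f s y) \<in> borel_measurable lebesgue"
        using that by (intro borel_measurable_integrable integrable_semigroup_kernel_mult fi) auto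
      then show "(\<lambda>y. ennreal (?k (\<tau> - s) (z - y) * f s y)) \<in> borel_measurable lebesgue" by measurable
    qed simp
    also have "\<dots> = (\<integral>\<^sup>+y. ennreal q * ennreal (?k (\<tau> - s) (z - d - y) * u (s - h) y) \<partial>lebesgue)"
      using q by (simp add: f_def algebra_simps flip: ennreal_mult')
    also have "\<dots> = ennreal q * (\<integral>\<^sup>+y. ennreal (?k (\<tau> - s) (z - d - y) * u (s - h) y) \<partial>lebesgue)"
    proof (rule nn_integral_cmult)
      have "(\<lambda>y. ?k (\<tau> - s) (z - d - y) * u (s - h) y) \<in> borel_measurable lebesgue"
        using that by (intro borel_measurable_integrable integrable_semigroup_kernel_mult ui) auto
      then show "(\<lambda>y. ennreal (?k (\<tau> - s) (z - d - y) * u (s - h) y)) \<in> borel_measurable lebesgue" by measurable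
    qed
    finally show ?thesis unfolding V_def by (simp add: nn_integral_completion)
  qed
  have cI: "continuous_on ({0<..<\<tau>} \<times> UNIV) (\<lambda>(s, z). I \<tau>' s z)" if "\<tau> \<le> \<tau>'" for \<tau> \<tau>'
    unfolding I_def by (rule continuous_on_kernel_integral[OF continuous_L1_on_subset[OF fL1]]) (use that in auto)
  have R0: "ennreal (u t z) = V 0 t z + (\<integral>\<^sup>+s. ennreal (I t s z) * indicator {0<..<t} s \<partial>lborel)" if t: "0 < t" for t z
  proof -
    have u0u: "u0 0 y = u 0 y" for y using uu0[of 0] h by simp
    have iI: "set_integrable lebesgue {0..t} (\<lambda>s. I t s z)"
      unfolding I_def using duhamel_integrable(2)[OF fL1 t p] .
    have "ennreal (u t z) = ennreal ((LINT y|lebesgue. ?k t (z - y) * u 0 y) + (LINT s:{0..t}|lebesgue. I t s z))"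
      unfolding umild[OF t] u0u I_def f_def ..
    also have "\<dots> = ennreal (LINT y|lebesgue. ?k t (z - y) * u 0 y) + ennreal (LINT s:{0..t}|lebesgue. I t s z)"
      using t h nonneg[of 0] I0[of _ t z] unfolding set_lebesgue_integral_def
      by (intro ennreal_plus Bochner_Integration.integral_nonneg) (auto simp: indicator_def)
    also have "ennreal (LINT y|lebesgue. ?k t (z - y) * u 0 y) = V 0 t z"
      unfolding V_def using t h nonneg[of 0]
      by (intro nn_integral_lebesgue_eq[symmetric] integrable_semigroup_kernel_mult ui mult_nonneg_nonneg) auto
    also have "ennreal (LINT s:{0..t}|lebesgue. I t s z) = (\<integral>\<^sup>+s. ennreal (indicator {0..t} s *\<^sub>R I t s z) \<partial>lborel)"
      unfolding set_lebesgue_integral_def using iI[unfolded set_integrable_def] I0[of _ t z]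
      by (intro nn_integral_lebesgue_eq[symmetric]) (auto simp: indicator_def)
    also have "\<dots> = (\<integral>\<^sup>+s. ennreal (I t s z) * indicator {0<..<t} s \<partial>lborel)"
    proof (rule nn_integral_cong_AE)
      have "AE s in lborel. s \<notin> {0, t}" by (rule AE_not_in) (intro finite_imp_null_set_lborel, simp)
      then show "AE s in lborel. ennreal (indicator {0..t} s *\<^sub>R I t s z) = ennreal (I t s z) * indicator {0<..<t} s"
        by eventually_elim (auto simp: indicator_def)
    qed
    finally show ?thesis .
  qed
  have R1: "V t r z = V 0 (r + t) z + (\<integral>\<^sup>+s. ennreal (I (r + t) s z) * indicator {0<..<t} s \<partial>lborel)" if t: "0 < t" and r: "0 < r" for t r z
  proof -
    \<comment> \<open>The Duhamel integrand on the strip, extended by 0. Its joint measurability,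
      required for exchanging the two integrals, comes from joint continuity on the open
      strip.\<close>
    define J where "J x = ennreal (indicator ({0<..<t} \<times> UNIV) x *\<^sub>R (case x of (s, y) \<Rightarrow> I t s y))" for x :: "real \<times> real"
    have "(\<lambda>x. indicator ({0<..<t} \<times> UNIV) x *\<^sub>R (case x of (s, y) \<Rightarrow> I t s y)) \<in> borel_measurable borel"
      by (intro borel_measurable_continuous_on_indicator cI) (auto intro!: borel_open open_Times)
    then have Jm [measurable]: "J \<in> borel_measurable (lborel \<Otimes>\<^sub>M lborel)"
      unfolding J_def[abs_def] by (simp add: lborel_prod)
    have J: "J (s, y) = ennreal (I t s y) * indicator {0<..<t} s" for s y
      by (simp add: J_def indicator_def)
    have k0: "0 \<le> ?k r x" for x using r by simp
    have [measurable]: "(\<lambda>y. V 0 t y) \<in> borel_measurable lborel"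
      unfolding V_def using t h by (intro kernel_nn_integral_measurable um) auto
    have "V t r z = (\<integral>\<^sup>+y. ennreal (?k r (z - y)) * ennreal (u t y) \<partial>lborel)"
      unfolding V_def using k0 by (simp add: ennreal_mult')
    also have "\<dots> = (\<integral>\<^sup>+y. ennreal (?k r (z - y)) * V 0 t y + (\<integral>\<^sup>+s. ennreal (?k r (z - y)) * J (s, y) \<partial>lborel) \<partial>lborel)"
    proof (rule nn_integral_cong)
      fix y
      have "(\<integral>\<^sup>+s. ennreal (?k r (z - y)) * J (s, y) \<partial>lborel) = ennreal (?k r (z - y)) * (\<integral>\<^sup>+s. J (s, y) \<partial>lborel)"
        by (intro nn_integral_cmult) measurable
      then show "ennreal (?k r (z - y)) * ennreal (u t y) = ennreal (?k r (z - y)) * V 0 t y + (\<integral>\<^sup>+s. ennreal (?k r (z - y)) * J (s, y) \<partial>lborel)"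
        unfolding R0[OF t] J by (simp add: distrib_left)
    qed
    also have "\<dots> = (\<integral>\<^sup>+y. ennreal (?k r (z - y)) * V 0 t y \<partial>lborel) + (\<integral>\<^sup>+y. (\<integral>\<^sup>+s. ennreal (?k r (z - y)) * J (s, y) \<partial>lborel) \<partial>lborel)"
      by (intro nn_integral_add) measurable
    also have "(\<integral>\<^sup>+y. ennreal (?k r (z - y)) * V 0 t y \<partial>lborel) = V 0 (r + t) z"
      unfolding V_def using h nonneg[of 0] by (intro semigroup_kernel_nn_semigroup r t um) auto
    also have "(\<integral>\<^sup>+y. (\<integral>\<^sup>+s. ennreal (?k r (z - y)) * J (s, y) \<partial>lborel) \<partial>lborel)
        = (\<integral>\<^sup>+s. (\<integral>\<^sup>+y. ennreal (?k r (z - y)) * J (s, y) \<partial>lborel) \<partial>lborel)"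
      by (rule lborel_pair.Fubini') measurable
    also have "\<dots> = (\<integral>\<^sup>+s. ennreal (I (r + t) s z) * indicator {0<..<t} s \<partial>lborel)"
    proof (rule nn_integral_cong)
      fix s
      show "(\<integral>\<^sup>+y. ennreal (?k r (z - y)) * J (s, y) \<partial>lborel) = ennreal (I (r + t) s z) * indicator {0<..<t} s"
      proof (cases "s \<in> {0<..<t}")
        case True
        then have s: "0 \<le> s" "s < t" "0 < t - s" by auto
        have "(\<integral>\<^sup>+y. ennreal (?k r (z - y)) * J (s, y) \<partial>lborel)
          = (\<integral>\<^sup>+y. ennreal (?k r (z - y)) * (\<integral>\<^sup>+x. ennreal (?k (t - s) (y - x) * f s x) \<partial>lborel) \<partial>lborel)"
          using True nnI[OF s(1,2)] by (simp add: J)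
        also have "\<dots> = (\<integral>\<^sup>+x. ennreal (?k (r + (t - s)) (z - x) * f s x) \<partial>lborel)"
          using s by (intro semigroup_kernel_nn_semigroup r fm f0) auto
        also have "r + (t - s) = (r + t) - s" by simp
        also have "(\<integral>\<^sup>+x. ennreal (?k ((r + t) - s) (z - x) * f s x) \<partial>lborel) = ennreal (I (r + t) s z)"
          using s r by (intro nnI) auto
        finally show ?thesis using True by simp
      qed (simp add: J)
    qed
    finally show ?thesis .
  qed
  \<comment> \<open>The kernel at time 0 is the default value 0 and not the identity, so
    \<open>V s 0 z\<close> would vanish; the value at \<open>r = 0\<close> is supplied by
    \<open>u\<close> itself.\<close>
  define V' where "V' s r z = (if r = 0 then ennreal (u s z) else V s r z)" for s r z
  have R: "V' t r z = V' 0 (r + t) z + (\<integral>\<^sup>+s. ennreal q * V' (s - h) (r + t - s) (z - d) * indicator {0<..<t} s \<partial>lborel)"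
    if t: "0 < t" and r: "0 \<le> r" for t r z
  proof -
    have "V' t r z = V 0 (r + t) z + (\<integral>\<^sup>+s. ennreal (I (r + t) s z) * indicator {0<..<t} s \<partial>lborel)"
      using R0[OF t, of z] R1[OF t, of r z] r by (cases "r = 0") (auto simp: V'_def)
    also have "(\<integral>\<^sup>+s. ennreal (I (r + t) s z) * indicator {0<..<t} s \<partial>lborel)
      = (\<integral>\<^sup>+s. ennreal q * V' (s - h) (r + t - s) (z - d) * indicator {0<..<t} s \<partial>lborel)"
    proof (rule nn_integral_cong)
      fix s
      show "ennreal (I (r + t) s z) * indicator {0<..<t} s = ennreal q * V' (s - h) (r + t - s) (z - d) * indicator {0<..<t} s"
        using IV[of s "r + t" z] r by (cases "s \<in> {0<..<t}") (auto simp: V'_def)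
    qed
    finally show ?thesis using t r by (simp add: V'_def)
  qed
  \<comment> \<open>Obtained backwards: on the open interval \<open>V'\<close> is
    \<open>1 / q\<close> times the integrand \<open>I\<close>, which is continuous in
    \<open>s\<close>.\<close>
  have measV': "(\<lambda>s. V' (s - h) (r + t - s) (z - d) * indicator {0<..<t} s) \<in> borel_measurable borel"
    if t: "0 < t" and r: "0 \<le> r" for t r z
  proof -
    have "continuous_on {0<..<t} (\<lambda>s. I (r + t) s z)"
    proof -
      have "continuous_on {0<..<t} (\<lambda>s. (s, z))" by (intro continuous_intros)
      from continuous_on_compose2[OF cI[of t "r + t"] this] r show ?thesis by auto
    qed
    then have "(\<lambda>s. indicator {0<..<t} s *\<^sub>R I (r + t) s z) \<in> borel_measurable borel"
      by (intro borel_measurable_continuous_on_indicator) auto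
    then have m: "(\<lambda>s. ennreal (1 / q) * ennreal (indicator {0<..<t} s *\<^sub>R I (r + t) s z)) \<in> borel_measurable borel"
      by measurable
    have "ennreal (1 / q) * ennreal (indicator {0<..<t} s *\<^sub>R I (r + t) s z) = V' (s - h) (r + t - s) (z - d) * indicator {0<..<t} s" for s
    proof (cases "s \<in> {0<..<t}")
      case True
      have "ennreal (1 / q) * ennreal (I (r + t) s z) = ennreal (1 / q) * (ennreal q * V (s - h) (r + t - s) (z - d))"
        using IV[of s "r + t" z] True r by simp
      also have "\<dots> = (ennreal (1 / q) * ennreal q) * V (s - h) (r + t - s) (z - d)" by (simp only: mult.assoc)
      also have "ennreal (1 / q) * ennreal q = 1" using q by (simp flip: ennreal_mult')
      finally show ?thesis using True r by (simp add: V'_def)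
    qed simp
    with m show ?thesis by simp
  qed
  \<comment> \<open>Chosen so that the bound \<open>C / sqrt (4 * pi * r)\<close> of the initial
    data is normalised to \<open>1 / sqrt r\<close>.\<close>
  define N where "N = sqrt (4 * pi) / C"
  have N: "0 < N" using C by (simp add: N_def)
  define a where "a = \<gamma> - p"
  have a: "0 < a" using \<gamma> by (simp add: a_def)
  \<comment> \<open>With this exponential factor the rate of loss \<open>\<gamma> - p\<close> and
    the strength of the delayed term coincide, by the equation for \<open>\<gamma>\<close>: both
    become \<open>a\<close>, and the renewal equation is that of a mean over a jump process.\<close>
  define X where "X s r z = ennreal (N * exp (- \<gamma> * s - p * r)) * V' s r z" for s r z
  have "X t 0 z \<le> ennreal (1 / sqrt (0 + diffusion_bound a h t))"
  proof (rule delayed_diffusion_decay[OF a h, where d = d])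
    fix s r z :: real assume s: "- h \<le> s" "s \<le> 0" and r: "0 < r"
    have "V s r z = ennreal (LINT y|lebesgue. ?k r (z - y) * u s y)"
      unfolding V_def using s r nonneg[of s]
      by (intro nn_integral_lebesgue_eq integrable_semigroup_kernel_mult ui mult_nonneg_nonneg) auto
    also have "(LINT y|lebesgue. ?k r (z - y) * u s y) \<le> exp (p * r) / sqrt (4 * pi * r) * C"
    proof -
      have "u s = u0 s" using uu0[of s] s by (auto simp: fun_eq_iff)
      then have "L1_norm (u s) \<le> C" using C(2)[of s] s by simp
      then have "exp (p * r) / sqrt (4 * pi * r) * L1_norm (u s) \<le> exp (p * r) / sqrt (4 * pi * r) * C"
        using r by (intro mult_left_mono) auto
      then show ?thesis using kernel_integral_bound[OF r ui[OF s(1)], of m p z] by linarith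
    qed
    finally have "V s r z \<le> ennreal (exp (p * r) / sqrt (4 * pi * r) * C)" by (simp add: ennreal_leI)
    then have "X s r z \<le> ennreal (N * exp (- \<gamma> * s - p * r)) * ennreal (exp (p * r) / sqrt (4 * pi * r) * C)"
      unfolding X_def V'_def using r by (auto intro: mult_left_mono)
    also have "\<dots> = ennreal ((N * exp (- \<gamma> * s - p * r)) * (exp (p * r) / sqrt (4 * pi * r) * C))"
      by (rule ennreal_mult'[symmetric]) (use N in simp)
    also have "\<dots> \<le> ennreal (1 / sqrt r)"
    proof (rule ennreal_leI)
      \<comment> \<open>The remaining factor is at most 1 because \<open>\<gamma>\<close> and
        \<open>s\<close> are both nonpositive.\<close>
      have e: "exp (- \<gamma> * s - p * r) * exp (p * r) = exp (- \<gamma> * s)" by (simp flip: exp_add)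
      have "(N * exp (- \<gamma> * s - p * r)) * (exp (p * r) / sqrt (4 * pi * r) * C)
        = (exp (- \<gamma> * s - p * r) * exp (p * r)) * (N * C / sqrt (4 * pi * r))" by simp
      also have "N * C / sqrt (4 * pi * r) = 1 / sqrt r" using C by (simp add: N_def real_sqrt_mult)
      also have "exp (- \<gamma> * s - p * r) * exp (p * r) * (1 / sqrt r) \<le> 1 * (1 / sqrt r)"
        unfolding e using \<gamma>(1) s r by (intro mult_right_mono) (auto simp: mult_nonpos_nonpos)
      finally show "(N * exp (- \<gamma> * s - p * r)) * (exp (p * r) / sqrt (4 * pi * r) * C) \<le> 1 / sqrt r" by simp
    qed
    finally show "X s r z \<le> ennreal (1 / sqrt r)" .
  next
    fix t r z :: real assume t: "0 < t" and r: "0 \<le> r"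
    let ?N = "ennreal (N * exp (- \<gamma> * t - p * r))"
    have [measurable]: "(\<lambda>s. V' (s - h) (r + t - s) (z - d) * indicator {0<..<t} s) \<in> borel_measurable borel"
      by (rule measV'[OF t r])
    have "X t r z = ?N * V' 0 (r + t) z + ?N * (\<integral>\<^sup>+s. ennreal q * V' (s - h) (r + t - s) (z - d) * indicator {0<..<t} s \<partial>lborel)"
      unfolding X_def R[OF t r, of z] by (rule distrib_left)
    also have "?N * V' 0 (r + t) z = ennreal (exp (- a * t)) * X 0 (r + t) z"
    proof -
      have "N * exp (- \<gamma> * t - p * r) = exp (- a * t) * (N * exp (- \<gamma> * 0 - p * (r + t)))"
        by (simp add: a_def algebra_simps flip: exp_add)
      then have "?N = ennreal (exp (- a * t)) * ennreal (N * exp (- \<gamma> * 0 - p * (r + t)))"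
        by (simp only: ennreal_mult' exp_ge_zero)
      then show ?thesis unfolding X_def by (simp only: mult.assoc)
    qed
    also have "?N * (\<integral>\<^sup>+s. ennreal q * V' (s - h) (r + t - s) (z - d) * indicator {0<..<t} s \<partial>lborel)
      = (\<integral>\<^sup>+s. ?N * (ennreal q * (V' (s - h) (r + t - s) (z - d) * indicator {0<..<t} s)) \<partial>lborel)"
      unfolding mult.assoc by (rule nn_integral_cmult[symmetric]) measurable
    also have "\<dots> = (\<integral>\<^sup>+s. ennreal (a * exp (- a * (t - s))) * X (s - h) (r + t - s) (z - d) * indicator {0<..<t} s \<partial>lborel)"
    proof (rule nn_integral_cong)
      fix s
      \<comment> \<open>One factor \<open>a\<close> is written as
        \<open>q * exp (- h * \<gamma>)\<close>; this cancels the \<open>exp (h * \<gamma>)\<close>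
        which the delayed time leaves in the weight of \<open>X (s - h)\<close>.\<close>
      have "a * exp (- a * (t - s)) * (N * exp (- \<gamma> * (s - h) - p * (r + t - s)))
        = q * N * (exp (- h * \<gamma>) * (exp (- a * (t - s)) * exp (- \<gamma> * (s - h) - p * (r + t - s))))"
        unfolding \<gamma>(3)[folded a_def] by simp
      also have "exp (- h * \<gamma>) * (exp (- a * (t - s)) * exp (- \<gamma> * (s - h) - p * (r + t - s))) = exp (- \<gamma> * t - p * r)"
        unfolding exp_add[symmetric] by (simp add: a_def algebra_simps)
      finally have "ennreal (a * exp (- a * (t - s))) * ennreal (N * exp (- \<gamma> * (s - h) - p * (r + t - s))) = ?N * ennreal q"
        using a N q by (simp add: mult_ac flip: ennreal_mult')
      then show "?N * (ennreal q * (V' (s - h) (r + t - s) (z - d) * indicator {0<..<t} s))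
        = ennreal (a * exp (- a * (t - s))) * X (s - h) (r + t - s) (z - d) * indicator {0<..<t} s"
        unfolding X_def by (simp only: mult.assoc[symmetric])
    qed
    finally show "X t r z = ennreal (exp (- a * t)) * X 0 (r + t) z
      + (\<integral>\<^sup>+s. ennreal (a * exp (- a * (t - s))) * X (s - h) (r + t - s) (z - d) * indicator {0<..<t} s \<partial>lborel)" .
    show "(\<lambda>s. X (s - h) (r + t - s) (z - d) * indicator {0<..<t} s) \<in> borel_measurable borel"
      unfolding X_def mult.assoc by measurable
  qed (use t in auto)
  then have "ennreal (N * exp (- \<gamma> * t) * u t z) \<le> ennreal (1 / sqrt (diffusion_bound a h t))"
    using N by (simp add: X_def V'_def ennreal_mult')
  then have "N * exp (- \<gamma> * t) * u t z \<le> 1 / sqrt (diffusion_bound a h t)"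
    using diffusion_bound_pos[OF a h t] by (subst (asm) ennreal_le_iff) auto
  also have "\<dots> \<le> sqrt (pi * (1 + a * h)) / sqrt t"
  proof -
    have "t / (pi * (1 + a * h)) \<le> diffusion_bound a h t"
      unfolding diffusion_bound_def using a h t by (intro divide_left_mono mult_left_mono add_left_mono mult_pos_pos add_pos_nonneg) auto
    then have "1 / sqrt (diffusion_bound a h t) \<le> 1 / sqrt (t / (pi * (1 + a * h)))"
      using a h t diffusion_bound_pos[OF a h t] by (intro divide_left_mono) (auto intro!: mult_pos_pos divide_pos_pos add_pos_pos)
    then show ?thesis by (simp add: real_sqrt_divide)
  qed
  finally have "(C / sqrt (4 * pi) * exp (\<gamma> * t)) * (N * exp (- \<gamma> * t) * u t z)
     \<le> (C / sqrt (4 * pi) * exp (\<gamma> * t)) * (sqrt (pi * (1 + a * h)) / sqrt t)"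
    using C by (intro mult_left_mono) auto
  also have "(C / sqrt (4 * pi) * exp (\<gamma> * t)) * (N * exp (- \<gamma> * t) * u t z) = u t z"
  proof -
    have "exp (\<gamma> * t) * exp (- \<gamma> * t) = 1" by (simp flip: exp_add)
    moreover have "C / sqrt (4 * pi) * N = 1" using C by (simp add: N_def)
    moreover have "(C / sqrt (4 * pi) * exp (\<gamma> * t)) * (N * exp (- \<gamma> * t) * u t z)
      = (C / sqrt (4 * pi) * N) * (exp (\<gamma> * t) * exp (- \<gamma> * t)) * u t z" by (simp only: mult_ac)
    ultimately show ?thesis by (simp only: mult_1)
  qed
  \<comment> \<open>The \<open>pi\<close> of the diffusion bound cancels against
    \<open>sqrt (4 * pi) = 2 * sqrt pi\<close>, and the constant \<open>1/2\<close> remains.\<close>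
  also have "(C / sqrt (4 * pi) * exp (\<gamma> * t)) * (sqrt (pi * (1 + a * h)) / sqrt t)
     = 1/2 * C * sqrt (1 + h * (\<gamma> - p)) * (exp (\<gamma> * t) / sqrt t)"
  proof -
    have "sqrt (4 * pi) = 2 * sqrt pi" by (simp add: real_sqrt_mult)
    moreover have "sqrt (pi * (1 + a * h)) = sqrt pi * sqrt (1 + h * (\<gamma> - p))"
      by (simp add: real_sqrt_mult a_def mult.commute)
    ultimately show ?thesis by simp
  qed
  finally show ?thesis .
qed

subsection \<open>The characteristic equations\<close>

text \<open>The exponential part is concave by convexity of \<open>exp\<close>, and
  \<open>- l\<^sup>2\<close> contributes the quadratic gain exactly. The gain makes the function
  positive strictly between two zeros.\<close>

lemma char_E_concave:
  assumes "0 \<le> s" "s \<le> 1" "0 \<le> L"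
  shows "(1 - s) * char_E h L c x + s * char_E h L c y + s * (1 - s) * (x - y)\<^sup>2 \<le> char_E h L c ((1 - s) * x + s * y)"
proof -
  define l where "l = (1 - s) * x + s * y"
  have "exp ((1 - s) *\<^sub>R (- x * c * h) + s *\<^sub>R (- y * c * h)) \<le> (1 - s) * exp (- x * c * h) + s * exp (- y * c * h)"
    using assms by (intro convex_onD[OF exp_convex]) auto
  also have "(1 - s) *\<^sub>R (- x * c * h) + s *\<^sub>R (- y * c * h) = - l * c * h"
    by (simp add: l_def algebra_simps)
  finally have "L * exp (- l * c * h) \<le> L * ((1 - s) * exp (- x * c * h) + s * exp (- y * c * h))"
    using assms by (intro mult_left_mono) auto
  moreover have "- l\<^sup>2 + c * l + 1 = (1 - s) * (- x\<^sup>2 + c * x + 1) + s * (- y\<^sup>2 + c * y + 1) + s * (1 - s) * (x - y)\<^sup>2"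
    unfolding l_def by (simp add: power2_eq_square algebra_simps)
  ultimately have "(1 - s) * (- x\<^sup>2 + c * x + 1 - L * exp (- x * c * h)) + s * (- y\<^sup>2 + c * y + 1 - L * exp (- y * c * h))
     + s * (1 - s) * (x - y)\<^sup>2 \<le> - l\<^sup>2 + c * l + 1 - L * exp (- l * c * h)"
    by (simp add: algebra_simps)
  then show ?thesis by (simp add: char_E_def l_def)
qed

lemma char_E_between:
  assumes "0 \<le> L" "x < z" "z < y" "char_E h L c x = 0" "char_E h L c y = 0"
  shows "0 < char_E h L c z"
proof -
  define s where "s = (z - x) / (y - x)"
  have s: "0 < s" "s < 1" using assms by (auto simp: s_def field_simps)
  have "s * (y - x) = z - x" using assms by (simp add: s_def)
  then have z: "(1 - s) * x + s * y = z" by (simp add: algebra_simps)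
  have "0 < s * (1 - s) * (x - y)\<^sup>2" using s assms by simp
  moreover have "s * (1 - s) * (x - y)\<^sup>2 \<le> char_E h L c z"
    using char_E_concave[of s L h c x y] s assms z by simp
  ultimately show ?thesis by linarith
qed

lemma continuous_char_E: "continuous_on UNIV (char_E h L c)"
  unfolding char_E_def[abs_def] by (intro continuous_intros)

text \<open>The infimum defining \<open>c_min\<close> is attained up to closure: speeds slightly
  above \<open>c\<close> admit nonnegative values of \<open>char_E\<close>, the corresponding
  \<open>l\<close> are positive and bounded, and a limit point serves for \<open>c\<close>.\<close>

lemma char_E_nonneg_exists:
  assumes h: "0 < h" and L: "1 < L" and c: "c_min h L \<le> c"
  shows "\<exists>l. 0 \<le> char_E h L c l"
proof -
  define A where "A = {c. c > 0 \<and> (\<exists>l0. char_E h L c l0 \<ge> 0)}"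
  have "exp (- 1 * L * h) \<le> 1" using h L by simp
  then have "L * exp (- 1 * L * h) \<le> L * 1" using L by (intro mult_left_mono) auto
  then have "0 \<le> char_E h L L 1" by (simp add: char_E_def)
  then have "L \<in> A" using L by (auto simp: A_def)
  have inf: "Inf A \<le> c" using c by (simp add: c_min_def A_def)
  have "0 \<le> Inf A" using \<open>L \<in> A\<close> by (intro cInf_greatest) (auto simp: A_def)
  then have c0: "0 \<le> c" using inf by simp
  define C where "C n = c + 1 / real (Suc n)" for n
  have "\<exists>l. 0 \<le> l \<and> l \<le> c + 2 \<and> 0 \<le> char_E h L (C n) l" for n
  proof -
    have "0 < 1 / real (Suc n)" by simp
    then have "Inf A < C n" using inf unfolding C_def by linarith
    then obtain c' where c': "c' \<in> A" "c' < C n" using cInf_lessD \<open>L \<in> A\<close> by blast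
    then obtain l where l: "0 < c'" "0 \<le> char_E h L c' l" by (auto simp: A_def)
    \<comment> \<open>For \<open>l \<le> 0\<close> and positive speed, \<open>char_E\<close> is at
      most \<open>1 - L\<close>, hence negative. For \<open>l > 0\<close> it increases with the
      speed, which permits passing from \<open>c'\<close> to \<open>C n\<close>.\<close>
    have l0: "0 < l"
    proof (rule ccontr)
      assume "\<not> 0 < l"
      then have le: "l \<le> 0" by simp
      have "0 \<le> - l * c' * h" using le l(1) h by (intro mult_nonneg_nonneg) auto
      then have "L * 1 \<le> L * exp (- l * c' * h)" using L by (intro mult_left_mono) auto
      moreover have "c' * l \<le> 0" using le l(1) by (simp add: mult_nonneg_nonpos)
      ultimately show False using l(2) L zero_le_power2[of l] unfolding char_E_def by linarith
    qed
    have "l * c' * h \<le> l * C n * h" using l0 c' h by (intro mult_right_mono mult_left_mono) auto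
    then have "L * exp (- l * C n * h) \<le> L * exp (- l * c' * h)" using L by (intro mult_left_mono) auto
    moreover have "c' * l \<le> C n * l" using l0 c' by (intro mult_right_mono) auto
    ultimately have E: "0 \<le> char_E h L (C n) l" using l(2) unfolding char_E_def by linarith
    have "C n \<le> c + 1" by (simp add: C_def)
    then have "C n * l \<le> (c + 1) * l" using l0 by (intro mult_right_mono) auto
    moreover have "0 \<le> L * exp (- l * C n * h)" using L by simp
    ultimately have q: "l * l \<le> (c + 1) * l + 1" using E unfolding char_E_def power2_eq_square by linarith
    have "l \<le> c + 2"
    proof (rule ccontr)
      assume "\<not> l \<le> c + 2"
      then have g: "c + 2 < l" by simp
      have "(c + 2) * l < l * l" using g l0 by (intro mult_strict_right_mono) auto
      then have "l < 1" using q by (simp add: algebra_simps)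
      then show False using g c0 by simp
    qed
    then show ?thesis using E l0 by (intro exI[of _ l]) auto
  qed
  then obtain l where l: "\<And>n. l n \<in> {0..c + 2}" "\<And>n. 0 \<le> char_E h L (C n) (l n)"
    by (metis atLeastAtMost_iff)
  obtain l0 r where r: "l0 \<in> {0..c + 2}" "strict_mono (r :: nat \<Rightarrow> nat)" "(l \<circ> r) \<longlonglongrightarrow> l0"
    using seq_compactE[OF compact_imp_seq_compact[OF compact_Icc], of l 0 "c + 2"] l(1) by blast
  have "(\<lambda>n. c + inverse (real (Suc n))) \<longlonglongrightarrow> c + 0" by (intro tendsto_intros LIMSEQ_inverse_real_of_nat)
  then have "C \<longlonglongrightarrow> c" unfolding C_def[abs_def] by (simp add: inverse_eq_divide)
  from LIMSEQ_subseq_LIMSEQ[OF this r(2)] have Cr: "(\<lambda>n. C (r n)) \<longlonglongrightarrow> c" by (simp add: o_def)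
  have lr: "(\<lambda>n. l (r n)) \<longlonglongrightarrow> l0" using r(3) by (simp add: o_def)
  have "(\<lambda>n. char_E h L (C (r n)) (l (r n))) \<longlonglongrightarrow> char_E h L c l0"
    unfolding char_E_def by (intro tendsto_intros Cr lr)
  then have "0 \<le> char_E h L c l0" by (rule LIMSEQ_le_const) (use l(2) in auto)
  then show ?thesis by blast
qed

text \<open>\<open>Min\<close> and \<open>Max\<close> carry information only for a finite nonempty
  set of zeros. A zero exists by the intermediate value theorem, as \<open>char_E\<close> is
  negative at 0; three zeros cannot exist, as the middle one would be a point of positivity.\<close>

lemma char_E_nonneg_between_roots:
  assumes h: "0 < h" and L: "1 < L" and c: "c_min h L \<le> c" and l: "l \<in> {lambda1 h L c..lambda2 h L c}"
  shows "0 \<le> char_E h L c l"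
proof -
  define Z where "Z = {l. char_E h L c l = 0}"
  have "Z \<noteq> {}"
  proof -
    obtain l0 where l0: "0 \<le> char_E h L c l0" using char_E_nonneg_exists[OF h L c] by blast
    have "char_E h L c 0 < 0" using L by (simp add: char_E_def)
    have ivt: "connected (range (char_E h L c))"
      by (intro connected_continuous_image continuous_char_E connected_UNIV)
    have "0 \<in> range (char_E h L c)"
      by (rule connectedD_interval[OF ivt, of "char_E h L c 0" "char_E h L c l0"]) (use l0 \<open>char_E h L c 0 < 0\<close> in auto)
    then show ?thesis by (auto simp: Z_def)
  qed
  moreover have "finite Z"
  proof (rule ccontr)
    assume "infinite Z"
    then obtain B where B: "finite B" "card B = 3" "B \<subseteq> Z" using infinite_arbitrarily_large by blast
    then have "B \<noteq> {}" by auto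
    have "card {Min B, Max B} \<le> 2" by (simp add: card_insert_if)
    then have "\<not> B \<subseteq> {Min B, Max B}" using B card_mono[of "{Min B, Max B}" B] by auto
    then obtain z where z: "z \<in> B" "z \<noteq> Min B" "z \<noteq> Max B" by blast
    have "Min B < z" "z < Max B" 
      using Min_le[OF B(1) z(1)] Max_ge[OF B(1) z(1)] z(2,3) by linarith+
    moreover have "Min B \<in> Z" "Max B \<in> Z"
      using Min_in[OF B(1) \<open>B \<noteq> {}\<close>] Max_in[OF B(1) \<open>B \<noteq> {}\<close>] B(3) by blast+
    ultimately have "0 < char_E h L c z"
      using L by (intro char_E_between[of L "Min B" z "Max B"]) (auto simp: Z_def)
    then show False using z B by (auto simp: Z_def)
  qed
  ultimately have Z: "Min Z \<in> Z" "Max Z \<in> Z" by (auto intro: Min_in Max_in)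
  have "Min Z \<le> l" "l \<le> Max Z" using l by (auto simp: lambda1_def lambda2_def Z_def)
  then show ?thesis
    using char_E_between[of L "Min Z" l "Max Z" h c] Z L by (cases "l = Min Z \<or> l = Max Z") (auto simp: Z_def)
qed

text \<open>\<open>\<Phi>\<close> is strictly increasing, with
  \<open>\<Phi> p = - q * exp (- h * p)\<close> negative and \<open>\<Phi> 0 = - (p + q)\<close>
  nonnegative; so its only zero lies in \<open>{p<..0}\<close>.\<close>

lemma delay_exponent_exists:
  fixes h p q :: real
  assumes h: "0 < h" and q: "0 < q" and pq: "p + q \<le> 0"
  obtains \<gamma> where "\<gamma> \<le> 0" "p < \<gamma>" "\<And>x. x - p = q * exp (- h * x) \<longleftrightarrow> x = \<gamma>"
proof -
  define \<Phi> where "\<Phi> x = x - p - q * exp (- h * x)" for x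
  have mono: "\<Phi> x < \<Phi> y" if "x < y" for x y
  proof -
    have "exp (- h * y) < exp (- h * x)" using that h by simp
    then have "q * exp (- h * y) < q * exp (- h * x)" using q by (intro mult_strict_left_mono) auto
    then show ?thesis using that by (simp add: \<Phi>_def)
  qed
  have p0: "p < 0" using q pq by simp
  have "\<Phi> p \<le> 0" "0 \<le> \<Phi> 0" using q pq by (auto simp: \<Phi>_def)
  moreover have "continuous_on {p..0} \<Phi>" unfolding \<Phi>_def by (intro continuous_intros)
  ultimately obtain \<gamma> where \<gamma>: "p \<le> \<gamma>" "\<gamma> \<le> 0" "\<Phi> \<gamma> = 0"
    using IVT'[of \<Phi> p 0 0] p0 by auto
  have "\<Phi> p < 0" using q by (simp add: \<Phi>_def)
  then have "p < \<gamma>" using \<gamma> by (cases "p = \<gamma>") auto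
  moreover have "x - p = q * exp (- h * x) \<longleftrightarrow> x = \<gamma>" for x
  proof -
    have "x - p = q * exp (- h * x) \<longleftrightarrow> \<Phi> x = 0" by (auto simp: \<Phi>_def)
    also have "\<dots> \<longleftrightarrow> x = \<gamma>" using mono[of x \<gamma>] mono[of \<gamma> x] \<gamma>(3) by (cases x \<gamma> rule: linorder_cases) auto
    finally show ?thesis .
  qed
  ultimately show ?thesis using \<gamma>(2) that by blast
qed

theorem theorem3:
  fixes h Lg \<kappa> c lam m p q Cu0 :: real
    and g :: "real \<Rightarrow> real"
    and v0 \<psi>0 v \<psi> u0 u :: "real \<Rightarrow> real \<Rightarrow> real"
  assumes "h > 0"
    and "g ` {0..} \<subseteq> {0..}"
    and "Lg > 1"
    and "Lg-lipschitz_on {0..} g"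
    and "\<kappa> > 0"
    and "{x\<in>{0..}. g x = x} = {0, \<kappa>}"
    and "c \<ge> c_min h Lg"
    and "lam \<in> {lambda1 h Lg c .. lambda2 h Lg c}"
    and "delayed_rd_solution h c g v0 v"
    and "delayed_rd_solution h c g \<psi>0 \<psi>"
    and "u0 = (\<lambda>s z. xi lam z * \<bar>v0 s z - \<psi>0 s z\<bar>)"
    and "continuous_L1_on {-h..0} u0"
    and "m = 2 * lam - c"
    and "p = lam\<^sup>2 - c * lam - 1"
    and "q = Lg * exp (- lam * c * h)"
    and "delayed_mild_solution h m p q (c * h) u0 u"
    and "Cu0 = (SUP s\<in>{-h..0}. L1_norm (u0 s))"
  shows "(\<forall>t\<ge>-h. \<forall>z. xi lam z * \<bar>v t z - \<psi> t z\<bar> \<le> u t z) \<and>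
    (\<exists>\<gamma>\<le>0. (\<forall>x. x - p = q * exp (- h * x) \<longleftrightarrow> x = \<gamma>) \<and>
      (\<forall>t>h/2. \<forall>z. \<bar>v t z - \<psi> t z\<bar> \<le>
         (1/2 * Cu0 * sqrt (1 + h * (\<gamma> - p))) * xi lam (-z) * (exp (\<gamma> * t) / sqrt t)))"
proof -
  let ?d = "c * h"
  \<comment> \<open>\<open>p + q\<close> is \<open>- char_E h Lg c lam\<close>.\<close>
  have pq: "p + q \<le> 0"
    using char_E_nonneg_between_roots[OF assms(1,3,7,8)] by (simp add: char_E_def assms(14,15))
  have q: "0 < q" using assms(3) by (simp add: assms(15))
  have p: "p \<le> 0" using pq q by simp
  obtain \<gamma> where \<gamma>: "\<gamma> \<le> 0" "p < \<gamma>" "\<And>x. x - p = q * exp (- h * x) \<longleftrightarrow> x = \<gamma>"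
    using delay_exponent_exists[OF assms(1) q pq] by blast
  have dom: "xi lam z * \<bar>v t z - \<psi> t z\<bar> \<le> u t z" if "- h \<le> t" for t z
    using mild_solution_dominates[OF assms(1,2,4,9,10,11,13,14) p assms(15,16) that] .
  \<comment> \<open>The domination already shows that \<open>u\<close> is nonnegative, as required
    for the interpretation of \<open>u\<close> as a mean.\<close>
  have nonneg: "0 \<le> u t z" if "- h \<le> t" for t z
    using dom[OF that, of z] by (meson abs_ge_zero mult_nonneg_nonneg order_trans xi_nonneg)
  have "compact ((\<lambda>s. L1_norm (u0 s)) ` {-h..0})"
    by (intro compact_continuous_image continuous_on_L1_norm assms(12) compact_Icc)
  then have bdd: "bdd_above ((\<lambda>s. L1_norm (u0 s)) ` {-h..0})"
    by (intro bounded_imp_bdd_above compact_imp_bounded)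
  have Cu0: "L1_norm (u0 s) \<le> Cu0" if "s \<in> {-h..0}" for s
    unfolding assms(17) by (rule cSUP_upper[OF that bdd])
  have "0 \<le> L1_norm (u0 0)" by (simp add: L1_norm_def)
  then have Cu00: "0 \<le> Cu0" using Cu0[of 0] assms(1) by simp
  have decay: "u t z \<le> 1/2 * Cu0 * sqrt (1 + h * (\<gamma> - p)) * (exp (\<gamma> * t) / sqrt t)" if t: "0 < t" for t z
  \<comment> \<open>\<open>Cu0\<close> may be 0, while the normalisation in
    \<open>mild_solution_decay\<close> divides by its constant; so the estimate is used with
    \<open>Cu0 + \<epsilon>\<close>.\<close>
  proof (rule field_le_epsilon)
    fix e :: real assume e: "0 < e"
    define K where "K = 1/2 * sqrt (1 + h * (\<gamma> - p)) * (exp (\<gamma> * t) / sqrt t)"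
    have K: "0 \<le> K" using assms(1) \<gamma>(2) t by (auto simp: K_def intro!: mult_nonneg_nonneg)
    define \<epsilon> where "\<epsilon> = e / (K + 1)"
    have \<epsilon>: "0 < \<epsilon>" "\<epsilon> * K \<le> e" using e K by (auto simp: \<epsilon>_def field_simps)
    have "u t z \<le> 1/2 * (Cu0 + \<epsilon>) * sqrt (1 + h * (\<gamma> - p)) * (exp (\<gamma> * t) / sqrt t)"
    proof (rule mild_solution_decay[OF assms(1) p q assms(16) nonneg \<gamma>(1,2)])
      show "\<gamma> - p = q * exp (- h * \<gamma>)" using \<gamma>(3) by blast
      show "L1_norm (u0 s) \<le> Cu0 + \<epsilon>" if "s \<in> {-h..0}" for s using Cu0[OF that] \<epsilon>(1) by simp
    qed (use Cu00 \<epsilon>(1) t in auto)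
    also have "\<dots> = Cu0 * K + \<epsilon> * K" by (simp add: K_def algebra_simps)
    also have "\<dots> \<le> Cu0 * K + e" using \<epsilon>(2) by simp
    also have "Cu0 * K = 1/2 * Cu0 * sqrt (1 + h * (\<gamma> - p)) * (exp (\<gamma> * t) / sqrt t)" by (simp add: K_def)
    finally show "u t z \<le> 1/2 * Cu0 * sqrt (1 + h * (\<gamma> - p)) * (exp (\<gamma> * t) / sqrt t) + e" .
  qed
  have "\<bar>v t z - \<psi> t z\<bar> \<le> (1/2 * Cu0 * sqrt (1 + h * (\<gamma> - p))) * xi lam (-z) * (exp (\<gamma> * t) / sqrt t)"
    if t: "h / 2 < t" for t z
  proof -
    have t0: "0 < t" "- h \<le> t" using t assms(1) by auto
    have "xi lam (-z) * xi lam z = 1" by (simp add: xi_def flip: exp_add)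
    then have "\<bar>v t z - \<psi> t z\<bar> = xi lam (-z) * (xi lam z * \<bar>v t z - \<psi> t z\<bar>)"
      by (simp flip: mult.assoc)
    also have "\<dots> \<le> xi lam (-z) * (1/2 * Cu0 * sqrt (1 + h * (\<gamma> - p)) * (exp (\<gamma> * t) / sqrt t))"
      using dom[OF t0(2), of z] decay[OF t0(1), of z] by (intro mult_left_mono) auto
    finally show ?thesis by (simp only: mult_ac)
  qed
  with dom \<gamma> show ?thesis by blast
qed

end
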